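(* Let $S=\mathrm{Aut}(F_n)$ with $n\geqslant 1$, or $S=B_n$ with $n\geqslant 3$. Then $\mathrm{Var}_k(S)\leqslant 3n$ and $\mathrm{Crem}_k(S)\leqslant 3n$.
   Context: $k$ is a fixed algebraically closed field. $F_n$ is the free group of rank $n$ and $B_n$ is the braid group on $n$ strands. For any group $S$, $\mathrm{Var}_k(S)$ denotes the minimal dimension of irreducible algebraic varieties $Z$ defined over $k$ such that $S$ embeds (via an injective group homomorphism) into the group $\mathrm{Aut}(Z)$ of biregular automorphisms of $Z$; set $\mathrm{Var}_k(S)=\infty$ if there is no such $Z$. Similarly, $\mathrm{Crem}_k(S)$ denotes the minimal rank of Cremona groups over $k$ into which $S$ embeds, and $\mathrm{Crem}_k(S)=\infty$ if there are none; here the Cremona group of rank $m$ is the group of birational self-maps of the projective space $\mathbb P^m$ over $k$. *)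

theory Defs
  imports
    "HOL-Analysis.Abstract_Topology"
    "HOL-Library.Poly_Mapping"
    "HOL-Library.Extended_Nat"
    "HOL-Computational_Algebra.Polynomial"
    "HOL-Algebra.Bij"
begin

section \<open>Group presentations, free groups and braid groups\<close>

text \<open>A letter is a pair of a sign and a generator; \<open>(True, x)\<close> stands for \<open>x\<close> and
  \<open>(False, x)\<close> for its formal inverse.\<close>

type_synonym 'a word = "(bool \<times> 'a) list"

definition words :: "'a set \<Rightarrow> 'a word set" where
  "words X = lists (UNIV \<times> X)"

inductive pres_eq :: "'a set \<Rightarrow> ('a word \<times> 'a word) set \<Rightarrow> 'a word \<Rightarrow> 'a word \<Rightarrow> bool"
  for X :: "'a set" and R :: "('a word \<times> 'a word) set" where
  refl: "w \<in> words X \<Longrightarrow> pres_eq X R w w"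
| sym: "pres_eq X R v w \<Longrightarrow> pres_eq X R w v"
| trans: "pres_eq X R u v \<Longrightarrow> pres_eq X R v w \<Longrightarrow> pres_eq X R u w"
| append: "pres_eq X R u v \<Longrightarrow> pres_eq X R u' v' \<Longrightarrow> pres_eq X R (u @ u') (v @ v')"
| cancel: "x \<in> X \<Longrightarrow> pres_eq X R [(b, x), (\<not> b, x)] []"
| relation: "(u, v) \<in> R \<Longrightarrow> u \<in> words X \<Longrightarrow> v \<in> words X \<Longrightarrow> pres_eq X R u v"

definition pres_rel :: "'a set \<Rightarrow> ('a word \<times> 'a word) set \<Rightarrow> ('a word \<times> 'a word) set" where
  "pres_rel X R = {(u, v). pres_eq X R u v}"

text \<open>The group \<open>\<langle> X | u = v for (u, v) \<in> R \<rangle>\<close>.\<close>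

definition presented_group ::
    "'a set \<Rightarrow> ('a word \<times> 'a word) set \<Rightarrow> 'a word set monoid" where
  "presented_group X R =
    \<lparr>carrier = words X // pres_rel X R,
     mult = (\<lambda>A B. \<Union>u\<in>A. \<Union>v\<in>B. pres_rel X R `` {u @ v}),
     one = pres_rel X R `` {[]}\<rparr>"

definition free_group :: "nat \<Rightarrow> nat word set monoid" where
  "free_group n = presented_group {..<n} {}"

text \<open>Artin's presentation; the generators are numbered from 0 to \<open>n - 2\<close>.\<close>

definition braid_relations :: "(nat word \<times> nat word) set" where
  "braid_relations =
    {([(True, i), (True, j)], [(True, j), (True, i)]) | i j. i + 2 \<le> j} \<union>
    {([(True, i), (True, Suc i), (True, i)], [(True, Suc i), (True, i), (True, Suc i)]) | i. True}"

definition braid_group :: "nat \<Rightarrow> nat word set monoid" where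
  "braid_group n = presented_group {..<n - 1} braid_relations"

lemma pres_eq_words: "pres_eq X R u v \<Longrightarrow> u \<in> words X \<and> v \<in> words X"
  by (induction rule: pres_eq.induct) (auto simp: words_def)

lemma equiv_pres_rel: "equiv (words X) (pres_rel X R)"
proof (rule equivI)
  show "pres_rel X R \<subseteq> words X \<times> words X"
    unfolding pres_rel_def using pres_eq_words[of X R] by blast
  show "refl_on (words X) (pres_rel X R)"
    unfolding refl_on_def pres_rel_def using pres_eq.refl[of _ X R] by blast
  show "Relation.sym (pres_rel X R)"
  proof (rule symI)
    fix u v assume "(u, v) \<in> pres_rel X R"
    then show "(v, u) \<in> pres_rel X R" unfolding pres_rel_def by (simp add: pres_eq.sym)
  qed
  show "Relation.trans (pres_rel X R)"
  proof (rule transI)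
    fix u v w assume "(u, v) \<in> pres_rel X R" "(v, w) \<in> pres_rel X R"
    then have "pres_eq X R u v" "pres_eq X R v w" by (simp_all add: pres_rel_def)
    then show "(u, w) \<in> pres_rel X R" unfolding pres_rel_def using pres_eq.trans[of X R u v w] by simp
  qed
qed

lemma presented_group_mult:
  assumes "u \<in> words X" "v \<in> words X"
  shows "pres_rel X R `` {u} \<otimes>\<^bsub>presented_group X R\<^esub> pres_rel X R `` {v} = pres_rel X R `` {u @ v}"
proof -
  have eq: "pres_rel X R `` {u' @ v'} = pres_rel X R `` {u @ v}"
    if "u' \<in> pres_rel X R `` {u}" "v' \<in> pres_rel X R `` {v}" for u' v'
  proof (rule equiv_class_eq[OF equiv_pres_rel])
    have "pres_eq X R u u'" "pres_eq X R v v'" using that by (auto simp: pres_rel_def)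
    from pres_eq.sym[OF pres_eq.append[OF this]]
    show "(u' @ v', u @ v) \<in> pres_rel X R" by (simp add: pres_rel_def)
  qed
  have "u \<in> pres_rel X R `` {u}" "v \<in> pres_rel X R `` {v}"
    using assms by (auto simp: pres_rel_def intro: pres_eq.refl)
  then have "(\<Union>u'\<in>pres_rel X R `` {u}. \<Union>v'\<in>pres_rel X R `` {v}. pres_rel X R `` {u' @ v'})
      = pres_rel X R `` {u @ v}"
    using eq by blast
  then show ?thesis by (simp add: presented_group_def)
qed

lemma pres_eq_inverse:
  "w \<in> words X \<Longrightarrow> pres_eq X R (rev (map (\<lambda>(b, x). (\<not> b, x)) w) @ w) []"
proof (induction w)
  case Nil
  then show ?case by (auto intro: pres_eq.refl)
next
  case (Cons a w)
  obtain b x where a: "a = (b, x)" by (cases a)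
  let ?v = "rev (map (\<lambda>(b, x). (\<not> b, x)) w)"
  have w: "w \<in> words X" and x: "x \<in> X" using Cons.prems a by (auto simp: words_def)
  have v: "?v \<in> words X" using w by (auto simp: words_def)
  have "pres_eq X R [(\<not> b, x), (b, x)] []"
    using pres_eq.cancel[OF x, of R "\<not> b"] by simp
  from pres_eq.append[OF pres_eq.refl[OF v] pres_eq.append[OF this pres_eq.refl[OF w]]]
  have "pres_eq X R (?v @ [(\<not> b, x), (b, x)] @ w) (?v @ w)" by simp
  with Cons.IH[OF w] have "pres_eq X R (?v @ [(\<not> b, x), (b, x)] @ w) []"
    by (rule pres_eq.trans[rotated])
  then show ?case using a by simp
qed

lemma group_presented_group: "group (presented_group X R)"
proof (rule groupI)
  let ?G = "presented_group X R" and ?c = "\<lambda>w. pres_rel X R `` {w}"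
  have C: "A \<in> carrier ?G \<longleftrightarrow> (\<exists>w\<in>words X. A = ?c w)" for A
    by (auto simp: presented_group_def quotient_def)
  have one: "\<one>\<^bsub>?G\<^esub> = ?c []" by (simp add: presented_group_def)
  have app: "u @ v \<in> words X" if "u \<in> words X" "v \<in> words X" for u v
    using that by (auto simp: words_def)
  have nil: "[] \<in> words X" by (simp add: words_def)
  show "A \<otimes>\<^bsub>?G\<^esub> B \<in> carrier ?G" if AB: "A \<in> carrier ?G" "B \<in> carrier ?G" for A B
  proof -
    obtain u v where "u \<in> words X" "A = ?c u" "v \<in> words X" "B = ?c v"
      using AB unfolding C by blast
    then have "A \<otimes>\<^bsub>?G\<^esub> B = ?c (u @ v)" "u @ v \<in> words X"
      by (simp_all add: presented_group_mult app)
    then show ?thesis unfolding C by blast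
  qed
  show "\<one>\<^bsub>?G\<^esub> \<in> carrier ?G" using nil unfolding C one by blast
  show "A \<otimes>\<^bsub>?G\<^esub> B \<otimes>\<^bsub>?G\<^esub> D = A \<otimes>\<^bsub>?G\<^esub> (B \<otimes>\<^bsub>?G\<^esub> D)"
    if "A \<in> carrier ?G" "B \<in> carrier ?G" "D \<in> carrier ?G" for A B D
    using that unfolding C by (auto simp: presented_group_mult app)
  show "\<one>\<^bsub>?G\<^esub> \<otimes>\<^bsub>?G\<^esub> A = A" if "A \<in> carrier ?G" for A
    using that nil unfolding C one by (auto simp: presented_group_mult)
  show "\<exists>B\<in>carrier ?G. B \<otimes>\<^bsub>?G\<^esub> A = \<one>\<^bsub>?G\<^esub>" if A0: "A \<in> carrier ?G" for A
  proof -
    obtain w where w: "w \<in> words X" and A: "A = ?c w" using A0 unfolding C by blast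
    let ?v = "rev (map (\<lambda>(b, x). (\<not> b, x)) w)"
    have v: "?v \<in> words X" using w by (auto simp: words_def)
    have "?c (?v @ w) = ?c []"
      by (rule equiv_class_eq[OF equiv_pres_rel]) (simp add: pres_rel_def pres_eq_inverse[OF w])
    then have "?c ?v \<otimes>\<^bsub>?G\<^esub> A = \<one>\<^bsub>?G\<^esub>"
      using presented_group_mult[OF v w] A one by simp
    moreover have "?c ?v \<in> carrier ?G" using v C by blast
    ultimately show ?thesis by blast
  qed
qed


section \<open>Polynomials in several variables\<close>

type_synonym 'k mpol = "(nat \<Rightarrow>\<^sub>0 nat) \<Rightarrow>\<^sub>0 'k"

definition polys :: "nat \<Rightarrow> 'k::comm_semiring_1 mpol set" where
  "polys n = {f. \<forall>m\<in>Poly_Mapping.keys f. Poly_Mapping.keys m \<subseteq> {..<n}}"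

definition homogeneous :: "nat \<Rightarrow> 'k::comm_semiring_1 mpol \<Rightarrow> bool" where
  "homogeneous d f \<longleftrightarrow>
    (\<forall>m\<in>Poly_Mapping.keys f. (\<Sum>i\<in>Poly_Mapping.keys m. Poly_Mapping.lookup m i) = d)"

definition mono_eval :: "(nat \<Rightarrow>\<^sub>0 nat) \<Rightarrow> 'k::comm_semiring_1 list \<Rightarrow> 'k" where
  "mono_eval m x = (\<Prod>i\<in>Poly_Mapping.keys m. (x ! i) ^ Poly_Mapping.lookup m i)"

definition mpeval :: "'k::comm_semiring_1 mpol \<Rightarrow> 'k list \<Rightarrow> 'k" where
  "mpeval f x = (\<Sum>m\<in>Poly_Mapping.keys f. Poly_Mapping.lookup f m * mono_eval m x)"

lemma mono_eval_superset:
  assumes "finite I" "Poly_Mapping.keys m \<subseteq> I"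
  shows "mono_eval m x = (\<Prod>i\<in>I. (x ! i) ^ Poly_Mapping.lookup m i)"
  unfolding mono_eval_def using assms
  by (intro prod.mono_neutral_left) (auto simp: in_keys_iff)

lemma mono_eval_add: "mono_eval (m + m') x = mono_eval m x * mono_eval m' x"
proof -
  let ?I = "Poly_Mapping.keys m \<union> Poly_Mapping.keys m'"
  have "mono_eval (m + m') x = (\<Prod>i\<in>?I. (x ! i) ^ Poly_Mapping.lookup (m + m') i)"
    by (rule mono_eval_superset) (use Poly_Mapping.keys_add[of m m'] in auto)
  also have "\<dots> = mono_eval m x * mono_eval m' x"
    by (simp add: mono_eval_superset[of ?I] lookup_add power_add prod.distrib)
  finally show ?thesis .
qed

lemma mpeval_superset:
  assumes "finite I" "Poly_Mapping.keys f \<subseteq> I"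
  shows "mpeval f x = (\<Sum>m\<in>I. Poly_Mapping.lookup f m * mono_eval m x)"
  unfolding mpeval_def using assms
  by (intro sum.mono_neutral_left) (auto simp: in_keys_iff)

lemma mpeval_zero [simp]: "mpeval 0 x = 0"
  by (simp add: mpeval_def)

lemma mpeval_add: "mpeval (f + g) x = mpeval f x + mpeval g x"
proof -
  let ?I = "Poly_Mapping.keys f \<union> Poly_Mapping.keys g"
  have "mpeval (f + g) x = (\<Sum>m\<in>?I. Poly_Mapping.lookup (f + g) m * mono_eval m x)"
    by (rule mpeval_superset) (use Poly_Mapping.keys_add[of f g] in auto)
  also have "\<dots> = mpeval f x + mpeval g x"
    by (simp add: mpeval_superset[of ?I] lookup_add distrib_right sum.distrib)
  finally show ?thesis .
qed

lemma mpeval_sum: "mpeval (\<Sum>i\<in>I. f i) x = (\<Sum>i\<in>I. mpeval (f i) x)"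
  by (induction I rule: infinite_finite_induct) (auto simp: mpeval_add)

lemma mpeval_single: "mpeval (Poly_Mapping.single m c) x = c * mono_eval m x"
  by (cases "c = 0") (auto simp: mpeval_def)

lemma mpeval_one [simp]: "mpeval 1 x = 1"
  by (simp add: mpeval_def mono_eval_def lookup_one)

lemma mpol_expand:
  "(\<Sum>m\<in>Poly_Mapping.keys f. Poly_Mapping.single m (Poly_Mapping.lookup f m)) = f"
  by (rule poly_mapping_eqI)
     (auto simp: lookup_sum lookup_single when_def in_keys_iff)

lemma mpeval_mult: "mpeval (f * g) x = mpeval f x * mpeval g x"
proof -
  have "f * g = (\<Sum>m\<in>Poly_Mapping.keys f. Poly_Mapping.single m (Poly_Mapping.lookup f m)) *
      (\<Sum>m'\<in>Poly_Mapping.keys g. Poly_Mapping.single m' (Poly_Mapping.lookup g m'))"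
    by (simp only: mpol_expand)
  also have "\<dots> = (\<Sum>m\<in>Poly_Mapping.keys f. \<Sum>m'\<in>Poly_Mapping.keys g.
      Poly_Mapping.single (m + m') (Poly_Mapping.lookup f m * Poly_Mapping.lookup g m'))"
    by (simp only: sum_product mult_single)
  also have "mpeval \<dots> x = (\<Sum>m\<in>Poly_Mapping.keys f. \<Sum>m'\<in>Poly_Mapping.keys g.
      (Poly_Mapping.lookup f m * mono_eval m x) * (Poly_Mapping.lookup g m' * mono_eval m' x))"
    by (simp only: mpeval_sum mpeval_single mono_eval_add mult_ac)
  also have "\<dots> = mpeval f x * mpeval g x"
    by (simp only: mpeval_def sum_product)
  finally show ?thesis .
qed

lemma polys_one [simp]: "1 \<in> polys n"
  by (simp add: polys_def)

lemma homogeneous_one [simp]: "homogeneous 0 1"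
  by (simp add: homogeneous_def)

lemma polys_mult:
  assumes "f \<in> polys n" "g \<in> polys n" shows "f * g \<in> polys n"
  unfolding polys_def
proof (intro CollectI ballI)
  fix m assume "m \<in> Poly_Mapping.keys (f * g)"
  then obtain a b where "m = a + b" "a \<in> Poly_Mapping.keys f" "b \<in> Poly_Mapping.keys g"
    using Poly_Mapping.keys_mult[of f g] by blast
  then show "Poly_Mapping.keys m \<subseteq> {..<n}"
    using assms Poly_Mapping.keys_add[of a b] unfolding polys_def by blast
qed

lemma homogeneous_mult:
  assumes "homogeneous d f" "homogeneous e g" shows "homogeneous (d + e) (f * g)"
  unfolding homogeneous_def
proof
  fix m assume "m \<in> Poly_Mapping.keys (f * g)"
  then obtain a b where m: "m = a + b" and ab: "a \<in> Poly_Mapping.keys f" "b \<in> Poly_Mapping.keys g"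
    using Poly_Mapping.keys_mult[of f g] by blast
  let ?I = "Poly_Mapping.keys a \<union> Poly_Mapping.keys b"
  have *: "(\<Sum>i\<in>Poly_Mapping.keys c. Poly_Mapping.lookup c i) = (\<Sum>i\<in>?I. Poly_Mapping.lookup c i)"
    if "Poly_Mapping.keys c \<subseteq> ?I" for c :: "nat \<Rightarrow>\<^sub>0 nat"
    using that by (intro sum.mono_neutral_left) (auto simp: in_keys_iff)
  have "(\<Sum>i\<in>Poly_Mapping.keys m. Poly_Mapping.lookup m i)
      = (\<Sum>i\<in>?I. Poly_Mapping.lookup a i) + (\<Sum>i\<in>?I. Poly_Mapping.lookup b i)"
    using *[of m] Poly_Mapping.keys_add[of a b] m by (simp add: lookup_add sum.distrib)
  also have "\<dots> = d + e"
    using *[of a] *[of b] ab assms by (simp add: homogeneous_def)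
  finally show "(\<Sum>i\<in>Poly_Mapping.keys m. Poly_Mapping.lookup m i) = d + e" .
qed


section \<open>Irreducibility and dimension of topological spaces\<close>

definition irreducible_in :: "'p topology \<Rightarrow> 'p set \<Rightarrow> bool" where
  "irreducible_in T A \<longleftrightarrow> A \<subseteq> topspace T \<and> A \<noteq> {} \<and>
    (\<forall>F G. closedin T F \<longrightarrow> closedin T G \<longrightarrow> A \<subseteq> F \<union> G \<longrightarrow> A \<subseteq> F \<or> A \<subseteq> G)"

definition top_dim :: "'p topology \<Rightarrow> enat" where
  "top_dim T = Sup {enat l | l. \<exists>C :: nat \<Rightarrow> 'p set.
     (\<forall>i\<le>l. closedin T (C i) \<and> irreducible_in T (C i)) \<and> (\<forall>i<l. C i \<subset> C (Suc i))}"


section \<open>Varieties over an algebraically closed field\<close>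

text \<open>A variety is a space with a sheaf of \<open>k\<close>-valued functions that is locally isomorphic to
  an affine algebraic set. Functions are total in HOL, so a function on \<open>U\<close> is represented by
  any total function extending it: \<open>regular X U f\<close> says that the restriction of \<open>f\<close> to \<open>U\<close>
  is a regular function on \<open>U\<close>.\<close>

record ('p, 'k) fspace =
  Top :: "'p topology"
  regular :: "'p set \<Rightarrow> ('p \<Rightarrow> 'k) \<Rightarrow> bool"

definition space_with_functions :: "('p, 'k::field) fspace \<Rightarrow> bool" where
  "space_with_functions X \<longleftrightarrow>
    (\<forall>U f g. openin (Top X) U \<longrightarrow> (\<forall>x\<in>U. f x = g x) \<longrightarrow> regular X U f \<longrightarrow> regular X U g) \<and>
    (\<forall>U c. openin (Top X) U \<longrightarrow> regular X U (\<lambda>_. c)) \<and>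
    (\<forall>U f g. openin (Top X) U \<longrightarrow> regular X U f \<longrightarrow> regular X U g \<longrightarrow>
       regular X U (\<lambda>x. f x + g x) \<and> regular X U (\<lambda>x. f x * g x)) \<and>
    (\<forall>U V f. openin (Top X) U \<longrightarrow> openin (Top X) V \<longrightarrow> V \<subseteq> U \<longrightarrow> regular X U f \<longrightarrow> regular X V f) \<and>
    (\<forall>\<U> f. (\<forall>U\<in>\<U>. openin (Top X) U \<and> regular X U f) \<longrightarrow> regular X (\<Union>\<U>) f)"

definition morphism :: "('p, 'k) fspace \<Rightarrow> ('q, 'k) fspace \<Rightarrow> ('p \<Rightarrow> 'q) \<Rightarrow> bool" where
  "morphism X Y \<phi> \<longleftrightarrow> continuous_map (Top X) (Top Y) \<phi> \<and>
    (\<forall>V g. openin (Top Y) V \<longrightarrow> regular Y V g \<longrightarrow>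
       regular X {x \<in> topspace (Top X). \<phi> x \<in> V} (g \<circ> \<phi>))"

definition isomorphic :: "('p, 'k) fspace \<Rightarrow> ('q, 'k) fspace \<Rightarrow> bool" where
  "isomorphic X Y \<longleftrightarrow> (\<exists>\<phi> \<psi>. morphism X Y \<phi> \<and> morphism Y X \<psi> \<and>
     (\<forall>x\<in>topspace (Top X). \<psi> (\<phi> x) = x) \<and> (\<forall>y\<in>topspace (Top Y). \<phi> (\<psi> y) = y))"

definition open_subspace :: "('p, 'k) fspace \<Rightarrow> 'p set \<Rightarrow> ('p, 'k) fspace" where
  "open_subspace X U = \<lparr>Top = subtopology (Top X) U, regular = regular X\<rparr>"

definition affine_points :: "nat \<Rightarrow> 'k list set" where
  "affine_points n = {x. length x = n}"

definition affine_zeros :: "nat \<Rightarrow> 'k::field mpol set \<Rightarrow> 'k list set" where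
  "affine_zeros n F = {x \<in> affine_points n. \<forall>f\<in>F. mpeval f x = 0}"

definition affine_zariski :: "nat \<Rightarrow> 'k::field list topology" where
  "affine_zariski n =
    topology (\<lambda>U. \<exists>F\<subseteq>polys n. U = affine_points n - affine_zeros n F)"

text \<open>The algebraic set \<open>Z\<close> in affine \<open>n\<close>-space, with the induced topology and the functions
  that are locally quotients of polynomials.\<close>

definition algebraic_set :: "nat \<Rightarrow> 'k::field list set \<Rightarrow> ('k list, 'k) fspace" where
  "algebraic_set n Z = \<lparr>Top = subtopology (affine_zariski n) Z,
     regular = (\<lambda>U f. \<forall>p\<in>U. \<exists>g\<in>polys n. \<exists>h\<in>polys n. \<exists>W.
       openin (subtopology (affine_zariski n) Z) W \<and> p \<in> W \<and> W \<subseteq> U \<and>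
       (\<forall>x\<in>W. mpeval h x \<noteq> 0 \<and> f x = mpeval g x / mpeval h x))\<rparr>"

definition affine_variety :: "('p, 'k::field) fspace \<Rightarrow> bool" where
  "affine_variety X \<longleftrightarrow> space_with_functions X \<and>
    (\<exists>n Z. closedin (affine_zariski n) Z \<and> isomorphic X (algebraic_set n Z))"

definition prevariety :: "('p, 'k::field) fspace \<Rightarrow> bool" where
  "prevariety X \<longleftrightarrow> space_with_functions X \<and>
    (\<exists>\<U>. finite \<U> \<and> \<Union>\<U> = topspace (Top X) \<and>
      (\<forall>U\<in>\<U>. openin (Top X) U \<and> affine_variety (open_subspace X U)))"

text \<open>Separatedness, in the form that two morphisms from an affine variety agree on a closed
  set; this avoids the construction of the product \<open>X \<times> X\<close>.\<close>

definition separated :: "('p, 'k::field) fspace \<Rightarrow> bool" where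
  "separated X \<longleftrightarrow> (\<forall>n Z \<phi> \<psi>. closedin (affine_zariski n) Z \<longrightarrow>
     morphism (algebraic_set n Z) X \<phi> \<longrightarrow> morphism (algebraic_set n Z) X \<psi> \<longrightarrow>
     closedin (affine_zariski n) {z \<in> Z. \<phi> z = \<psi> z})"

definition variety :: "('p, 'k::field) fspace \<Rightarrow> bool" where
  "variety X \<longleftrightarrow> prevariety X \<and> separated X"

definition irreducible_variety :: "('p, 'k::field) fspace \<Rightarrow> bool" where
  "irreducible_variety X \<longleftrightarrow> variety X \<and> irreducible_in (Top X) (topspace (Top X))"

lemma istopology_affine_zariski:
  "istopology (\<lambda>U. \<exists>F\<subseteq>polys n. U = affine_points n - affine_zeros n (F :: 'k::field mpol set))"
  unfolding istopology_def
proof (intro conjI allI impI)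
  fix U V :: "'k list set"
  assume "\<exists>F\<subseteq>polys n. U = affine_points n - affine_zeros n F"
    and "\<exists>F\<subseteq>polys n. V = affine_points n - affine_zeros n F"
  then obtain F G where FG: "F \<subseteq> polys n" "U = affine_points n - affine_zeros n F"
      "G \<subseteq> polys n" "V = affine_points n - affine_zeros n G" by blast
  let ?H = "{f * g | f g. f \<in> F \<and> g \<in> G}"
  have "?H \<subseteq> polys n" using FG polys_mult by blast
  moreover have "U \<inter> V = affine_points n - affine_zeros n ?H"
  proof (intro equalityI subsetI)
    fix x assume "x \<in> U \<inter> V"
    then obtain f g where "x \<in> affine_points n" "f \<in> F" "g \<in> G" "mpeval f x \<noteq> 0" "mpeval g x \<noteq> 0"
      unfolding FG affine_zeros_def by blast
    moreover from this have "mpeval (f * g) x \<noteq> 0" by (simp add: mpeval_mult)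
    ultimately show "x \<in> affine_points n - affine_zeros n ?H" unfolding affine_zeros_def by blast
  next
    fix x assume "x \<in> affine_points n - affine_zeros n ?H"
    then obtain f g where "x \<in> affine_points n" "f \<in> F" "g \<in> G" "mpeval (f * g) x \<noteq> 0"
      unfolding affine_zeros_def by blast
    moreover from this have "mpeval f x \<noteq> 0" "mpeval g x \<noteq> 0" by (auto simp: mpeval_mult)
    ultimately show "x \<in> U \<inter> V" unfolding FG affine_zeros_def by blast
  qed
  ultimately show "\<exists>F\<subseteq>polys n. U \<inter> V = affine_points n - affine_zeros n F" by blast
next
  fix \<U> :: "'k list set set"
  assume "\<forall>U\<in>\<U>. \<exists>F\<subseteq>polys n. U = affine_points n - affine_zeros n F"
  then obtain F where F: "\<And>U. U \<in> \<U> \<Longrightarrow> F U \<subseteq> polys n"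
      "\<And>U. U \<in> \<U> \<Longrightarrow> U = affine_points n - affine_zeros n (F U)" by metis
  have "\<Union>\<U> = (\<Union>U\<in>\<U>. affine_points n - affine_zeros n (F U))"
    using SUP_cong[OF HOL.refl F(2), of \<U> "\<lambda>U. U"] by simp
  also have "\<dots> = affine_points n - affine_zeros n (\<Union>U\<in>\<U>. F U)"
    unfolding affine_zeros_def by auto
  finally show "\<exists>F\<subseteq>polys n. \<Union>\<U> = affine_points n - affine_zeros n F"
    by (intro exI[of _ "\<Union>U\<in>\<U>. F U"] conjI UN_least F(1))
qed

lemma openin_affine_zariski:
  "openin (affine_zariski n) U \<longleftrightarrow> (\<exists>F\<subseteq>polys n. U = affine_points n - affine_zeros n F)"
  by (simp add: affine_zariski_def topology_inverse'[OF istopology_affine_zariski])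

lemma topspace_affine_zariski [simp]: "topspace (affine_zariski n) = affine_points n"
proof -
  have "openin (affine_zariski n) (affine_points n)"
    unfolding openin_affine_zariski
    by (intro exI[of _ "{1}"]) (auto simp: affine_zeros_def)
  moreover have "U \<subseteq> affine_points n" if "openin (affine_zariski n) U" for U :: "'a list set"
    using that unfolding openin_affine_zariski by auto
  ultimately show ?thesis by (meson openin_subset openin_topspace subset_antisym)
qed

lemma closedin_affine_zariski:
  "closedin (affine_zariski n) Z \<longleftrightarrow> (\<exists>F\<subseteq>polys n. Z = affine_zeros n F)"
proof -
  have sub: "affine_zeros n F \<subseteq> affine_points n" for F :: "'a mpol set"
    by (auto simp: affine_zeros_def)
  have "Z = affine_zeros n F \<longleftrightarrow>
      Z \<subseteq> affine_points n \<and> affine_points n - Z = affine_points n - affine_zeros n F" for F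
    using sub[of F] by blast
  then show ?thesis by (auto simp: closedin_def openin_affine_zariski)
qed


section \<open>Automorphism groups of varieties\<close>

definition Aut_variety :: "('p, 'k) fspace \<Rightarrow> ('p \<Rightarrow> 'p) monoid" where
  "Aut_variety X = (BijGroup (topspace (Top X)))
    \<lparr>carrier := {\<phi> \<in> Bij (topspace (Top X)).
       morphism X X \<phi> \<and> morphism X X (inv_into (topspace (Top X)) \<phi>)}\<rparr>"


section \<open>Rational maps, projective space and Cremona groups\<close>

text \<open>The notions of this section are meant for irreducible varieties. A rational map is an
  equivalence class of morphisms defined on nonempty open subsets.\<close>

definition rational_reps ::
    "('p, 'k) fspace \<Rightarrow> ('q, 'k) fspace \<Rightarrow> ('p set \<times> ('p \<Rightarrow> 'q)) set" where
  "rational_reps X Y = {(U, \<phi>). openin (Top X) U \<and> U \<noteq> {} \<and> morphism (open_subspace X U) Y \<phi>}"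

definition rational_rel ::
    "('p, 'k) fspace \<Rightarrow> ('q, 'k) fspace \<Rightarrow>
     (('p set \<times> ('p \<Rightarrow> 'q)) \<times> ('p set \<times> ('p \<Rightarrow> 'q))) set" where
  "rational_rel X Y = {((U, \<phi>), (V, \<psi>)).
     (U, \<phi>) \<in> rational_reps X Y \<and> (V, \<psi>) \<in> rational_reps X Y \<and> (\<forall>x\<in>U \<inter> V. \<phi> x = \<psi> x)}"

definition rational_maps ::
    "('p, 'k) fspace \<Rightarrow> ('q, 'k) fspace \<Rightarrow> ('p set \<times> ('p \<Rightarrow> 'q)) set set" where
  "rational_maps X Y = rational_reps X Y // rational_rel X Y"

definition dominant_maps ::
    "('p, 'k) fspace \<Rightarrow> ('q, 'k) fspace \<Rightarrow> ('p set \<times> ('p \<Rightarrow> 'q)) set set" where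
  "dominant_maps X Y = {a \<in> rational_maps X Y.
     \<forall>(U, \<phi>)\<in>a. Top Y closure_of (\<phi> ` U) = topspace (Top Y)}"

definition rational_comp ::
    "('p, 'k) fspace \<Rightarrow> ('p set \<times> ('p \<Rightarrow> 'p)) set \<Rightarrow> ('p set \<times> ('p \<Rightarrow> 'p)) set
      \<Rightarrow> ('p set \<times> ('p \<Rightarrow> 'p)) set" where
  "rational_comp X b a =
    (\<Union>(V, \<psi>)\<in>b. \<Union>(U, \<phi>)\<in>a. rational_rel X X `` {({x \<in> U. \<phi> x \<in> V}, \<psi> \<circ> \<phi>)})"

definition rational_id :: "('p, 'k) fspace \<Rightarrow> ('p set \<times> ('p \<Rightarrow> 'p)) set" where
  "rational_id X = rational_rel X X `` {(topspace (Top X), id)}"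

definition Bir :: "('p, 'k) fspace \<Rightarrow> ('p set \<times> ('p \<Rightarrow> 'p)) set monoid" where
  "Bir X =
    \<lparr>carrier = {a \<in> dominant_maps X X. \<exists>b\<in>dominant_maps X X.
       rational_comp X b a = rational_id X \<and> rational_comp X a b = rational_id X},
     mult = rational_comp X,
     one = rational_id X\<rparr>"

text \<open>A point of projective \<open>m\<close>-space is a line through the origin of \<open>k\<^bsup>m+1\<^esup>\<close>, with the
  origin removed.\<close>

definition proj_point :: "'k::field list \<Rightarrow> 'k list set" where
  "proj_point x = {map ((*) c) x | c. c \<noteq> 0}"

definition proj_points :: "nat \<Rightarrow> 'k::field list set set" where
  "proj_points m = proj_point ` {x. length x = Suc m \<and> (\<exists>a\<in>set x. a \<noteq> 0)}"

definition proj_zeros :: "nat \<Rightarrow> 'k::field mpol set \<Rightarrow> 'k list set set" where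
  "proj_zeros m F = {P \<in> proj_points m. \<forall>f\<in>F. \<forall>x\<in>P. mpeval f x = 0}"

definition proj_zariski :: "nat \<Rightarrow> 'k::field list set topology" where
  "proj_zariski m = topology (\<lambda>U. \<exists>F\<subseteq>{f \<in> polys (Suc m). \<exists>d. homogeneous d f}.
     U = proj_points m - proj_zeros m F)"

definition proj_space :: "nat \<Rightarrow> ('k::field list set, 'k) fspace" where
  "proj_space m = \<lparr>Top = proj_zariski m,
     regular = (\<lambda>U f. \<forall>P\<in>U. \<exists>d. \<exists>g\<in>polys (Suc m). \<exists>h\<in>polys (Suc m). \<exists>W.
       homogeneous d g \<and> homogeneous d h \<and> openin (proj_zariski m) W \<and> P \<in> W \<and> W \<subseteq> U \<and>
       (\<forall>Q\<in>W. \<forall>x\<in>Q. mpeval h x \<noteq> 0 \<and> f Q = mpeval g x / mpeval h x))\<rparr>"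

definition Cremona :: "nat \<Rightarrow> ('k::field list set set \<times> ('k list set \<Rightarrow> 'k list set)) set monoid"
  where "Cremona m = Bir (proj_space m)"

lemma mono_eval_scale:
  assumes "Poly_Mapping.keys m \<subseteq> {..<length x}"
  shows "mono_eval m (map ((*) c) x)
    = c ^ (\<Sum>i\<in>Poly_Mapping.keys m. Poly_Mapping.lookup m i) * mono_eval m x"
proof -
  have "mono_eval m (map ((*) c) x)
      = (\<Prod>i\<in>Poly_Mapping.keys m. c ^ Poly_Mapping.lookup m i * (x ! i) ^ Poly_Mapping.lookup m i)"
    unfolding mono_eval_def using assms by (intro prod.cong) (auto simp: power_mult_distrib)
  then show ?thesis by (simp add: mono_eval_def prod.distrib power_sum)
qed

lemma mpeval_scale:
  assumes "homogeneous d f" "f \<in> polys (length x)"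
  shows "mpeval f (map ((*) c) x) = c ^ d * mpeval f x"
  unfolding mpeval_def sum_distrib_left
  using assms by (intro sum.cong) (auto simp: mono_eval_scale homogeneous_def polys_def mult.left_commute)

lemma proj_nonzero_iff:
  assumes "P \<in> proj_points m" "f \<in> polys (Suc m)" "homogeneous d f" "x \<in> P" "y \<in> P"
  shows "mpeval f x = 0 \<longleftrightarrow> mpeval f y = 0"
proof -
  have *: "mpeval f z = 0 \<longleftrightarrow> mpeval f w = 0" if "z \<in> proj_point w" "length w = Suc m" for z w
    using that assms(2,3) by (auto simp: proj_point_def mpeval_scale)
  obtain w where "P = proj_point w" "length w = Suc m"
    using assms(1) by (auto simp: proj_points_def)
  then show ?thesis using *[of x w] *[of y w] assms(4,5) by simp
qed

lemma proj_points_nonempty: "P \<in> proj_points m \<Longrightarrow> \<exists>x. x \<in> P"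
  by (auto simp: proj_points_def proj_point_def intro: exI[of _ 1])

lemma istopology_proj_zariski:
  "istopology (\<lambda>U. \<exists>F\<subseteq>{f \<in> polys (Suc m). \<exists>d. homogeneous d f}.
     U = proj_points m - proj_zeros m (F :: 'k::field mpol set))"
  (is "istopology (\<lambda>U. \<exists>F\<subseteq>?H. _ U F)")
  unfolding istopology_def
proof (intro conjI allI impI)
  fix U V :: "'k list set set"
  assume "\<exists>F\<subseteq>?H. U = proj_points m - proj_zeros m F"
    and "\<exists>F\<subseteq>?H. V = proj_points m - proj_zeros m F"
  then obtain F G where FG: "F \<subseteq> ?H" "U = proj_points m - proj_zeros m F"
      "G \<subseteq> ?H" "V = proj_points m - proj_zeros m G" by blast
  let ?FG = "{f * g | f g. f \<in> F \<and> g \<in> G}"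
  have sub: "?FG \<subseteq> ?H"
  proof
    fix p assume "p \<in> ?FG"
    then obtain f g where p: "p = f * g" and "f \<in> F" "g \<in> G" by blast
    with FG(1,3) obtain d e where "f \<in> polys (Suc m)" "homogeneous d f"
        "g \<in> polys (Suc m)" "homogeneous e g" by blast
    then have "f * g \<in> polys (Suc m)" "homogeneous (d + e) (f * g)"
      by (simp_all add: polys_mult homogeneous_mult)
    then show "p \<in> ?H" unfolding p by blast
  qed
  have "P \<in> U \<inter> V \<longleftrightarrow> P \<in> proj_points m - proj_zeros m ?FG" for P
  proof
    assume P: "P \<in> U \<inter> V"
    then obtain f x g y where P': "P \<in> proj_points m" "f \<in> F" "x \<in> P" "mpeval f x \<noteq> 0"
        "g \<in> G" "y \<in> P" "mpeval g y \<noteq> 0"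
      unfolding FG proj_zeros_def by blast
    obtain e where "g \<in> polys (Suc m)" "homogeneous e g" using P' FG(3) by blast
    with P' have "mpeval g x \<noteq> 0"
      using proj_nonzero_iff[of P m g e x y] by simp
    with P' have "mpeval (f * g) x \<noteq> 0" by (simp add: mpeval_mult)
    moreover have "f * g \<in> ?FG" using P' by blast
    ultimately show "P \<in> proj_points m - proj_zeros m ?FG" using P'(1,3) unfolding proj_zeros_def by blast
  next
    assume "P \<in> proj_points m - proj_zeros m ?FG"
    then obtain f g x where "P \<in> proj_points m" "f \<in> F" "g \<in> G" "x \<in> P" "mpeval (f * g) x \<noteq> 0"
      unfolding proj_zeros_def by blast
    moreover from this have "mpeval f x \<noteq> 0" "mpeval g x \<noteq> 0" by (auto simp: mpeval_mult)
    ultimately show "P \<in> U \<inter> V" unfolding FG proj_zeros_def by blast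
  qed
  then have "U \<inter> V = proj_points m - proj_zeros m ?FG" by blast
  with sub show "\<exists>F\<subseteq>?H. U \<inter> V = proj_points m - proj_zeros m F" by blast
next
  fix \<U> :: "'k list set set set"
  assume "\<forall>U\<in>\<U>. \<exists>F\<subseteq>?H. U = proj_points m - proj_zeros m F"
  from bchoice[OF this]
  obtain F where F: "\<forall>U\<in>\<U>. F U \<subseteq> ?H \<and> U = proj_points m - proj_zeros m (F U)" ..
  have F1: "F U \<subseteq> ?H" if "U \<in> \<U>" for U
    using bspec[OF F that] by (rule conjunct1)
  have F2: "U = proj_points m - proj_zeros m (F U)" if "U \<in> \<U>" for U
    using bspec[OF F that] by (rule conjunct2)
  have "\<Union>\<U> = (\<Union>U\<in>\<U>. proj_points m - proj_zeros m (F U))"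
    using SUP_cong[OF HOL.refl F2, of \<U> "\<lambda>U. U"] by simp
  also have "\<dots> = proj_points m - proj_zeros m (\<Union>U\<in>\<U>. F U)"
    unfolding proj_zeros_def by auto
  finally show "\<exists>F\<subseteq>?H. \<Union>\<U> = proj_points m - proj_zeros m F"
    by (intro exI[of _ "\<Union>U\<in>\<U>. F U"] conjI UN_least F1)
qed

lemma openin_proj_zariski:
  "openin (proj_zariski m) U \<longleftrightarrow> (\<exists>F\<subseteq>{f \<in> polys (Suc m). \<exists>d. homogeneous d f}.
     U = proj_points m - proj_zeros m F)"
  by (simp add: proj_zariski_def topology_inverse'[OF istopology_proj_zariski])

lemma topspace_proj_zariski [simp]: "topspace (proj_zariski m) = proj_points m"
proof -
  have "openin (proj_zariski m) (proj_points m :: 'a list set set)"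
  proof -
    have "proj_zeros m {1 :: 'a mpol} = {}"
      using proj_points_nonempty by (fastforce simp: proj_zeros_def)
    moreover have "{1 :: 'a mpol} \<subseteq> {f \<in> polys (Suc m). \<exists>d. homogeneous d f}"
      using homogeneous_one polys_one by blast
    ultimately show ?thesis unfolding openin_proj_zariski
      by (intro exI[of _ "{1}"] conjI) simp_all
  qed
  moreover have "U \<subseteq> proj_points m" if "openin (proj_zariski m) U" for U :: "'a list set set"
    using that unfolding openin_proj_zariski by auto
  ultimately show ?thesis by (meson openin_subset openin_topspace subset_antisym)
qed


section \<open>The invariants Var and Crem\<close>

text \<open>A group \<open>S\<close> embeds into \<open>G\<close> iff \<open>mon S G\<close>, the set of injective homomorphisms, is
  nonempty. Infima are taken in the well-ordered type \<^typ>\<open>enat\<close>, so they are minima of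
  nonempty sets and \<open>\<infinity>\<close> for the empty set.

  In the definition of \<open>Var\<close> the points of the varieties are taken from the type
  \<^typ>\<open>'k list\<close>. This loses no generality: a variety over the infinite field \<open>k\<close> is a finite
  union of sets that are in bijection with algebraic sets in affine spaces, hence has at most
  as many points as \<^typ>\<open>'k list\<close> has elements, and the structure can be transported along an
  injection.\<close>

definition Var :: "'k::alg_closed_field itself \<Rightarrow> 's monoid \<Rightarrow> enat" where
  "Var k S = Inf {top_dim (Top Z) | Z :: ('k list, 'k) fspace.
     irreducible_variety Z \<and> mon S (Aut_variety Z) \<noteq> {}}"

definition Crem :: "'k::alg_closed_field itself \<Rightarrow> 's monoid \<Rightarrow> enat" where
  "Crem k S = Inf {enat m | m.
     mon S (Cremona m :: ('k list set set \<times> ('k list set \<Rightarrow> 'k list set)) set monoid) \<noteq> {}}"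

end

theory Submission
  imports Defs "HOL-Algebra.Generated_Groups"
begin

text \<open>
  Everything rests on two properties of \<open>SL\<^sub>2(k)\<close>: it is a rational variety of dimension 3, and no
  nontrivial reduced word vanishes identically on it. The homomorphisms from the free group \<open>F\<close> of
  rank \<open>n\<close> to \<open>SL\<^sub>2(k)\<close> are the \<open>n\<close>-tuples of matrices, that is, the points of the variety
  \<open>SL\<^sub>2(k)\<^sup>n\<close>. An automorphism \<open>\<phi>\<close> of \<open>F\<close> acts on them by \<open>\<rho> \<mapsto> \<rho> \<circ> \<phi>\<^sup>-\<^sup>1\<close>. In coordinates this is a tuple
  of word maps, hence a morphism. If \<open>\<phi>\<close> acts trivially, then \<open>\<phi>(x)\<close> and \<open>x\<close> have the same image under
  every homomorphism to \<open>SL\<^sub>2(k)\<close>, for every generator \<open>x\<close>, and then \<open>\<phi>\<close> is the identity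
  (\<open>free_group_separated_by_SL2\<close>, \<open>act_hom_mon\<close>). So \<open>Aut(F)\<close> embeds into \<open>Aut(SL\<^sub>2(k)\<^sup>n)\<close>.

  Words are separated by the matrices with eigenlines spanned by \<open>(1, p)\<close> and \<open>(1, q)\<close> and eigenvalues
  \<open>t\<close> and \<open>1/t\<close>. If all the lines for the different generators are distinct, then a reduced word of
  length \<open>l \<ge> 1\<close> in these matrices maps a suitable vector to a Laurent polynomial in \<open>t\<close> whose
  coefficient of degree \<open>l\<close> arises from that vector by rank one projections and does not vanish.
  This works in every characteristic, and also where \<open>SL\<^sub>2(k)\<close> is a torsion group.

  The dimension is bounded without dimension theory (\<open>top_dim_le_of_rational_parametrisation\<close>). A chain
  of \<open>l + 1\<close> irreducible closed sets yields \<open>l\<close> polynomial functions, the \<open>i\<close>-th of which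
  vanishes on a member of the chain but not on the next one; they are algebraically independent. Pulled
  back to affine \<open>m\<close>-space and freed of denominators, the \<open>(N + 1)\<^sup>l\<close> monomials in them with exponents
  at most \<open>N\<close> become polynomials of degree \<open>O(N)\<close> in \<open>m\<close> variables, and for \<open>l > m\<close> and large \<open>N\<close> there are too
  many of them to be linearly independent.

  For the Cremona group, the chart \<open>(a, b, c, d) \<mapsto> (a, b, c)\<close> of \<open>SL\<^sub>2\<close> identifies an open subset of
  \<open>SL\<^sub>2(k)\<^sup>n\<close> with one of projective \<open>3n\<close>-space, and an automorphism of the variety becomes a birational
  self-map of projective space (\<open>rational_chart.bir_class_mon\<close>).

  The braid group embeds into \<open>Aut(F)\<close> by Artin's theorem (\<open>artin_representation_faithful\<close>), proved here
  by induction on the number of strands. The cosets of the stabiliser of the last strand are represented by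
  the braids \<open>T\<^sub>j\<close> that move strand \<open>j\<close> to the end, and the stabiliser is the product of the subgroup
  \<open>U\<close> generated by the loops \<open>A\<^sub>j\<close> of the last strand around the strand \<open>j\<close>, and of the braid group \<open>B\<close> on
  one strand less (\<open>coset_decomposition\<close>). A braid \<open>u b T\<^sub>j\<close> that acts trivially on \<open>F\<close> fixes
  the last generator \<open>x\<close> up to conjugacy, so \<open>T\<^sub>j = 1\<close>; and \<open>u\<close> maps \<open>x\<close> to \<open>W x W\<^sup>-\<^sup>1\<close>, where the image of \<open>W\<close>
  modulo \<open>x\<close> determines \<open>u\<close>. As \<open>W\<close> commutes with \<open>x\<close>, that image is trivial, so \<open>u = 1\<close>, and the
  induction hypothesis applies to \<open>b\<close>.
\<close>


section \<open>Presented groups and reduced words\<close>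

primrec word_val :: "('g, 'm) monoid_scheme \<Rightarrow> ('a \<Rightarrow> 'g) \<Rightarrow> 'a word \<Rightarrow> 'g" where
  "word_val G g [] = \<one>\<^bsub>G\<^esub>"
| "word_val G g (l # w) =
    (if fst l then g (snd l) else inv\<^bsub>G\<^esub> g (snd l)) \<otimes>\<^bsub>G\<^esub> word_val G g w"

lemma words_simps [simp]:
  "[] \<in> words X" "l # w \<in> words X \<longleftrightarrow> snd l \<in> X \<and> w \<in> words X"
  "u @ v \<in> words X \<longleftrightarrow> u \<in> words X \<and> v \<in> words X"
  by (auto simp: words_def mem_Times_iff)

lemma words_mono: "X \<subseteq> Y \<Longrightarrow> w \<in> words X \<Longrightarrow> w \<in> words Y"
  by (auto simp: words_def)

context group
begin

lemma word_val_closed [simp]: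
  "(\<And>x. x \<in> X \<Longrightarrow> g x \<in> carrier G) \<Longrightarrow> w \<in> words X \<Longrightarrow> word_val G g w \<in> carrier G"
  by (induction w) auto

lemma word_val_append:
  assumes "\<And>x. x \<in> X \<Longrightarrow> g x \<in> carrier G" "u \<in> words X" "v \<in> words X"
  shows "word_val G g (u @ v) = word_val G g u \<otimes> word_val G g v"
  using assms(2) by (induction u) (auto simp: m_assoc assms word_val_closed[of X])

lemma word_val_pres_eq:
  assumes g: "\<And>x. x \<in> X \<Longrightarrow> g x \<in> carrier G"
    and R: "\<And>u v. (u, v) \<in> R \<Longrightarrow> u \<in> words X \<Longrightarrow> v \<in> words X \<Longrightarrow> word_val G g u = word_val G g v"
    and uv: "pres_eq X R u v"
  shows "word_val G g u = word_val G g v"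
  using uv
proof (induction rule: pres_eq.induct)
  case (append u v u' v')
  then show ?case
    using pres_eq_words[OF append.hyps(1)] pres_eq_words[OF append.hyps(2)]
    by (simp add: word_val_append[of X] g)
qed (auto simp: g R)

lemma word_val_hom:
  assumes "group H" "h \<in> hom G H" "\<And>x. x \<in> X \<Longrightarrow> g x \<in> carrier G" "w \<in> words X"
  shows "word_val H (h \<circ> g) w = h (word_val G g w)"
proof -
  have cl: "w \<in> words X \<Longrightarrow> word_val G g w \<in> carrier G" for w
    using assms(3) by (rule word_val_closed)
  interpret group_hom G H h
    using assms(1,2) by (simp add: group_hom_def group_hom_axioms_def is_group)
  show ?thesis
    using assms(4)
  proof (induction w)
    case (Cons l w)
    then have "word_val G g w \<in> carrier G" "g (snd l) \<in> carrier G"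
      using assms(3) cl by auto
    then show ?case using Cons by simp
  qed simp
qed

end

lemma word_val_cong:
  "(\<And>x. x \<in> X \<Longrightarrow> g x = g' x) \<Longrightarrow> w \<in> words X \<Longrightarrow> word_val G g w = word_val G g' w"
  by (induction w) auto

definition pres_gen :: "'a set \<Rightarrow> ('a word \<times> 'a word) set \<Rightarrow> 'a \<Rightarrow> 'a word set" where
  "pres_gen X R x = pres_rel X R `` {[(True, x)]}"

text \<open>The word is an arbitrary element of the class. Its value depends on the class only if the images \<open>g x\<close>
  satisfy the relations.\<close>

definition pres_lift ::
    "('g, 'm) monoid_scheme \<Rightarrow> ('a \<Rightarrow> 'g) \<Rightarrow> 'a word set \<Rightarrow> 'g" where
  "pres_lift G g A = word_val G g (SOME w. w \<in> A)"

lemma in_carrier_presented_group: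
  "A \<in> carrier (presented_group X R) \<longleftrightarrow> (\<exists>w\<in>words X. A = pres_rel X R `` {w})"
  by (auto simp: presented_group_def quotient_def)

lemma one_presented_group: "\<one>\<^bsub>presented_group X R\<^esub> = pres_rel X R `` {[]}"
  by (simp add: presented_group_def)

lemma pres_gen_closed [simp]: "x \<in> X \<Longrightarrow> pres_gen X R x \<in> carrier (presented_group X R)"
  unfolding in_carrier_presented_group pres_gen_def
  by (intro bexI[of _ "[(True, x)]"]) auto

lemma pres_class_eq_iff:
  assumes "u \<in> words X" "v \<in> words X"
  shows "pres_rel X R `` {u} = pres_rel X R `` {v} \<longleftrightarrow> pres_eq X R u v"
  using eq_equiv_class_iff[OF equiv_pres_rel assms, of R] by (simp add: pres_rel_def)

lemma inv_pres_gen: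
  assumes "x \<in> X"
  shows "inv\<^bsub>presented_group X R\<^esub> (pres_gen X R x) = pres_rel X R `` {[(False, x)]}"
proof -
  interpret group "presented_group X R" by (rule group_presented_group)
  have "pres_rel X R `` {[(False, x)]} \<otimes>\<^bsub>presented_group X R\<^esub> pres_gen X R x
      = pres_rel X R `` {[(False, x), (True, x)]}"
    unfolding pres_gen_def using assms by (subst presented_group_mult) auto
  also have "\<dots> = \<one>\<^bsub>presented_group X R\<^esub>"
    unfolding one_presented_group using assms pres_eq.cancel[of x X R False]
    by (subst pres_class_eq_iff) auto
  finally have "pres_rel X R `` {[(False, x)]} \<otimes>\<^bsub>presented_group X R\<^esub> pres_gen X R x
      = \<one>\<^bsub>presented_group X R\<^esub>" .
  moreover have "pres_rel X R `` {[(False, x)]} \<in> carrier (presented_group X R)"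
    unfolding in_carrier_presented_group using assms by (intro bexI[of _ "[(False, x)]"]) auto
  ultimately show ?thesis using inv_equality[OF _ pres_gen_closed[OF assms]] by blast
qed

lemma word_val_pres_gen:
  "w \<in> words X \<Longrightarrow> word_val (presented_group X R) (pres_gen X R) w = pres_rel X R `` {w}"
proof (induction w)
  case Nil
  then show ?case by (simp add: one_presented_group)
next
  case (Cons l w)
  obtain b x where l: "l = (b, x)" by (cases l)
  have "(if b then pres_gen X R x else inv\<^bsub>presented_group X R\<^esub> pres_gen X R x)
      = pres_rel X R `` {[l]}"
    using Cons.prems l inv_pres_gen[of x X R] by (cases b) (simp_all add: pres_gen_def)
  then show ?case
    using Cons l presented_group_mult[of "[l]" X w R] by (cases b) simp_all
qed

context group
begin

lemma pres_lift_class: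
  assumes g: "\<And>x. x \<in> X \<Longrightarrow> g x \<in> carrier G"
    and R: "\<And>u v. (u, v) \<in> R \<Longrightarrow> u \<in> words X \<Longrightarrow> v \<in> words X \<Longrightarrow> word_val G g u = word_val G g v"
    and w: "w \<in> words X"
  shows "pres_lift G g (pres_rel X R `` {w}) = word_val G g w"
proof -
  have "w \<in> pres_rel X R `` {w}" using w by (auto simp: pres_rel_def intro: pres_eq.refl)
  then have "(SOME v. v \<in> pres_rel X R `` {w}) \<in> pres_rel X R `` {w}" by (rule someI)
  then have "pres_eq X R w (SOME v. v \<in> pres_rel X R `` {w})" by (simp add: pres_rel_def)
  from word_val_pres_eq[OF g R this] show ?thesis by (simp add: pres_lift_def)
qed

lemma pres_lift_hom:
  assumes g: "\<And>x. x \<in> X \<Longrightarrow> g x \<in> carrier G"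
    and R: "\<And>u v. (u, v) \<in> R \<Longrightarrow> u \<in> words X \<Longrightarrow> v \<in> words X \<Longrightarrow> word_val G g u = word_val G g v"
  shows "pres_lift G g \<in> hom (presented_group X R) G"
proof (rule homI)
  have cl: "pres_lift G g (pres_rel X R `` {w}) = word_val G g w" if "w \<in> words X" for w
    by (rule pres_lift_class[OF g R that])
  fix A assume "A \<in> carrier (presented_group X R)"
  then obtain u where u: "u \<in> words X" "A = pres_rel X R `` {u}"
    by (auto simp: in_carrier_presented_group)
  then show "pres_lift G g A \<in> carrier G"
    using cl[OF u(1)] word_val_closed[OF g u(1)] by simp
  fix B assume "B \<in> carrier (presented_group X R)"
  then obtain v where v: "v \<in> words X" "B = pres_rel X R `` {v}"
    by (auto simp: in_carrier_presented_group)
  have "A \<otimes>\<^bsub>presented_group X R\<^esub> B = pres_rel X R `` {u @ v}"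
    unfolding u(2) v(2) by (rule presented_group_mult[OF u(1) v(1)])
  then show "pres_lift G g (A \<otimes>\<^bsub>presented_group X R\<^esub> B) = pres_lift G g A \<otimes> pres_lift G g B"
    using cl[of u] cl[of v] cl[of "u @ v"] u v by (simp add: word_val_append[of X] g)
qed

lemma pres_lift_gen:
  assumes g: "\<And>x. x \<in> X \<Longrightarrow> g x \<in> carrier G"
    and R: "\<And>u v. (u, v) \<in> R \<Longrightarrow> u \<in> words X \<Longrightarrow> v \<in> words X \<Longrightarrow> word_val G g u = word_val G g v"
    and x: "x \<in> X"
  shows "pres_lift G g (pres_gen X R x) = g x"
  using pres_lift_class[OF g R, of X R "[(True, x)]"] x g by (simp add: pres_gen_def)

lemma hom_presented_group_word:
  assumes "h \<in> hom (presented_group X R) G" "w \<in> words X"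
  shows "h (pres_rel X R `` {w}) = word_val G (h \<circ> pres_gen X R) w"
proof -
  interpret P: group "presented_group X R" by (rule group_presented_group)
  show ?thesis
    using P.word_val_hom[OF is_group assms(1), of X "pres_gen X R" w] assms(2)
    by (simp add: word_val_pres_gen)
qed

lemma hom_presented_group_eqI:
  assumes "h \<in> hom (presented_group X R) G" "h' \<in> hom (presented_group X R) G"
    and "\<And>x. x \<in> X \<Longrightarrow> h (pres_gen X R x) = h' (pres_gen X R x)"
    and "A \<in> carrier (presented_group X R)"
  shows "h A = h' A"
proof -
  obtain w where w: "w \<in> words X" "A = pres_rel X R `` {w}"
    using assms(4) by (auto simp: in_carrier_presented_group)
  show ?thesis
    using hom_presented_group_word[OF assms(1) w(1)] hom_presented_group_word[OF assms(2) w(1)] w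
      word_val_cong[OF _ w(1), of "h \<circ> pres_gen X R" "h' \<circ> pres_gen X R" G] assms(3) by simp
qed

end

fun reduced :: "'a word \<Rightarrow> bool" where
  "reduced (l # m # w) \<longleftrightarrow> \<not> (snd l = snd m \<and> fst l \<noteq> fst m) \<and> reduced (m # w)"
| "reduced w \<longleftrightarrow> True"

lemma reduced_ConsD: "reduced (l # w) \<Longrightarrow> reduced w"
  by (cases w) auto

text \<open>The tail is reduced first; then at most the new first letter and the first letter of the
  reduced tail can cancel.\<close>

lemma ex_reduced_word:
  "w \<in> words X \<Longrightarrow> \<exists>r\<in>words X. reduced r \<and> pres_eq X R w r"
proof (induction w)
  case Nil
  then show ?case by (intro bexI[of _ "[]"]) (auto intro: pres_eq.refl)
next
  case (Cons l w)
  obtain r where r: "r \<in> words X" "reduced r" "pres_eq X R w r" using Cons by auto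
  have l: "snd l \<in> X" using Cons.prems by simp
  have lr: "pres_eq X R (l # w) (l # r)"
    using pres_eq.append[OF pres_eq.refl[of "[l]"] r(3)] l by simp
  show ?case
  proof (cases "\<exists>m r'. r = m # r' \<and> snd l = snd m \<and> fst l \<noteq> fst m")
    case True
    then obtain m r' where m: "r = m # r'" "snd l = snd m" "fst l \<noteq> fst m" by blast
    have "m = (\<not> fst l, snd l)" using m by (cases m) auto
    then have "pres_eq X R [l, m] []" using pres_eq.cancel[OF l, of R "fst l"] by simp
    from pres_eq.append[OF this pres_eq.refl[of r']] r m have "pres_eq X R (l # r) r'" by simp
    with lr have "pres_eq X R (l # w) r'" by (rule pres_eq.trans)
    then show ?thesis using r(1,2) m(1) reduced_ConsD[of m r'] by auto
  next
    case False
    then have "reduced (l # r)" using r(2) by (cases r) auto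
    then show ?thesis using r l lr by auto
  qed
qed

section \<open>Cosets of the stabiliser of the last strand in a braid group\<close>

context group
begin

lemma inv_cancel_left [simp]:
  "x \<in> carrier G \<Longrightarrow> y \<in> carrier G \<Longrightarrow> inv x \<otimes> (x \<otimes> y) = y"
  "x \<in> carrier G \<Longrightarrow> y \<in> carrier G \<Longrightarrow> x \<otimes> (inv x \<otimes> y) = y"
  by (simp_all add: m_assoc[symmetric])

definition conj_by :: "'a \<Rightarrow> 'a \<Rightarrow> 'a" where
  "conj_by g z = g \<otimes> z \<otimes> inv g"

lemma conj_closed [simp]: "g \<in> carrier G \<Longrightarrow> z \<in> carrier G \<Longrightarrow> conj_by g z \<in> carrier G"
  by (simp add: conj_by_def)

lemma conj_mult:
  "g \<in> carrier G \<Longrightarrow> a \<in> carrier G \<Longrightarrow> b \<in> carrier G \<Longrightarrow> conj_by g (a \<otimes> b) = conj_by g a \<otimes> conj_by g b"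
  by (simp add: conj_by_def m_assoc inv_solve_left)

lemma conj_inv: "g \<in> carrier G \<Longrightarrow> a \<in> carrier G \<Longrightarrow> conj_by g (inv a) = inv (conj_by g a)"
  by (simp add: conj_by_def m_assoc inv_mult_group)

lemma conj_one [simp]: "g \<in> carrier G \<Longrightarrow> conj_by g \<one> = \<one>"
  by (simp add: conj_by_def)

lemma conj_one_left [simp]: "z \<in> carrier G \<Longrightarrow> conj_by \<one> z = z"
  by (simp add: conj_by_def)

lemma conj_conj:
  "g \<in> carrier G \<Longrightarrow> h \<in> carrier G \<Longrightarrow> z \<in> carrier G \<Longrightarrow> conj_by g (conj_by h z) = conj_by (g \<otimes> h) z"
  by (simp add: conj_by_def m_assoc inv_mult_group)

lemma conj_inv_conj [simp]:
  "g \<in> carrier G \<Longrightarrow> z \<in> carrier G \<Longrightarrow> conj_by (inv g) (conj_by g z) = z"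
  "g \<in> carrier G \<Longrightarrow> z \<in> carrier G \<Longrightarrow> conj_by g (conj_by (inv g) z) = z"
  by (simp_all add: conj_conj)

lemma conj_eq_iff:
  "g \<in> carrier G \<Longrightarrow> z \<in> carrier G \<Longrightarrow> z' \<in> carrier G \<Longrightarrow> conj_by g z = z' \<longleftrightarrow> g \<otimes> z = z' \<otimes> g"
  by (metis conj_by_def inv_solve_right m_closed)

lemma conj_mult_swap: "g \<in> carrier G \<Longrightarrow> z \<in> carrier G \<Longrightarrow> g \<otimes> z = conj_by g z \<otimes> g"
  by (simp add: conj_by_def m_assoc)

lemma conj_conj_distrib:
  assumes "g \<in> carrier G" "a \<in> carrier G" "b \<in> carrier G"
  shows "conj_by g (conj_by a b) = conj_by (conj_by g a) (conj_by g b)"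
  using assms by (simp add: conj_conj) (simp add: conj_by_def m_assoc)

lemma intertwine_inv:
  "g \<in> carrier G \<Longrightarrow> z \<in> carrier G \<Longrightarrow> z' \<in> carrier G \<Longrightarrow> g \<otimes> z = z' \<otimes> g \<Longrightarrow>
    g \<otimes> inv z = inv z' \<otimes> g"
  using conj_eq_iff[of g z z'] conj_eq_iff[of g "inv z" "inv z'"] by (simp add: conj_inv)

text \<open>A homomorphism maps a generated subgroup into itself as soon as it maps the generators into it.\<close>

lemma conj_generate:
  assumes "g \<in> carrier G" "S \<subseteq> carrier G" "\<And>a. a \<in> S \<Longrightarrow> conj_by g a \<in> generate G S" "u \<in> generate G S"
  shows "conj_by g u \<in> generate G S"
  using assms(4)
proof (induction rule: generate.induct)
  case (inv h)
  then show ?case using assms generate_m_inv_closed[OF assms(2)] by (auto simp: conj_inv)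
next
  case (eng h1 h2)
  then show ?case
    using assms generate_in_carrier[OF assms(2)] by (auto simp: conj_mult intro: generate.eng)
qed (use assms in \<open>auto intro: generate.one\<close>)

end

text \<open>The last index \<open>N\<close> is included, so this is the situation of the braid group on \<open>N + 2\<close> strands,
  the strands being numbered from 0 to \<open>N + 1\<close>.\<close>

locale braid_generators = group G for G :: "('a, 'b) monoid_scheme" (structure) +
  fixes s :: "nat \<Rightarrow> 'a" and N :: nat
  assumes s_closed [simp]: "i \<le> N \<Longrightarrow> s i \<in> carrier G"
    and far_commute: "i + 2 \<le> j \<Longrightarrow> j \<le> N \<Longrightarrow> s i \<otimes> s j = s j \<otimes> s i"
    and braid: "Suc i \<le> N \<Longrightarrow> s i \<otimes> s (Suc i) \<otimes> s i = s (Suc i) \<otimes> s i \<otimes> s (Suc i)"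
begin

text \<open>\<open>A j\<close> is the pure braid in which the last strand runs once around strand \<open>j\<close>, and \<open>T j\<close> moves
  strand \<open>j\<close> to the last position. Both are defined downwards from \<open>N\<close>, hence the recursion on \<open>N - j\<close>.\<close>

primrec A_rec :: "nat \<Rightarrow> 'a" where
  "A_rec 0 = s N \<otimes> s N"
| "A_rec (Suc m) = conj_by (inv (s (N - Suc m))) (A_rec m)"

definition A :: "nat \<Rightarrow> 'a" where "A j = A_rec (N - j)"

primrec T_rec :: "nat \<Rightarrow> 'a" where
  "T_rec 0 = \<one>"
| "T_rec (Suc m) = T_rec m \<otimes> s (N - m)"

definition T :: "nat \<Rightarrow> 'a" where "T j = T_rec (Suc N - j)"

lemma A_last: "A N = s N \<otimes> s N"
  by (simp add: A_def)

lemma A_step: "j < N \<Longrightarrow> A j = conj_by (inv (s j)) (A (Suc j))"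
  by (cases "N - j") (auto simp: A_def Suc_diff_Suc[symmetric])

lemma T_end [simp]: "T (Suc N) = \<one>"
  by (simp add: T_def)

lemma T_step: "j \<le> N \<Longrightarrow> T j = T (Suc j) \<otimes> s j"
  by (simp add: T_def Suc_diff_le)

lemma A_closed [simp]: "j \<le> N \<Longrightarrow> A j \<in> carrier G"
  by (induction rule: inc_induct) (simp_all add: A_last A_step)

lemma T_closed [simp]: "j \<le> Suc N \<Longrightarrow> T j \<in> carrier G"
  by (induction rule: inc_induct) (simp_all add: T_step)

lemma A_commute_low:
  assumes "i \<le> N" "j + 2 \<le> i" shows "conj_by (s j) (A i) = A i"
  using assms
proof (induction i rule: inc_induct)
  case base
  then have "conj_by (s j) (s N) = s N" using far_commute[of j N] by (simp add: conj_eq_iff)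
  then show ?case using base by (simp add: A_last conj_mult)
next
  case (step i)
  have c: "conj_by (s j) (s i) = s i" using step far_commute[of j i] by (simp add: conj_eq_iff)
  have "conj_by (s j) (A i) = conj_by (conj_by (s j) (inv (s i))) (conj_by (s j) (A (Suc i)))"
    using step.prems step.hyps unfolding A_step[OF step.hyps(2)] by (intro conj_conj_distrib) auto
  also have "\<dots> = A i" using step c by (simp add: A_step conj_inv)
  finally show ?case .
qed

text \<open>For \<open>i = j - 1\<close>, conjugation by \<open>(s\<^sub>j s\<^sub>j\<^sub>-\<^sub>1)\<^sup>-\<^sup>1\<close> carries \<open>s\<^sub>j\<^sub>-\<^sub>1\<close> to \<open>s\<^sub>j\<close> and \<open>A\<^sub>j\<^sub>+\<^sub>1\<close> to \<open>A\<^sub>j\<^sub>-\<^sub>1\<close>, and \<open>s\<^sub>j\<^sub>-\<^sub>1\<close> commutes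
  with \<open>A\<^sub>j\<^sub>+\<^sub>1\<close>. For smaller \<open>i\<close>, \<open>s\<^sub>j\<close> commutes with all that is used to pass from \<open>A\<^sub>i\<^sub>+\<^sub>1\<close> to \<open>A\<^sub>i\<close>.\<close>

lemma A_commute_high:
  assumes "i < j" "j < N" shows "conj_by (s j) (A i) = A i"
proof -
  have "i \<le> j - 1" using assms by simp
  then show ?thesis
  proof (induction i rule: inc_induct)
    case base
    define c where "c = inv (s (j - 1)) \<otimes> inv (s j)"
    have [simp]: "c \<in> carrier G" using assms by (simp add: c_def)
    have "A (j - 1) = conj_by c (A (Suc j))"
      using assms A_step[of "j - 1"] A_step[of j] by (simp add: conj_conj c_def)
    moreover have "conj_by c (s (j - 1)) = s j"
    proof -
      have "conj_by (inv c) (s j) = s (j - 1)"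
        using assms braid[of "j - 1"] by (simp add: conj_eq_iff c_def inv_mult_group m_assoc)
      then have "conj_by c (conj_by (inv c) (s j)) = conj_by c (s (j - 1))" by simp
      then show ?thesis using assms by simp
    qed
    moreover have "conj_by c (conj_by (s (j - 1)) (A (Suc j)))
        = conj_by (conj_by c (s (j - 1))) (conj_by c (A (Suc j)))"
      using assms by (intro conj_conj_distrib) auto
    ultimately show ?case using assms A_commute_low[of "Suc j" "j - 1"] by simp
  next
    case (step i)
    have c: "conj_by (s j) (s i) = s i"
      using step assms far_commute[of i j] by (simp add: conj_eq_iff)
    have "conj_by (s j) (A i) = conj_by (conj_by (s j) (inv (s i))) (conj_by (s j) (A (Suc i)))"
      using step.hyps assms A_step[of i] by (simp add: conj_conj_distrib[of "s j" "inv (s i)"])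
    also have "\<dots> = A i" using step assms c by (simp add: A_step conj_inv)
    finally show ?case .
  qed
qed

text \<open>The relation of length 4 of the Coxeter diagram of type B. Conjugation by \<open>(s\<^sub>i s\<^sub>i\<^sub>+\<^sub>1)\<^sup>-\<^sup>1\<close> carries \<open>s\<^sub>i\<^sub>+\<^sub>1\<close> to \<open>s\<^sub>i\<close>
  and \<open>A\<^sub>i\<^sub>+\<^sub>2\<close> to \<open>A\<^sub>i\<^sub>+\<^sub>1\<close>, so it carries the relation for \<open>i + 1\<close> to the relation for \<open>i\<close>.\<close>

lemma A_type_B_relation:
  assumes "i < N"
  shows "s i \<otimes> A (Suc i) \<otimes> (s i \<otimes> A (Suc i)) = A (Suc i) \<otimes> s i \<otimes> (A (Suc i) \<otimes> s i)"
proof -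
  have "i \<le> N - 1" using assms by simp
  then show ?thesis
  proof (induction i rule: inc_induct)
    case base
    define x y where "x = s (N - 1)" and "y = s N"
    have [simp]: "x \<in> carrier G" "y \<in> carrier G" by (simp_all add: x_def y_def)
    have b: "x \<otimes> (y \<otimes> x) = y \<otimes> (x \<otimes> y)"
      using braid[of "N - 1"] assms by (simp add: x_def y_def m_assoc)
    have b': "y \<otimes> (x \<otimes> (y \<otimes> z)) = x \<otimes> (y \<otimes> (x \<otimes> z))" if "z \<in> carrier G" for z
      using b that by (metis \<open>x \<in> carrier G\<close> \<open>y \<in> carrier G\<close> m_assoc m_closed)
    have "x \<otimes> (y \<otimes> (y \<otimes> (x \<otimes> (y \<otimes> y)))) = x \<otimes> (y \<otimes> (x \<otimes> (y \<otimes> (x \<otimes> y))))"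
      using b'[of y] by simp
    also have "\<dots> = y \<otimes> (x \<otimes> (y \<otimes> (y \<otimes> (x \<otimes> y))))"
      using b'[of "y \<otimes> (x \<otimes> y)"] by simp
    also have "\<dots> = y \<otimes> (x \<otimes> (y \<otimes> (x \<otimes> (y \<otimes> x))))" using b by simp
    also have "\<dots> = y \<otimes> (y \<otimes> (x \<otimes> (y \<otimes> (y \<otimes> x))))" using b'[of "y \<otimes> x"] by simp
    finally show ?case using assms by (simp add: A_last x_def y_def m_assoc)
  next
    case (step i)
    define x y B where "x = s i" and "y = s (Suc i)" and "B = A (Suc (Suc i))"
    have [simp]: "x \<in> carrier G" "y \<in> carrier G" "B \<in> carrier G"
      using step.hyps by (simp_all add: x_def y_def B_def)
    have b: "x \<otimes> y \<otimes> x = y \<otimes> x \<otimes> y"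
      using braid[of i] step.hyps by (simp add: x_def y_def)
    define g where "g = inv y \<otimes> inv x"
    have [simp]: "g \<in> carrier G" by (simp add: g_def)
    have "conj_by (inv g) x = y" using b by (simp add: conj_eq_iff g_def inv_mult_group m_assoc)
    then have gy: "conj_by g y = x" by (metis conj_inv_conj(2) \<open>g \<in> carrier G\<close> \<open>x \<in> carrier G\<close>)
    have "conj_by x B = B"
      using A_commute_low[of "Suc (Suc i)" i] step.hyps by (simp add: x_def B_def)
    then have "conj_by (inv x) B = B" by (metis conj_inv_conj(1) \<open>x \<in> carrier G\<close> \<open>B \<in> carrier G\<close>)
    then have gB: "conj_by g B = A (Suc i)"
      using step.hyps by (simp add: g_def conj_conj[symmetric] A_step y_def B_def)
    have "conj_by g (y \<otimes> B \<otimes> (y \<otimes> B)) = conj_by g (B \<otimes> y \<otimes> (B \<otimes> y))"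
      using step.IH step.hyps by (simp add: y_def B_def)
    then show ?case by (simp add: conj_mult gy gB) (simp add: x_def)
  qed
qed

abbreviation U where "U \<equiv> generate G (A ` {..N})"
abbreviation B where "B \<equiv> generate G (s ` {..<N})"

lemma A_in_U: "i \<le> N \<Longrightarrow> A i \<in> U"
  by (auto intro: generate.incl)

lemma U_subset: "U \<subseteq> carrier G"
  by (rule generate_incl) auto

lemma B_subset: "B \<subseteq> carrier G"
  by (rule generate_incl) auto

text \<open>If \<open>s\<^sub>j\<close> does not commute with \<open>A\<^sub>i\<close>, then \<open>i\<close> is \<open>j\<close> or \<open>j + 1\<close>. Conjugation by \<open>s\<^sub>j\<close> maps \<open>A\<^sub>j\<close> to
  \<open>A\<^sub>j\<^sub>+\<^sub>1\<close> by definition. The type B relation expresses the conjugates of \<open>A\<^sub>j\<^sub>+\<^sub>1\<close> by \<open>s\<^sub>j\<close> and of \<open>A\<^sub>j\<close> by \<open>s\<^sub>j\<^sup>-\<^sup>1\<close>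
  in terms of these two elements.\<close>

lemma conj_A_in_U:
  assumes "i \<le> N" "j < N"
  shows "conj_by (s j) (A i) \<in> U" "conj_by (inv (s j)) (A i) \<in> U"
proof -
  consider "j + 2 \<le> i \<or> i < j" | "i = j" | "i = Suc j" by linarith
  then have "conj_by (s j) (A i) \<in> U \<and> conj_by (inv (s j)) (A i) \<in> U"
  proof cases
    case 1
    then have "conj_by (s j) (A i) = A i"
      using assms A_commute_low[of i j] A_commute_high[of i j] by auto
    moreover from this have "conj_by (inv (s j)) (A i) = A i"
      using assms by (metis conj_inv_conj(1) A_closed s_closed less_imp_le)
    ultimately show ?thesis using assms by (simp add: A_in_U)
  next
    case 2
    define x C D where "x = s j" and "C = A j" and "D = A (Suc j)"
    have [simp]: "x \<in> carrier G" "C \<in> carrier G" "D \<in> carrier G" and CU: "C \<in> U" "D \<in> U"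
      using assms by (simp_all add: x_def C_def D_def A_in_U)
    have C: "C = conj_by (inv x) D" using assms by (simp add: C_def D_def x_def A_step)
    then have "conj_by x C = D" by simp
    have "x \<otimes> D \<otimes> (x \<otimes> D) = D \<otimes> x \<otimes> (D \<otimes> x)"
      using A_type_B_relation[of j] assms by (simp add: x_def D_def)
    then have "D \<otimes> (x \<otimes> (D \<otimes> x)) = x \<otimes> (D \<otimes> (x \<otimes> D))" by (simp add: m_assoc)
    moreover have "D \<otimes> x = x \<otimes> C" using C by (simp add: conj_by_def m_assoc inv_solve_left)
    ultimately have "x \<otimes> (C \<otimes> (x \<otimes> C)) = x \<otimes> (x \<otimes> (C \<otimes> D))"
      by (metis \<open>x \<in> carrier G\<close> \<open>C \<in> carrier G\<close> \<open>D \<in> carrier G\<close> m_assoc m_closed)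
    then have eq: "x \<otimes> (C \<otimes> D) = C \<otimes> (x \<otimes> C)" by simp
    have "x \<otimes> conj_by C D = x \<otimes> (C \<otimes> D) \<otimes> inv C" by (simp add: conj_by_def m_assoc)
    also have "\<dots> = C \<otimes> x" unfolding eq by (simp add: m_assoc)
    finally have "x \<otimes> conj_by C D = C \<otimes> x" .
    then have "conj_by x (conj_by C D) = C" by (simp add: conj_eq_iff)
    then have "conj_by (inv x) C = conj_by C D"
      by (metis conj_inv_conj(1) conj_closed \<open>x \<in> carrier G\<close> \<open>C \<in> carrier G\<close> \<open>D \<in> carrier G\<close>)
    moreover have "conj_by C D \<in> U"
      unfolding conj_by_def using CU
      by (intro generate.eng generate_m_inv_closed) auto
    ultimately show ?thesis using \<open>conj_by x C = D\<close> CU 2 by (simp add: x_def C_def)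
  next
    case 3
    define x C D where "x = s j" and "C = A j" and "D = A (Suc j)"
    have [simp]: "x \<in> carrier G" "C \<in> carrier G" "D \<in> carrier G" and CU: "C \<in> U" "D \<in> U"
      using assms by (simp_all add: x_def C_def D_def A_in_U)
    have C: "C = conj_by (inv x) D" using assms by (simp add: C_def D_def x_def A_step)
    then have "x \<otimes> C = D \<otimes> x" by (simp add: conj_by_def m_assoc inv_solve_left)
    have "x \<otimes> D \<otimes> (x \<otimes> D) = D \<otimes> x \<otimes> (D \<otimes> x)"
      using A_type_B_relation[of j] assms by (simp add: x_def D_def)
    also have "\<dots> = x \<otimes> C \<otimes> (D \<otimes> x)" using \<open>x \<otimes> C = D \<otimes> x\<close> by simp
    finally have eq: "D \<otimes> (x \<otimes> D) = C \<otimes> (D \<otimes> x)" by (simp add: m_assoc)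
    have "x \<otimes> D = inv D \<otimes> (D \<otimes> (x \<otimes> D))" by simp
    also have "\<dots> = conj_by (inv D) C \<otimes> x" unfolding eq by (simp add: conj_by_def m_assoc)
    finally have "x \<otimes> D = conj_by (inv D) C \<otimes> x" .
    then have "conj_by x D = conj_by (inv D) C" by (simp add: conj_eq_iff)
    moreover have "conj_by (inv D) C \<in> U"
      unfolding conj_by_def using CU
      by (intro generate.eng generate_m_inv_closed) auto
    ultimately show ?thesis using C CU 3 by (simp add: x_def D_def C_def)
  qed
  then show "conj_by (s j) (A i) \<in> U" "conj_by (inv (s j)) (A i) \<in> U" by auto
qed

lemma conj_B_U:
  assumes "b \<in> B" "u \<in> U"
  shows "conj_by b u \<in> U"
  using assms
proof (induction arbitrary: u rule: generate.induct)
  case one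
  then show ?case using U_subset by auto
next
  case (incl h)
  then obtain j where j: "j < N" "h = s j" by auto
  show ?case
    by (rule conj_generate) (use j conj_A_in_U(1)[OF _ j(1)] incl.prems in auto)
next
  case (inv h)
  then obtain j where j: "j < N" "h = s j" by auto
  show ?case
    by (rule conj_generate) (use j conj_A_in_U(2)[OF _ j(1)] inv.prems in auto)
next
  case (eng h1 h2)
  have "h1 \<in> carrier G" "h2 \<in> carrier G" "u \<in> carrier G"
    using eng.hyps eng.prems U_subset B_subset by blast+
  then have "conj_by (h1 \<otimes> h2) u = conj_by h1 (conj_by h2 u)" by (simp add: conj_conj)
  then show ?case using eng.IH eng.prems by simp
qed

lemma T_far:
  assumes "i + 2 \<le> j" "j \<le> Suc N"
  shows "T j \<otimes> s i = s i \<otimes> T j"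
  using assms(2,1)
proof (induction j rule: inc_induct)
  case base
  then show ?case by simp
next
  case (step j)
  have "T j \<otimes> s i = T (Suc j) \<otimes> (s i \<otimes> s j)"
    using step.hyps step.prems far_commute[of i j] by (simp add: T_step m_assoc)
  also have "\<dots> = (T (Suc j) \<otimes> s i) \<otimes> s j" using step.hyps step.prems by (simp add: m_assoc)
  also have "T (Suc j) \<otimes> s i = s i \<otimes> T (Suc j)" using step.IH step.prems by simp
  also have "\<dots> \<otimes> s j = s i \<otimes> T j" using step.hyps step.prems by (simp add: T_step m_assoc)
  finally show ?case .
qed

text \<open>\<open>T j\<close> contains \<open>s\<^sub>i s\<^sub>i\<^sub>-\<^sub>1\<close>, and \<open>s\<^sub>i s\<^sub>i\<^sub>-\<^sub>1 s\<^sub>i = s\<^sub>i\<^sub>-\<^sub>1 s\<^sub>i s\<^sub>i\<^sub>-\<^sub>1\<close>. The new first factor commutes with everything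
  to its left.\<close>

lemma T_shift:
  assumes "j < i" "i \<le> N"
  shows "T j \<otimes> s i = s (i - 1) \<otimes> T j"
proof -
  have "j \<le> i - 1" using assms by simp
  then show ?thesis
  proof (induction j rule: inc_induct)
    case base
    have "T (i - 1) \<otimes> s i = T (Suc i) \<otimes> (s (i - 1) \<otimes> s i \<otimes> s (i - 1))"
      using assms T_step[of "i - 1"] T_step[of i] braid[of "i - 1"] by (simp add: m_assoc)
    also have "\<dots> = (T (Suc i) \<otimes> s (i - 1)) \<otimes> s i \<otimes> s (i - 1)" using assms by (simp add: m_assoc)
    also have "T (Suc i) \<otimes> s (i - 1) = s (i - 1) \<otimes> T (Suc i)" using assms by (intro T_far) auto
    also have "\<dots> \<otimes> s i \<otimes> s (i - 1) = s (i - 1) \<otimes> T (i - 1)"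
      using assms T_step[of "i - 1"] T_step[of i] by (simp add: m_assoc)
    finally show ?case .
  next
    case (step j)
    have "T j \<otimes> s i = T (Suc j) \<otimes> (s i \<otimes> s j)"
      using step.hyps assms far_commute[of j i] by (simp add: T_step m_assoc)
    also have "\<dots> = (T (Suc j) \<otimes> s i) \<otimes> s j" using step.hyps assms by (simp add: m_assoc)
    also have "T (Suc j) \<otimes> s i = s (i - 1) \<otimes> T (Suc j)" by (rule step.IH)
    also have "\<dots> \<otimes> s j = s (i - 1) \<otimes> T j" using step.hyps assms by (simp add: T_step m_assoc)
    finally show ?case .
  qed
qed

text \<open>Equivalently, \<open>A j\<close> is the conjugate of \<open>s\<^sub>j\<^sup>2\<close> by \<open>T (j + 1)\<close>. The inductive step is the identity
  \<open>s\<^sub>j\<^sub>+\<^sub>1 s\<^sub>j\<^sup>2 s\<^sub>j\<^sub>+\<^sub>1\<^sup>-\<^sup>1 = s\<^sub>j\<^sup>-\<^sup>1 s\<^sub>j\<^sub>+\<^sub>1\<^sup>2 s\<^sub>j\<close>, conjugated by \<open>T (j + 2)\<close>, which commutes with \<open>s\<^sub>j\<close>.\<close>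

lemma T_absorb:
  assumes "j \<le> N"
  shows "T j \<otimes> s j = A j \<otimes> T (Suc j)"
proof -
  have "conj_by (T (Suc j)) (s j \<otimes> s j) = A j"
    using assms
  proof (induction j rule: inc_induct)
    case base
    then show ?case by (simp add: A_last)
  next
    case (step j)
    define x y t where "x = s j" and "y = s (Suc j)" and "t = T (Suc (Suc j))"
    have [simp]: "x \<in> carrier G" "y \<in> carrier G" "t \<in> carrier G"
      using step.hyps by (simp_all add: x_def y_def t_def)
    have "conj_by t x = x" using T_far[of j "Suc (Suc j)"] step.hyps by (simp add: conj_eq_iff x_def t_def)
    then have t: "t \<otimes> inv x = inv x \<otimes> t" by (intro intertwine_inv) (simp_all add: conj_eq_iff)
    have "x \<otimes> y \<otimes> x = y \<otimes> x \<otimes> y" using braid[of j] step.hyps by (simp add: x_def y_def)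
    then have "conj_by (x \<otimes> y) x = y" by (simp add: conj_eq_iff m_assoc)
    then have "conj_by y x = conj_by (inv x) y" by (metis \<open>x \<in> carrier G\<close> \<open>y \<in> carrier G\<close> conj_closed conj_conj conj_inv_conj(1))
    then have yx: "conj_by y (x \<otimes> x) = conj_by (inv x) (y \<otimes> y)" by (simp add: conj_mult)
    have "conj_by (T (Suc j)) (s j \<otimes> s j) = conj_by t (conj_by y (x \<otimes> x))"
      using step.hyps by (simp add: T_step[of "Suc j"] conj_conj x_def y_def t_def)
    also have "\<dots> = conj_by (inv x) (conj_by t (y \<otimes> y))" by (simp add: yx conj_conj t)
    also have "\<dots> = A j" using step by (simp add: A_step x_def y_def t_def)
    finally show ?case .
  qed
  then show ?thesis
    using assms by (simp add: T_step m_assoc conj_eq_iff)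
qed

lemma T_times_generator:
  assumes "j \<le> Suc N" "i \<le> N" "e = s i \<or> e = inv (s i)"
  shows "\<exists>h\<in>B \<union> U. \<exists>j'\<le>Suc N. T j \<otimes> e = h \<otimes> T j'"
proof -
  have ex: ?thesis if "h \<in> B \<union> U" "j' \<le> Suc N" "T j \<otimes> e = h \<otimes> T j'" for h j'
    using that by blast
  consider "i + 2 \<le> j" | "j = Suc i" | "j = i" | "j < i" by linarith
  then show ?thesis
  proof cases
    case 1
    then have "s i \<in> B" using assms by (auto intro: generate.incl)
    moreover from this have "inv (s i) \<in> B" by (rule generate_m_inv_closed[rotated]) auto
    moreover have "T j \<otimes> s i = s i \<otimes> T j" using T_far 1 assms by simp
    ultimately show ?thesis
      using ex[of "s i" j] ex[of "inv (s i)" j] assms intertwine_inv[of "T j" "s i" "s i"]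
      by auto
  next
    case 2
    have "T (Suc i) \<otimes> s i = \<one> \<otimes> T i" using assms by (simp add: T_step)
    moreover have "T (Suc i) \<otimes> inv (s i) = inv (A i) \<otimes> T i"
      using T_absorb[of i] assms by (simp add: inv_solve_left inv_solve_right m_assoc[symmetric])
    moreover have "inv (A i) \<in> U" using A_in_U assms by (intro generate_m_inv_closed) auto
    ultimately show ?thesis
      using ex[of \<one> i] ex[of "inv (A i)" i] assms 2 generate.one[of G "A ` {..N}"] by auto
  next
    case 3
    have "T i \<otimes> inv (s i) = \<one> \<otimes> T (Suc i)" using assms by (simp add: T_step m_assoc)
    moreover have "T i \<otimes> s i = A i \<otimes> T (Suc i)" using T_absorb assms by simp
    ultimately show ?thesis
      using ex[of \<one> "Suc i"] ex[of "A i" "Suc i"] assms 3 generate.one[of G "A ` {..N}"] A_in_U by auto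
  next
    case 4
    then have "s (i - 1) \<in> B" using assms by (auto intro: generate.incl)
    moreover from this have "inv (s (i - 1)) \<in> B" by (rule generate_m_inv_closed[rotated]) auto
    moreover have "T j \<otimes> s i = s (i - 1) \<otimes> T j" using T_shift 4 assms by simp
    ultimately show ?thesis
      using ex[of "s (i - 1)" j] ex[of "inv (s (i - 1))" j] assms
        intertwine_inv[of "T j" "s i" "s (i - 1)"] by auto
  qed
qed

text \<open>The products \<open>u b T\<^sub>j\<close> are permuted by right multiplication with the generators and their inverses: a
  factor from \<open>U\<close> that appears on the left of \<open>T\<^sub>j\<close> can be moved across \<open>b\<close> because \<open>B\<close> normalises \<open>U\<close>.\<close>

theorem coset_decomposition:
  assumes "w \<in> words {..N}"
  shows "\<exists>u\<in>U. \<exists>b\<in>B. \<exists>j\<le>Suc N. word_val G s w = u \<otimes> b \<otimes> T j"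
  using assms
proof (induction w rule: rev_induct)
  case Nil
  show ?case
    by (intro bexI[of _ \<one>] exI[of _ "Suc N"] conjI) (auto intro: generate.one)
next
  case (snoc l w)
  define e where "e = (if fst l then s (snd l) else inv (s (snd l)))"
  obtain u b j where h: "u \<in> U" "b \<in> B" "j \<le> Suc N" "word_val G s w = u \<otimes> b \<otimes> T j"
    using snoc by auto
  have l: "snd l \<le> N" using snoc.prems by simp
  then have e: "e \<in> carrier G" by (simp add: e_def)
  have "e = s (snd l) \<or> e = inv (s (snd l))" by (simp add: e_def)
  from T_times_generator[OF h(3) l this]
  obtain h' j' where h': "h' \<in> B \<union> U" "j' \<le> Suc N" "T j \<otimes> e = h' \<otimes> T j'" by blast
  have c: "u \<in> carrier G" "b \<in> carrier G" "h' \<in> carrier G"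
    using h h' U_subset B_subset by auto
  have "word_val G s (w @ [l]) = word_val G s w \<otimes> e"
    using snoc.prems l by (subst word_val_append[of "{..N}"]) (auto simp: e_def)
  also have "\<dots> = u \<otimes> b \<otimes> h' \<otimes> T j'"
    using h h' c e by (simp add: m_assoc)
  finally have *: "word_val G s (w @ [l]) = u \<otimes> b \<otimes> h' \<otimes> T j'" .
  show ?case
  proof (cases "h' \<in> B")
    case True
    then have "b \<otimes> h' \<in> B" using h by (intro generate.eng)
    then show ?thesis using * h h' c
      by (intro bexI[of _ u] bexI[of _ "b \<otimes> h'"] exI[of _ j']) (simp_all add: m_assoc)
  next
    case False
    then have "u \<otimes> conj_by b h' \<in> U" using h h' conj_B_U by (intro generate.eng) auto
    moreover have "u \<otimes> b \<otimes> h' = u \<otimes> conj_by b h' \<otimes> b"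
      using c conj_mult_swap[of b h'] by (simp add: m_assoc)
    ultimately show ?thesis using * h(2) h'(2) by (intro bexI[of _ "u \<otimes> conj_by b h'"] bexI[of _ b] exI[of _ j']) auto
  qed
qed

end

section \<open>Automorphisms of free groups\<close>

lemma presented_group_induct [consumes 1, case_names one gen inv mult]:
  assumes "A \<in> carrier (presented_group X R)"
    and one: "P \<one>\<^bsub>presented_group X R\<^esub>"
    and gen: "\<And>x. x \<in> X \<Longrightarrow> P (pres_gen X R x)"
    and inv: "\<And>A. A \<in> carrier (presented_group X R) \<Longrightarrow> P A \<Longrightarrow> P (inv\<^bsub>presented_group X R\<^esub> A)"
    and mult: "\<And>A B. A \<in> carrier (presented_group X R) \<Longrightarrow> B \<in> carrier (presented_group X R) \<Longrightarrow>
      P A \<Longrightarrow> P B \<Longrightarrow> P (A \<otimes>\<^bsub>presented_group X R\<^esub> B)"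
  shows "P A"
proof -
  interpret group "presented_group X R" by (rule group_presented_group)
  obtain w where w: "w \<in> words X" "A = pres_rel X R `` {w}"
    using assms(1) by (auto simp: in_carrier_presented_group)
  have "P (word_val (presented_group X R) (pres_gen X R) w)"
    using w(1)
  proof (induction w)
    case (Cons l w)
    then have "word_val (presented_group X R) (pres_gen X R) w \<in> carrier (presented_group X R)"
      by (intro word_val_closed[of X]) auto
    then show ?case using Cons by (auto intro!: mult inv gen)
  qed (simp add: one)
  then show ?thesis using w by (simp add: word_val_pres_gen)
qed

locale automorphisms = group F for F :: "('a, 'b) monoid_scheme" (structure)
begin

lemma group_Aut: "group (AutoGroup F)"
  by (rule AutoGroup)

lemma Aut_iff: "\<phi> \<in> carrier (AutoGroup F) \<longleftrightarrow> \<phi> \<in> hom F F \<and> \<phi> \<in> Bij (carrier F)"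
  by (simp add: AutoGroup_def auto_def)

lemma Aut_hom: "\<phi> \<in> carrier (AutoGroup F) \<Longrightarrow> \<phi> \<in> hom F F"
  by (simp add: Aut_iff)

lemma Aut_closed [simp]: "\<phi> \<in> carrier (AutoGroup F) \<Longrightarrow> y \<in> carrier F \<Longrightarrow> \<phi> y \<in> carrier F"
  using Aut_hom hom_in_carrier by metis

lemma Aut_group_hom: "\<phi> \<in> carrier (AutoGroup F) \<Longrightarrow> group_hom F F \<phi>"
  by (simp add: group_hom_def group_hom_axioms_def is_group Aut_hom)

lemma Aut_map_mult [simp]:
  "\<phi> \<in> carrier (AutoGroup F) \<Longrightarrow> y \<in> carrier F \<Longrightarrow> z \<in> carrier F \<Longrightarrow> \<phi> (y \<otimes> z) = \<phi> y \<otimes> \<phi> z"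
  using group_hom.hom_mult[OF Aut_group_hom] .

lemma Aut_map_inv [simp]:
  "\<phi> \<in> carrier (AutoGroup F) \<Longrightarrow> y \<in> carrier F \<Longrightarrow> \<phi> (inv y) = inv (\<phi> y)"
  using group_hom.hom_inv[OF Aut_group_hom] .

lemma Aut_map_one [simp]: "\<phi> \<in> carrier (AutoGroup F) \<Longrightarrow> \<phi> \<one> = \<one>"
  using group_hom.hom_one[OF Aut_group_hom] .

lemma Aut_mult_apply [simp]:
  "\<phi> \<in> carrier (AutoGroup F) \<Longrightarrow> \<psi> \<in> carrier (AutoGroup F) \<Longrightarrow> y \<in> carrier F \<Longrightarrow>
    (\<phi> \<otimes>\<^bsub>AutoGroup F\<^esub> \<psi>) y = \<phi> (\<psi> y)"
  by (simp add: Aut_iff) (simp add: AutoGroup_def BijGroup_def compose_def)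

lemma Aut_one_apply [simp]: "y \<in> carrier F \<Longrightarrow> \<one>\<^bsub>AutoGroup F\<^esub> y = y"
  by (simp add: AutoGroup_def BijGroup_def)

lemma Aut_inv_apply [simp]:
  assumes "\<phi> \<in> carrier (AutoGroup F)" "y \<in> carrier F"
  shows "(inv\<^bsub>AutoGroup F\<^esub> \<phi>) (\<phi> y) = y" "\<phi> ((inv\<^bsub>AutoGroup F\<^esub> \<phi>) y) = y"
proof -
  interpret K: group "AutoGroup F" by (rule group_Aut)
  show "(inv\<^bsub>AutoGroup F\<^esub> \<phi>) (\<phi> y) = y"
    using assms Aut_mult_apply[of "inv\<^bsub>AutoGroup F\<^esub> \<phi>" \<phi> y] by simp
  show "\<phi> ((inv\<^bsub>AutoGroup F\<^esub> \<phi>) y) = y"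
    using assms Aut_mult_apply[of \<phi> "inv\<^bsub>AutoGroup F\<^esub> \<phi>" y] by simp
qed

lemma Aut_inv_closed [simp]:
  "\<phi> \<in> carrier (AutoGroup F) \<Longrightarrow> inv\<^bsub>AutoGroup F\<^esub> \<phi> \<in> carrier (AutoGroup F)"
  using group.inv_closed[OF group_Aut] .

lemma Aut_mult_closed [simp]:
  "\<phi> \<in> carrier (AutoGroup F) \<Longrightarrow> \<psi> \<in> carrier (AutoGroup F) \<Longrightarrow>
    \<phi> \<otimes>\<^bsub>AutoGroup F\<^esub> \<psi> \<in> carrier (AutoGroup F)"
  using monoid.m_closed[OF group.is_monoid[OF group_Aut]] .

lemma Aut_eqI:
  assumes "\<phi> \<in> carrier (AutoGroup F)" "\<psi> \<in> carrier (AutoGroup F)"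
    and "\<And>y. y \<in> carrier F \<Longrightarrow> \<phi> y = \<psi> y"
  shows "\<phi> = \<psi>"
  using assms by (intro extensionalityI[of _ "carrier F"]) (auto simp: Aut_iff Bij_imp_extensional)

lemma restrict_in_Aut:
  assumes "f \<in> hom F F" "g \<in> hom F F"
    and "\<And>y. y \<in> carrier F \<Longrightarrow> f (g y) = y" "\<And>y. y \<in> carrier F \<Longrightarrow> g (f y) = y"
  shows "restrict f (carrier F) \<in> carrier (AutoGroup F)"
proof -
  have "bij_betw f (carrier F) (carrier F)"
    by (rule bij_betwI[of f _ _ g]) (use assms hom_in_carrier in \<open>auto simp: hom_def\<close>)
  moreover have "restrict f (carrier F) \<in> hom F F"
    using assms(1) by (auto simp: hom_def)
  ultimately show ?thesis
    by (simp add: Aut_iff Bij_def)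
qed

end

locale free_group_of_rank =
  fixes M :: nat
begin

abbreviation F where "F \<equiv> free_group M"
abbreviation x where "x \<equiv> pres_gen {..<M} {}"
abbreviation K where "K \<equiv> AutoGroup F"

lemma group_F: "group F"
  unfolding free_group_def by (rule group_presented_group)

sublocale automorphisms F
  by (simp add: automorphisms_def group_F)

sublocale K: group K
  by (rule group_Aut)

lemma x_closed [simp]: "i < M \<Longrightarrow> x i \<in> carrier F"
  by (simp add: free_group_def)

lemma free_lift_hom:
  "group G \<Longrightarrow> (\<And>i. i < M \<Longrightarrow> g i \<in> carrier G) \<Longrightarrow> pres_lift G g \<in> hom F G"
  unfolding free_group_def by (intro group.pres_lift_hom) auto

lemma free_lift_gen:
  "group G \<Longrightarrow> (\<And>i. i < M \<Longrightarrow> g i \<in> carrier G) \<Longrightarrow> i < M \<Longrightarrow> pres_lift G g (x i) = g i"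
  by (intro group.pres_lift_gen) auto

lemma hom_free_eqI:
  assumes "group G" "h \<in> hom F G" "h' \<in> hom F G" "\<And>i. i < M \<Longrightarrow> h (x i) = h' (x i)" "y \<in> carrier F"
  shows "h y = h' y"
  by (rule group.hom_presented_group_eqI[OF assms(1), of h "{..<M}" "{}" h'])
    (use assms in \<open>auto simp: free_group_def\<close>)

lemma Aut_free_eqI:
  assumes "\<phi> \<in> carrier K" "\<psi> \<in> carrier K" "\<And>i. i < M \<Longrightarrow> \<phi> (x i) = \<psi> (x i)"
  shows "\<phi> = \<psi>"
proof (rule Aut_eqI[OF assms(1,2)])
  fix y assume "y \<in> carrier F"
  then show "\<phi> y = \<psi> y"
    using hom_free_eqI[OF group_F Aut_hom[OF assms(1)] Aut_hom[OF assms(2)]] assms(3) by blast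
qed

definition kill :: "nat \<Rightarrow> nat word set \<Rightarrow> nat word set" where
  "kill n = pres_lift F (\<lambda>i. if i = n then \<one>\<^bsub>F\<^esub> else x i)"

lemma kill_hom: "kill n \<in> hom F F"
  unfolding kill_def by (rule free_lift_hom) (auto simp: group_F)

lemma kill_gen [simp]: "i < M \<Longrightarrow> kill n (x i) = (if i = n then \<one>\<^bsub>F\<^esub> else x i)"
  unfolding kill_def by (subst free_lift_gen) (auto simp: group_F)

lemma kill_group_hom: "group_hom F F (kill n)"
  by (simp add: group_hom_def group_hom_axioms_def group_F kill_hom)

lemmas kill_simps [simp] = group_hom.hom_mult[OF kill_group_hom] group_hom.hom_inv[OF kill_group_hom]
  group_hom.hom_one[OF kill_group_hom] group_hom.hom_closed[OF kill_group_hom]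

text \<open>A permutation representation of the free group that singles out the generator \<open>x n\<close>: the other
  generators multiply the first component, and \<open>x n\<close> moves only the two points above the identity, which it
  exchanges.\<close>

definition flip_perm :: "nat \<Rightarrow> nat \<Rightarrow> nat word set \<times> bool \<Rightarrow> nat word set \<times> bool" where
  "flip_perm n i = (\<lambda>(f, b) \<in> carrier F \<times> UNIV.
     if i = n then (f, if f = \<one>\<^bsub>F\<^esub> then \<not> b else b) else (x i \<otimes>\<^bsub>F\<^esub> f, b))"

lemma flip_perm_Bij: "i < M \<Longrightarrow> flip_perm n i \<in> Bij (carrier F \<times> UNIV)"
proof -
  assume i: "i < M"
  have "bij_betw (flip_perm n i) (carrier F \<times> UNIV) (carrier F \<times> UNIV)"
  proof (cases "i = n")
    case True
    then have eq: "flip_perm n i q = (fst q, if fst q = \<one>\<^bsub>F\<^esub> then \<not> snd q else snd q)"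
      if "q \<in> carrier F \<times> UNIV" for q
      using that True by (cases q) (simp add: flip_perm_def)
    show ?thesis
      by (rule bij_betwI[where g = "flip_perm n i"]) (simp_all add: eq mem_Times_iff prod_eq_iff)
  next
    case False
    then have eq: "flip_perm n i q = (x i \<otimes>\<^bsub>F\<^esub> fst q, snd q)" if "q \<in> carrier F \<times> UNIV" for q
      using that False by (cases q) (simp add: flip_perm_def)
    show ?thesis
      by (rule bij_betwI[where g = "\<lambda>q. (inv\<^bsub>F\<^esub> (x i) \<otimes>\<^bsub>F\<^esub> fst q, snd q)"])
        (simp_all add: eq mem_Times_iff i prod_eq_iff)
  qed
  then show ?thesis by (simp add: Bij_def flip_perm_def)
qed

lemma carrier_BijGroup: "carrier (BijGroup S) = Bij S"
  by (simp add: BijGroup_def)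

definition flip :: "nat \<Rightarrow> nat word set \<Rightarrow> nat word set \<times> bool \<Rightarrow> nat word set \<times> bool" where
  "flip n = pres_lift (BijGroup (carrier F \<times> UNIV)) (flip_perm n)"

lemma flip_hom: "flip n \<in> hom F (BijGroup (carrier F \<times> UNIV))"
  unfolding flip_def
  by (rule free_lift_hom) (auto simp: group_BijGroup flip_perm_Bij carrier_BijGroup)

lemma flip_gen: "i < M \<Longrightarrow> flip n (x i) = flip_perm n i"
  unfolding flip_def
  by (rule free_lift_gen) (auto simp: group_BijGroup flip_perm_Bij carrier_BijGroup)

lemma flip_Bij: "W \<in> carrier F \<Longrightarrow> flip n W \<in> Bij (carrier F \<times> UNIV)"
  using hom_in_carrier[OF flip_hom] by (simp add: BijGroup_def)

lemma flip_closed: "W \<in> carrier F \<Longrightarrow> fst q \<in> carrier F \<Longrightarrow> fst (flip n W q) \<in> carrier F"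
  using funcset_mem[OF Bij_imp_funcset[OF flip_Bij], of W q n] by (simp add: mem_Times_iff)

lemma flip_mult:
  "V \<in> carrier F \<Longrightarrow> W \<in> carrier F \<Longrightarrow> fst q \<in> carrier F \<Longrightarrow>
    flip n (V \<otimes>\<^bsub>F\<^esub> W) q = flip n V (flip n W q)"
  using hom_mult[OF flip_hom, of V W n] flip_Bij[of V n] flip_Bij[of W n]
  by (cases q) (auto simp: BijGroup_def compose_def)

lemma flip_one: "fst q \<in> carrier F \<Longrightarrow> flip n \<one>\<^bsub>F\<^esub> q = q"
  using hom_one[OF flip_hom group_F group_BijGroup] by (cases q) (auto simp: BijGroup_def)

text \<open>On first components \<open>x n\<close> acts trivially, like its image under \<open>kill n\<close>.\<close>

lemma fst_flip:
  assumes "W \<in> carrier F" "fst q \<in> carrier F"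
  shows "fst (flip n W q) = kill n W \<otimes>\<^bsub>F\<^esub> fst q"
proof -
  have "\<forall>q. fst q \<in> carrier F \<longrightarrow> fst (flip n W q) = kill n W \<otimes>\<^bsub>F\<^esub> fst q"
    using assms(1) unfolding free_group_def
  proof (induction W rule: presented_group_induct)
    case one
    then show ?case unfolding free_group_def[symmetric] by (simp add: flip_one)
  next
    case (gen i)
    then show ?case unfolding free_group_def[symmetric] by (auto simp: flip_gen flip_perm_def)
  next
    case (inv W)
    note W = inv[folded free_group_def]
    show ?case unfolding free_group_def[symmetric]
    proof (intro allI impI)
      fix q :: "nat word set \<times> bool" assume q: "fst q \<in> carrier F"
      define t where "t = flip n (inv\<^bsub>F\<^esub> W) q"
      have t: "fst t \<in> carrier F" using W q by (simp add: t_def flip_closed)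
      have "flip n W t = q"
        using W q flip_mult[of W "inv\<^bsub>F\<^esub> W" q n] by (simp add: t_def flip_one)
      then have "fst q = kill n W \<otimes>\<^bsub>F\<^esub> fst t" using W t by metis
      then show "fst (flip n (inv\<^bsub>F\<^esub> W) q) = kill n (inv\<^bsub>F\<^esub> W) \<otimes>\<^bsub>F\<^esub> fst q"
        using W t by (simp add: t_def)
    qed
  next
    case (mult V W)
    note VW = mult[folded free_group_def]
    show ?case unfolding free_group_def[symmetric]
    proof (intro allI impI)
      fix q :: "nat word set \<times> bool" assume q: "fst q \<in> carrier F"
      then have "fst (flip n W q) \<in> carrier F" using VW by (simp add: flip_closed)
      then have "fst (flip n V (flip n W q)) = kill n V \<otimes>\<^bsub>F\<^esub> fst (flip n W q)"
        using VW by blast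
      also have "fst (flip n W q) = kill n W \<otimes>\<^bsub>F\<^esub> fst q" using VW q by blast
      finally show "fst (flip n (V \<otimes>\<^bsub>F\<^esub> W) q) = kill n (V \<otimes>\<^bsub>F\<^esub> W) \<otimes>\<^bsub>F\<^esub> fst q"
        using VW(1,2) q by (simp add: flip_mult m_assoc)
    qed
  qed
  then show ?thesis using assms(2) by blast
qed

lemma x_neq_one:
  assumes "n < M" shows "x n \<noteq> \<one>\<^bsub>F\<^esub>"
proof
  assume "x n = \<one>\<^bsub>F\<^esub>"
  then have "flip_perm n n = flip n \<one>\<^bsub>F\<^esub>" using flip_gen[OF assms, of n] by simp
  then have "flip_perm n n (\<one>\<^bsub>F\<^esub>, True) = (\<one>\<^bsub>F\<^esub>, True)" by (simp add: flip_one)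
  then show False by (simp add: flip_perm_def)
qed

text \<open>If \<open>W\<close> commutes with \<open>x n\<close>, it permutes the points that \<open>x n\<close> moves, which are the two points above the
  identity. It maps them to points above \<open>kill n W\<close>.\<close>

lemma commute_with_generator:
  assumes "n < M" "W \<in> carrier F" "W \<otimes>\<^bsub>F\<^esub> x n = x n \<otimes>\<^bsub>F\<^esub> W"
  shows "kill n W = \<one>\<^bsub>F\<^esub>"
proof (rule ccontr)
  assume ne: "kill n W \<noteq> \<one>\<^bsub>F\<^esub>"
  define t where "t = flip n W (\<one>\<^bsub>F\<^esub>, True)"
  have fst_t: "fst t = kill n W" using assms by (simp add: t_def fst_flip)
  have "flip n W (\<one>\<^bsub>F\<^esub>, False) = flip n (W \<otimes>\<^bsub>F\<^esub> x n) (\<one>\<^bsub>F\<^esub>, True)"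
    using assms(1,2) by (simp add: flip_mult flip_gen flip_perm_def)
  also have "\<dots> = flip_perm n n t"
    using assms by (simp add: flip_mult flip_gen t_def)
  also have "\<dots> = t" using ne fst_t assms(2) by (cases t) (auto simp: flip_perm_def)
  finally have "flip n W (\<one>\<^bsub>F\<^esub>, False) = flip n W (\<one>\<^bsub>F\<^esub>, True)" by (simp add: t_def)
  then show False
    using flip_Bij[OF assms(2), of n] by (auto simp: Bij_def bij_betw_def dest: inj_onD)
qed

text \<open>The convention for the Artin representation is \<open>x\<^sub>i \<mapsto> x\<^sub>i\<^sub>+\<^sub>1\<close> and
  \<open>x\<^sub>i\<^sub>+\<^sub>1 \<mapsto> x\<^sub>i\<^sub>+\<^sub>1\<^sup>-\<^sup>1 x\<^sub>i x\<^sub>i\<^sub>+\<^sub>1\<close>. With it the braid \<open>A j\<close> of the previous section conjugates the last generator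
  by an element that is just \<open>x\<^sub>j\<^sup>-\<^sup>1\<close> modulo the last generator.\<close>

definition artin_image :: "nat \<Rightarrow> nat \<Rightarrow> nat word set" where
  "artin_image i j = (if j = i then x (Suc i)
     else if j = Suc i then inv\<^bsub>F\<^esub> x (Suc i) \<otimes>\<^bsub>F\<^esub> (x i \<otimes>\<^bsub>F\<^esub> x (Suc i)) else x j)"

definition artin_inverse_image :: "nat \<Rightarrow> nat \<Rightarrow> nat word set" where
  "artin_inverse_image i j = (if j = i then x i \<otimes>\<^bsub>F\<^esub> (x (Suc i) \<otimes>\<^bsub>F\<^esub> inv\<^bsub>F\<^esub> x i)
     else if j = Suc i then x i else x j)"

definition \<sigma> :: "nat \<Rightarrow> nat word set \<Rightarrow> nat word set" where
  "\<sigma> i = restrict (pres_lift F (artin_image i)) (carrier F)"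

lemma \<sigma>_in_Aut [simp]:
  assumes "Suc i < M"
  shows "\<sigma> i \<in> carrier K"
  unfolding \<sigma>_def
proof (rule restrict_in_Aut)
  have cl: "artin_image i j \<in> carrier F" "artin_inverse_image i j \<in> carrier F" if "j < M" for j
    using that assms by (auto simp: artin_image_def artin_inverse_image_def)
  show h: "pres_lift F (artin_image i) \<in> hom F F" and h': "pres_lift F (artin_inverse_image i) \<in> hom F F"
    using cl by (auto intro!: free_lift_hom simp: group_F)
  interpret g: group_hom F F "pres_lift F (artin_image i)"
    by (simp add: group_hom_def group_hom_axioms_def group_F h)
  interpret g': group_hom F F "pres_lift F (artin_inverse_image i)"
    by (simp add: group_hom_def group_hom_axioms_def group_F h')
  note gen = free_lift_gen[OF group_F, of "artin_image i"] free_lift_gen[OF group_F, of "artin_inverse_image i"]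
  have id: "(\<lambda>y. y) \<in> hom F F" by (simp add: hom_def)
  have gens: "pres_lift F (artin_image i) (pres_lift F (artin_inverse_image i) (x j)) = x j"
      "pres_lift F (artin_inverse_image i) (pres_lift F (artin_image i) (x j)) = x j" if "j < M" for j
  proof -
    have cl': "artin_image i j \<in> carrier F" "artin_inverse_image i j \<in> carrier F"
      using cl[OF that] by auto
    consider "j = i" | "j = Suc i" | "j \<noteq> i" "j \<noteq> Suc i" by blast
    then have "pres_lift F (artin_image i) (pres_lift F (artin_inverse_image i) (x j)) = x j \<and>
      pres_lift F (artin_inverse_image i) (pres_lift F (artin_image i) (x j)) = x j"
      by cases (use assms that in \<open>simp_all add: gen cl, simp_all add: artin_image_def
        artin_inverse_image_def gen cl m_assoc inv_mult_group\<close>)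
    then show "pres_lift F (artin_image i) (pres_lift F (artin_inverse_image i) (x j)) = x j"
      "pres_lift F (artin_inverse_image i) (pres_lift F (artin_image i) (x j)) = x j" by auto
  qed
  show "pres_lift F (artin_image i) (pres_lift F (artin_inverse_image i) y) = y" if "y \<in> carrier F" for y
    using hom_free_eqI[OF group_F Group.hom_compose[OF h' h] id _ that] gens(1) by (simp add: comp_def)
  show "pres_lift F (artin_inverse_image i) (pres_lift F (artin_image i) y) = y" if "y \<in> carrier F" for y
    using hom_free_eqI[OF group_F Group.hom_compose[OF h h'] id _ that] gens(2) by (simp add: comp_def)
qed

lemma \<sigma>_gen:
  assumes "Suc i < M" "j < M"
  shows "\<sigma> i (x j) = artin_image i j"
proof -
  have "artin_image i j \<in> carrier F" if "j < M" for j
    using that assms by (auto simp: artin_image_def)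
  then show ?thesis using assms by (simp add: \<sigma>_def free_lift_gen group_F)
qed

lemma \<sigma>_simps:
  assumes "Suc i < M"
  shows "\<sigma> i (x i) = x (Suc i)"
    "\<sigma> i (x (Suc i)) = inv\<^bsub>F\<^esub> x (Suc i) \<otimes>\<^bsub>F\<^esub> (x i \<otimes>\<^bsub>F\<^esub> x (Suc i))"
    "j < M \<Longrightarrow> j \<noteq> i \<Longrightarrow> j \<noteq> Suc i \<Longrightarrow> \<sigma> i (x j) = x j"
  using assms by (simp_all add: \<sigma>_gen artin_image_def)

lemma \<sigma>_far_commute:
  assumes "i + 2 \<le> j" "Suc j < M"
  shows "\<sigma> i \<otimes>\<^bsub>K\<^esub> \<sigma> j = \<sigma> j \<otimes>\<^bsub>K\<^esub> \<sigma> i"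
proof (rule Aut_free_eqI)
  fix k assume k: "k < M"
  consider "k = i" | "k = Suc i" | "k = j" | "k = Suc j"
    | "k \<noteq> i" "k \<noteq> Suc i" "k \<noteq> j" "k \<noteq> Suc j" by blast
  then show "(\<sigma> i \<otimes>\<^bsub>K\<^esub> \<sigma> j) (x k) = (\<sigma> j \<otimes>\<^bsub>K\<^esub> \<sigma> i) (x k)"
    by cases (use assms k in \<open>simp_all add: \<sigma>_simps\<close>)
qed (use assms in simp_all)

lemma \<sigma>_braid:
  assumes "Suc (Suc i) < M"
  shows "\<sigma> i \<otimes>\<^bsub>K\<^esub> \<sigma> (Suc i) \<otimes>\<^bsub>K\<^esub> \<sigma> i = \<sigma> (Suc i) \<otimes>\<^bsub>K\<^esub> \<sigma> i \<otimes>\<^bsub>K\<^esub> \<sigma> (Suc i)"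
proof (rule Aut_free_eqI)
  fix k assume k: "k < M"
  consider "k = i" | "k = Suc i" | "k = Suc (Suc i)"
    | "k \<noteq> i" "k \<noteq> Suc i" "k \<noteq> Suc (Suc i)" by blast
  then show "(\<sigma> i \<otimes>\<^bsub>K\<^esub> \<sigma> (Suc i) \<otimes>\<^bsub>K\<^esub> \<sigma> i) (x k)
      = (\<sigma> (Suc i) \<otimes>\<^bsub>K\<^esub> \<sigma> i \<otimes>\<^bsub>K\<^esub> \<sigma> (Suc i)) (x k)"
    by cases (use assms k in \<open>simp_all add: \<sigma>_simps inv_mult_group m_assoc\<close>)
qed (use assms in simp_all)

end

section \<open>Faithfulness of the Artin representation\<close>

lemma pres_eq_mono:
  "pres_eq X R u v \<Longrightarrow> X \<subseteq> Y \<Longrightarrow> pres_eq Y R u v"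
proof (induction rule: pres_eq.induct)
  case (trans u v w)
  then show ?case by (blast intro: pres_eq.trans)
qed (auto intro: pres_eq.intros words_mono)

lemma generate_as_word:
  assumes "Y \<subseteq> X" "b \<in> generate (presented_group X R) (pres_gen X R ` Y)"
  shows "\<exists>w\<in>words Y. b = pres_rel X R `` {w}"
  using assms(2)
proof (induction rule: generate.induct)
  case one
  then show ?case by (intro bexI[of _ "[]"]) (auto simp: one_presented_group)
next
  case (incl h)
  then obtain y where "y \<in> Y" "h = pres_gen X R y" by auto
  then show ?case by (intro bexI[of _ "[(True, y)]"]) (auto simp: pres_gen_def)
next
  case (inv h)
  then obtain y where y: "y \<in> Y" "h = pres_gen X R y" by auto
  then have "y \<in> X" using assms by auto
  from inv_pres_gen[OF this, of R] show ?case using y by (intro bexI[of _ "[(False, y)]"]) auto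
next
  case (eng h1 h2)
  then obtain u v where "u \<in> words Y" "h1 = pres_rel X R `` {u}" "v \<in> words Y" "h2 = pres_rel X R `` {v}"
    by blast
  then show ?case using presented_group_mult[of u X v R] words_mono[OF assms(1)]
    by (intro bexI[of _ "u @ v"]) auto
qed

lemma braid_relations_cases:
  assumes "(u, v) \<in> braid_relations"
  obtains (far) i j where "i + 2 \<le> j" "u = [(True, i), (True, j)]" "v = [(True, j), (True, i)]"
  | (near) i where "u = [(True, i), (True, Suc i), (True, i)]"
      "v = [(True, Suc i), (True, i), (True, Suc i)]"
  using assms unfolding braid_relations_def by blast

lemma braid_generators_presented:
  "braid_generators (presented_group {..N} braid_relations) (pres_gen {..N} braid_relations) N"
proof -
  let ?G = "presented_group {..N} braid_relations" and ?s = "pres_gen {..N} braid_relations"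
  interpret group ?G by (rule group_presented_group)
  have rel: "word_val ?G ?s u = word_val ?G ?s v"
    if "(u, v) \<in> braid_relations" "u \<in> words {..N}" "v \<in> words {..N}" for u v
  proof -
    have "pres_eq {..N} braid_relations u v" using that by (rule pres_eq.relation)
    then show ?thesis using that by (simp add: word_val_pres_gen pres_class_eq_iff)
  qed
  show ?thesis
  proof
    show "?s i \<in> carrier ?G" if "i \<le> N" for i using that by simp
    show "?s i \<otimes>\<^bsub>?G\<^esub> ?s j = ?s j \<otimes>\<^bsub>?G\<^esub> ?s i" if "i + 2 \<le> j" "j \<le> N" for i j
    proof -
      have "([(True, i), (True, j)], [(True, j), (True, i)]) \<in> braid_relations"
        using that by (auto simp: braid_relations_def)
      from rel[OF this] show ?thesis using that by simp
    qed
    show "?s i \<otimes>\<^bsub>?G\<^esub> ?s (Suc i) \<otimes>\<^bsub>?G\<^esub> ?s i = ?s (Suc i) \<otimes>\<^bsub>?G\<^esub> ?s i \<otimes>\<^bsub>?G\<^esub> ?s (Suc i)"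
      if "Suc i \<le> N" for i
    proof -
      have "([(True, i), (True, Suc i), (True, i)], [(True, Suc i), (True, i), (True, Suc i)])
          \<in> braid_relations"
        by (auto simp: braid_relations_def)
      from rel[OF this] show ?thesis using that by (simp add: m_assoc)
    qed
  qed
qed

context free_group_of_rank
begin

lemma \<sigma>_relations:
  assumes "n \<le> M" "(u, v) \<in> braid_relations" "u \<in> words {..<n - 1}" "v \<in> words {..<n - 1}"
  shows "word_val K \<sigma> u = word_val K \<sigma> v"
  using assms(2)
proof (cases rule: braid_relations_cases)
  case (far i j)
  then have "Suc j < M" "Suc i < M" using assms by auto
  then show ?thesis using far \<sigma>_far_commute[of i j] by simp
next
  case (near i)
  then have "Suc (Suc i) < M" using assms by auto
  then show ?thesis using near \<sigma>_braid[of i] by (simp add: K.m_assoc)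
qed

end

text \<open>The passage from \<open>n\<close> to \<open>n + 1\<close> strands. The strands are numbered from 0 to \<open>n\<close>, the generators of
  the braid group \<open>G\<close> from 0 to \<open>N = n - 1\<close>, and \<open>x n\<close> belongs to the new strand. The rank \<open>M\<close> of the free
  group stays fixed, so that all braid groups act on the same group.\<close>

locale artin_step = free_group_of_rank +
  fixes n N :: nat
  assumes n_less: "n < M" and n_Suc: "n = Suc N"
begin

abbreviation G where "G \<equiv> presented_group {..N} braid_relations"
abbreviation s where "s \<equiv> pres_gen {..N} braid_relations"

sublocale B: braid_generators G s N
  by (rule braid_generators_presented)

definition \<rho> :: "nat word set \<Rightarrow> nat word set \<Rightarrow> nat word set" where
  "\<rho> = pres_lift K \<sigma>"

lemma \<rho>_hom: "\<rho> \<in> hom G K"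
  unfolding \<rho>_def
proof (rule K.pres_lift_hom)
  have "n + 1 - 1 = Suc N" "n + 1 \<le> M" using n_Suc n_less by simp_all
  then show "word_val K \<sigma> u = word_val K \<sigma> v"
    if "(u, v) \<in> braid_relations" "u \<in> words {..N}" "v \<in> words {..N}" for u v
    using \<sigma>_relations[of "n + 1" u v] that by (simp add: lessThan_Suc_atMost)
qed (use n_Suc n_less in simp)

lemma \<rho>_gen: "i \<le> N \<Longrightarrow> \<rho> (s i) = \<sigma> i"
  unfolding \<rho>_def
proof (rule K.pres_lift_gen)
  have "n + 1 - 1 = Suc N" "n + 1 \<le> M" using n_Suc n_less by simp_all
  then show "word_val K \<sigma> u = word_val K \<sigma> v"
    if "(u, v) \<in> braid_relations" "u \<in> words {..N}" "v \<in> words {..N}" for u v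
    using \<sigma>_relations[of "n + 1" u v] that by (simp add: lessThan_Suc_atMost)
qed (use n_Suc n_less in auto)

sublocale \<rho>: group_hom G K \<rho>
  by (simp add: group_hom_def group_hom_axioms_def group_presented_group K.is_group \<rho>_hom)

lemma \<rho>_word:
  assumes "w \<in> words {..N}" shows "\<rho> (pres_rel {..N} braid_relations `` {w}) = word_val K \<sigma> w"
proof -
  have "\<rho> (pres_rel {..N} braid_relations `` {w}) = word_val K (\<rho> \<circ> s) w"
    by (rule K.hom_presented_group_word[OF \<rho>_hom assms])
  also have "\<dots> = word_val K \<sigma> w"
    by (rule word_val_cong[OF _ assms]) (simp add: \<rho>_gen)
  finally show ?thesis .
qed

lemma kill_\<sigma>:
  assumes "j < N" "y \<in> carrier F"
  shows "kill n (\<sigma> j y) = \<sigma> j (kill n y)"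
proof -
  have \<sigma>: "\<sigma> j \<in> carrier K" using assms n_Suc n_less by simp
  have "(kill n \<circ> \<sigma> j) y = (\<sigma> j \<circ> kill n) y"
  proof (rule hom_free_eqI[where h = "kill n \<circ> \<sigma> j" and h' = "\<sigma> j \<circ> kill n", OF group_F])
    show "kill n \<circ> \<sigma> j \<in> hom F F" "\<sigma> j \<circ> kill n \<in> hom F F"
      using \<sigma> Aut_hom kill_hom by (auto intro: Group.hom_compose)
    fix i assume i: "i < M"
    consider "i = j" | "i = Suc j" | "i \<noteq> j" "i \<noteq> Suc j" by blast
    then show "(kill n \<circ> \<sigma> j) (x i) = (\<sigma> j \<circ> kill n) (x i)"
      by cases (use assms n_Suc n_less i \<sigma> in \<open>simp_all add: \<sigma>_simps\<close>)
  qed (use assms in simp)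
  then show ?thesis by simp
qed

lemma \<sigma>_fixes_last: "j < N \<Longrightarrow> \<sigma> j (x n) = x n"
  using n_Suc n_less by (simp add: \<sigma>_simps)

text \<open>Braids that only move the last strand around the other ones act in this way, and \<open>v\<close> records the path of
  that strand.\<close>

definition pushes_last :: "(nat word set \<Rightarrow> nat word set) \<Rightarrow> nat word set \<Rightarrow> bool" where
  "pushes_last \<phi> v \<longleftrightarrow> (\<forall>y\<in>carrier F. kill n (\<phi> y) = kill n y) \<and>
     (\<exists>V\<in>carrier F. \<phi> (x n) = V \<otimes>\<^bsub>F\<^esub> x n \<otimes>\<^bsub>F\<^esub> inv\<^bsub>F\<^esub> V \<and> kill n V = v)"

lemma pushes_last_A_end: "pushes_last (\<rho> (B.A N)) (inv\<^bsub>F\<^esub> x N)"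
  unfolding pushes_last_def
proof
  have \<sigma>: "\<sigma> N \<in> carrier K" using n_Suc n_less by simp
  have \<rho>: "\<rho> (B.A N) y = \<sigma> N (\<sigma> N y)" if "y \<in> carrier F" for y
    using that \<sigma> by (simp add: B.A_last \<rho>_gen)
  have gens: "\<sigma> N (x N) = x n" "\<sigma> N (x n) = inv\<^bsub>F\<^esub> x n \<otimes>\<^bsub>F\<^esub> (x N \<otimes>\<^bsub>F\<^esub> x n)" "x n \<in> carrier F" "x N \<in> carrier F"
    using n_Suc n_less \<sigma>_simps(1,2)[of N] by simp_all
  show "\<forall>y\<in>carrier F. kill n (\<rho> (B.A N) y) = kill n y"
  proof
    fix y assume y: "y \<in> carrier F"
    have "(kill n \<circ> (\<sigma> N \<circ> \<sigma> N)) y = kill n y"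
    proof (rule hom_free_eqI[where h = "kill n \<circ> (\<sigma> N \<circ> \<sigma> N)" and h' = "kill n", OF group_F])
      show "kill n \<circ> (\<sigma> N \<circ> \<sigma> N) \<in> hom F F"
        using \<sigma> Aut_hom kill_hom by (auto intro!: Group.hom_compose)
      fix i assume i: "i < M"
      consider "i = N" | "i = n" | "i \<noteq> N" "i \<noteq> n" by blast
      then show "(kill n \<circ> (\<sigma> N \<circ> \<sigma> N)) (x i) = kill n (x i)"
        by cases (use n_Suc n_less i \<sigma> gens in \<open>simp_all add: \<sigma>_simps\<close>)
    qed (use y kill_hom in simp_all)
    then show "kill n (\<rho> (B.A N) y) = kill n y" using y by (simp add: \<rho>)
  qed
  show "\<exists>V\<in>carrier F. \<rho> (B.A N) (x n) = V \<otimes>\<^bsub>F\<^esub> x n \<otimes>\<^bsub>F\<^esub> inv\<^bsub>F\<^esub> V \<and> kill n V = inv\<^bsub>F\<^esub> x N"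
    by (rule bexI[of _ "inv\<^bsub>F\<^esub> x n \<otimes>\<^bsub>F\<^esub> inv\<^bsub>F\<^esub> x N"])
      (use n_Suc n_less \<sigma> gens in \<open>simp_all add: \<rho> inv_mult_group m_assoc\<close>)
qed

text \<open>By definition \<open>A j\<close> arises from \<open>A (j + 1)\<close> by conjugation with \<open>\<sigma> j\<close>, which fixes \<open>x n\<close>, commutes with
  \<open>kill n\<close>, and maps \<open>x j\<close> to \<open>x (j + 1)\<close>.\<close>

lemma pushes_last_A:
  assumes "j \<le> N"
  shows "pushes_last (\<rho> (B.A j)) (inv\<^bsub>F\<^esub> x j)"
  using assms
proof (induction j rule: inc_induct)
  case base
  show ?case by (rule pushes_last_A_end)
next
  case (step j)
  have j: "j < N" "Suc j < n" "j < M" "Suc j < M" using step.hyps n_Suc n_less by simp_all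
  define \<alpha> \<tau> where "\<alpha> = \<rho> (B.A (Suc j))" and "\<tau> = inv\<^bsub>K\<^esub> \<sigma> j"
  have \<sigma>: "\<sigma> j \<in> carrier K" and \<tau>: "\<tau> \<in> carrier K" and \<alpha>: "\<alpha> \<in> carrier K"
    using j by (simp_all add: \<alpha>_def \<tau>_def)
  have \<tau>\<sigma>: "\<tau> (\<sigma> j y) = y" "\<sigma> j (\<tau> y) = y" if "y \<in> carrier F" for y
    using \<sigma> that by (simp_all add: \<tau>_def)
  have kill_\<tau>: "kill n (\<tau> y) = \<tau> (kill n y)" if "y \<in> carrier F" for y
  proof -
    have "\<tau> (kill n (\<sigma> j (\<tau> y))) = \<tau> (\<sigma> j (kill n (\<tau> y)))"
      using kill_\<sigma>[OF j(1), of "\<tau> y"] \<tau> that by simp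
    then show ?thesis using that \<tau> by (simp add: \<tau>\<sigma>)
  qed
  have \<rho>: "\<rho> (B.A j) y = \<tau> (\<alpha> (\<sigma> j y))" if "y \<in> carrier F" for y
    using that j \<sigma> \<tau> \<alpha> by (simp add: B.A_step B.conj_by_def \<rho>_gen \<alpha>_def \<tau>_def)
  from step.IH obtain V where V: "V \<in> carrier F" "\<alpha> (x n) = V \<otimes>\<^bsub>F\<^esub> x n \<otimes>\<^bsub>F\<^esub> inv\<^bsub>F\<^esub> V"
      "kill n V = inv\<^bsub>F\<^esub> x (Suc j)" and kill: "\<And>y. y \<in> carrier F \<Longrightarrow> kill n (\<alpha> y) = kill n y"
    by (auto simp: pushes_last_def \<alpha>_def)
  have "\<tau> (x n) = x n" using \<tau>\<sigma>(1)[of "x n"] \<sigma>_fixes_last[OF j(1)] n_less by simp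
  then have "\<rho> (B.A j) (x n) = \<tau> V \<otimes>\<^bsub>F\<^esub> x n \<otimes>\<^bsub>F\<^esub> inv\<^bsub>F\<^esub> \<tau> V"
    using V \<tau> j n_less by (simp add: \<rho> \<sigma>_fixes_last)
  moreover have "\<tau> (x (Suc j)) = x j"
    using \<tau>\<sigma>(1)[of "x j"] \<sigma>_simps(1)[of j] j by simp
  then have "kill n (\<tau> V) = inv\<^bsub>F\<^esub> x j" using V \<tau> j by (simp add: kill_\<tau>)
  moreover have "kill n (\<rho> (B.A j) y) = kill n y" if "y \<in> carrier F" for y
    using that \<sigma> \<alpha> \<tau> j by (simp add: \<rho> kill_\<tau> kill kill_\<sigma> \<tau>\<sigma>)
  ultimately show ?case
    unfolding pushes_last_def using V \<tau> by (intro conjI ballI bexI[of _ "\<tau> V"]) auto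
qed

lemma pushes_last_one: "pushes_last \<one>\<^bsub>K\<^esub> \<one>\<^bsub>F\<^esub>"
  unfolding pushes_last_def using n_less by (intro conjI ballI bexI[of _ "\<one>\<^bsub>F\<^esub>"]) auto

text \<open>The order is reversed because \<open>\<phi>\<close> is applied to the conjugating element of \<open>\<psi>\<close>, which then stands to
  the left of that of \<open>\<phi>\<close>.\<close>

lemma pushes_last_mult:
  assumes "\<phi> \<in> carrier K" "\<psi> \<in> carrier K" "pushes_last \<phi> v" "pushes_last \<psi> w"
  shows "pushes_last (\<phi> \<otimes>\<^bsub>K\<^esub> \<psi>) (w \<otimes>\<^bsub>F\<^esub> v)"
proof -
  obtain V W where V: "V \<in> carrier F" "\<phi> (x n) = V \<otimes>\<^bsub>F\<^esub> x n \<otimes>\<^bsub>F\<^esub> inv\<^bsub>F\<^esub> V" "kill n V = v"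
    and W: "W \<in> carrier F" "\<psi> (x n) = W \<otimes>\<^bsub>F\<^esub> x n \<otimes>\<^bsub>F\<^esub> inv\<^bsub>F\<^esub> W" "kill n W = w"
    and kill: "\<And>y. y \<in> carrier F \<Longrightarrow> kill n (\<phi> y) = kill n y" "\<And>y. y \<in> carrier F \<Longrightarrow> kill n (\<psi> y) = kill n y"
    using assms(3,4) by (auto simp: pushes_last_def)
  show ?thesis
    unfolding pushes_last_def using assms(1,2) V W n_less
    by (intro conjI ballI bexI[of _ "\<phi> W \<otimes>\<^bsub>F\<^esub> V"]) (simp_all add: kill m_assoc inv_mult_group)
qed

lemma pushes_last_inv:
  assumes "\<phi> \<in> carrier K" "pushes_last \<phi> v"
  shows "pushes_last (inv\<^bsub>K\<^esub> \<phi>) (inv\<^bsub>F\<^esub> v)"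
proof -
  define \<psi> where "\<psi> = inv\<^bsub>K\<^esub> \<phi>"
  have \<psi>: "\<psi> \<in> carrier K" "\<And>y. y \<in> carrier F \<Longrightarrow> \<psi> (\<phi> y) = y" "\<And>y. y \<in> carrier F \<Longrightarrow> \<phi> (\<psi> y) = y"
    using assms(1) by (simp_all add: \<psi>_def)
  obtain V where V: "V \<in> carrier F" "\<phi> (x n) = V \<otimes>\<^bsub>F\<^esub> x n \<otimes>\<^bsub>F\<^esub> inv\<^bsub>F\<^esub> V" "kill n V = v"
    and kill: "\<And>y. y \<in> carrier F \<Longrightarrow> kill n (\<phi> y) = kill n y"
    using assms(2) by (auto simp: pushes_last_def)
  have kill': "kill n (\<psi> y) = kill n y" if "y \<in> carrier F" for y
    using kill[of "\<psi> y"] that \<psi> by simp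
  have "x n = \<psi> V \<otimes>\<^bsub>F\<^esub> (\<psi> (x n) \<otimes>\<^bsub>F\<^esub> inv\<^bsub>F\<^esub> \<psi> V)"
    using \<psi>(2)[of "x n"] V \<psi>(1) n_less by (simp add: m_assoc)
  then have "inv\<^bsub>F\<^esub> \<psi> V \<otimes>\<^bsub>F\<^esub> x n \<otimes>\<^bsub>F\<^esub> \<psi> V
      = inv\<^bsub>F\<^esub> \<psi> V \<otimes>\<^bsub>F\<^esub> (\<psi> V \<otimes>\<^bsub>F\<^esub> (\<psi> (x n) \<otimes>\<^bsub>F\<^esub> inv\<^bsub>F\<^esub> \<psi> V)) \<otimes>\<^bsub>F\<^esub> \<psi> V"
    by simp
  also have "\<dots> = \<psi> (x n)"
    using V \<psi>(1) n_less by (simp add: m_assoc del: Aut_map_inv)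
  finally show ?thesis
    unfolding pushes_last_def \<psi>_def[symmetric] using V \<psi>(1)
    by (intro conjI ballI bexI[of _ "inv\<^bsub>F\<^esub> \<psi> V"]) (simp_all add: kill')
qed

text \<open>Since \<open>A j\<close> pushes the last generator along \<open>x\<^sub>j\<^sup>-\<^sup>1\<close> and products are reversed, the inverse of an element of
  \<open>U\<close> can be read off its path by this homomorphism.\<close>

definition \<kappa> :: "nat word set \<Rightarrow> nat word set" where
  "\<kappa> = pres_lift G (\<lambda>j. if j \<le> N then B.A j else \<one>\<^bsub>G\<^esub>)"

lemma \<kappa>_hom: "\<kappa> \<in> hom F G"
  unfolding \<kappa>_def by (rule free_lift_hom) (auto simp: group_presented_group)

lemma \<kappa>_gen: "j \<le> N \<Longrightarrow> \<kappa> (x j) = B.A j"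
  unfolding \<kappa>_def using n_Suc n_less by (subst free_lift_gen) (auto simp: group_presented_group)

sublocale \<kappa>: group_hom F G \<kappa>
  by (simp add: group_hom_def group_hom_axioms_def group_presented_group group_F \<kappa>_hom)

lemma U_pushes_last:
  assumes "u \<in> B.U"
  shows "\<exists>v\<in>carrier F. pushes_last (\<rho> u) v \<and> \<kappa> v = inv\<^bsub>G\<^esub> u"
  using assms
proof (induction rule: generate.induct)
  case one
  then show ?case using pushes_last_one by (intro bexI[of _ "\<one>\<^bsub>F\<^esub>"]) auto
next
  case (incl h)
  then obtain j where "j \<le> N" "h = B.A j" by auto
  then show ?case using pushes_last_A[of j] n_Suc n_less
    by (intro bexI[of _ "inv\<^bsub>F\<^esub> x j"]) (auto simp: \<kappa>_gen)
next
  case (inv h)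
  then obtain j where j: "j \<le> N" "h = B.A j" by auto
  then have "pushes_last (\<rho> (inv\<^bsub>G\<^esub> h)) (inv\<^bsub>F\<^esub> (inv\<^bsub>F\<^esub> x j))"
    using pushes_last_inv[OF _ pushes_last_A[of j]] by simp
  then show ?case using j n_Suc n_less
    by (intro bexI[of _ "x j"]) (simp_all add: \<kappa>_gen)
next
  case (eng h1 h2)
  then obtain v1 v2 where v: "v1 \<in> carrier F" "pushes_last (\<rho> h1) v1" "\<kappa> v1 = inv\<^bsub>G\<^esub> h1"
      "v2 \<in> carrier F" "pushes_last (\<rho> h2) v2" "\<kappa> v2 = inv\<^bsub>G\<^esub> h2" by blast
  have h: "h1 \<in> carrier G" "h2 \<in> carrier G" using eng.hyps B.U_subset by auto
  show ?case
    using v h pushes_last_mult[of "\<rho> h1" "\<rho> h2" v1 v2]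
    by (intro bexI[of _ "v2 \<otimes>\<^bsub>F\<^esub> v1"]) (simp_all add: B.inv_mult_group)
qed

lemma B_fixes_last:
  assumes "b \<in> B.B"
  shows "\<rho> b (x n) = x n"
  using assms
proof (induction rule: generate.induct)
  case one
  then show ?case using n_less by simp
next
  case (incl h)
  then show ?case by (auto simp: \<rho>_gen \<sigma>_fixes_last)
next
  case (inv h)
  then obtain j where j: "j < N" "h = s j" by auto
  then have "\<sigma> j \<in> carrier K" using n_Suc n_less by simp
  then have "(inv\<^bsub>K\<^esub> \<sigma> j) (\<sigma> j (x n)) = x n" using n_less by simp
  then show ?case using j by (simp add: \<rho>_gen \<sigma>_fixes_last)
next
  case (eng h1 h2)
  then have "h1 \<in> carrier G" "h2 \<in> carrier G" using B.B_subset by auto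
  then show ?case using eng.IH n_less by simp
qed

lemma T_moves_to_last:
  assumes "j \<le> n"
  shows "\<rho> (B.T j) (x j) = x n"
proof -
  have "j \<le> Suc N" using assms n_Suc by simp
  then show ?thesis
  proof (induction j rule: inc_induct)
    case base
    then show ?case using n_Suc n_less by simp
  next
    case (step j)
    then show ?case using n_Suc n_less by (simp add: B.T_step \<rho>_gen \<sigma>_simps)
  qed
qed

text \<open>In \<open>y = u b T\<^sub>j\<close> the factors act in turn on \<open>x\<^sub>j\<close>: \<open>T\<^sub>j\<close> maps it to \<open>x n\<close>, \<open>b\<close> fixes that, and \<open>u\<close>
  conjugates it by some \<open>V\<close>. If \<open>y\<close> acts trivially, then \<open>x\<^sub>j\<close> is a conjugate of \<open>x n\<close>, which forces \<open>j = n\<close>,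
  and \<open>V\<close> commutes with \<open>x n\<close>, which forces its path, hence \<open>u\<close>, to be trivial.\<close>

lemma kernel_subset_B:
  assumes "y \<in> carrier G" "\<rho> y = \<one>\<^bsub>K\<^esub>"
  shows "y \<in> B.B"
proof -
  obtain w where w: "w \<in> words {..N}" "y = pres_rel {..N} braid_relations `` {w}"
    using assms(1) by (auto simp: in_carrier_presented_group)
  obtain u b j where u: "u \<in> B.U" and b: "b \<in> B.B" and j: "j \<le> Suc N"
    and "word_val G s w = u \<otimes>\<^bsub>G\<^esub> b \<otimes>\<^bsub>G\<^esub> B.T j"
    using B.coset_decomposition[OF w(1)] by blast
  then have y: "y = u \<otimes>\<^bsub>G\<^esub> b \<otimes>\<^bsub>G\<^esub> B.T j" using w by (simp add: word_val_pres_gen)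
  have cl: "u \<in> carrier G" "b \<in> carrier G" "x n \<in> carrier F" "x j \<in> carrier F"
    using u b B.U_subset B.B_subset n_less n_Suc j by auto
  obtain v V where v: "v \<in> carrier F" "\<kappa> v = inv\<^bsub>G\<^esub> u"
    and V: "V \<in> carrier F" "\<rho> u (x n) = V \<otimes>\<^bsub>F\<^esub> x n \<otimes>\<^bsub>F\<^esub> inv\<^bsub>F\<^esub> V" "kill n V = v"
    using U_pushes_last[OF u] by (auto simp: pushes_last_def)
  have "x j = \<rho> y (x j)" using assms cl by simp
  also have "\<dots> = \<rho> u (\<rho> b (\<rho> (B.T j) (x j)))" using y cl j by simp
  also have "\<dots> = V \<otimes>\<^bsub>F\<^esub> x n \<otimes>\<^bsub>F\<^esub> inv\<^bsub>F\<^esub> V"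
    using T_moves_to_last[of j] B_fixes_last[OF b] V j n_Suc by simp
  finally have xj: "x j = V \<otimes>\<^bsub>F\<^esub> x n \<otimes>\<^bsub>F\<^esub> inv\<^bsub>F\<^esub> V" .
  have "j = n"
  proof (rule ccontr)
    assume "j \<noteq> n"
    then have "x j = kill n (x j)" using j n_Suc n_less by simp
    also have "\<dots> = \<one>\<^bsub>F\<^esub>" unfolding xj using V v(1) cl n_less by simp
    finally show False using x_neq_one[of j] j n_Suc n_less by simp
  qed
  with xj have "x n \<otimes>\<^bsub>F\<^esub> V = V \<otimes>\<^bsub>F\<^esub> x n \<otimes>\<^bsub>F\<^esub> inv\<^bsub>F\<^esub> V \<otimes>\<^bsub>F\<^esub> V" by simp
  then have "V \<otimes>\<^bsub>F\<^esub> x n = x n \<otimes>\<^bsub>F\<^esub> V" using V cl by (simp add: m_assoc)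
  then have "kill n V = \<one>\<^bsub>F\<^esub>" by (rule commute_with_generator[OF n_less V(1)])
  then have "inv\<^bsub>G\<^esub> u = \<one>\<^bsub>G\<^esub>" using v V by simp
  then have "u = \<one>\<^bsub>G\<^esub>" using cl by (metis B.inv_inv B.inv_one)
  then show ?thesis using y b cl \<open>j = n\<close> n_Suc by simp
qed

end

context free_group_of_rank
begin

text \<open>A braid that acts trivially lies in the subgroup \<open>B\<close>, so it is represented by a word in the generators for
  one strand less. That word acts trivially too.\<close>

lemma artin_word_faithful:
  assumes "n \<le> M" "w \<in> words {..<n - 1}" "word_val K \<sigma> w = \<one>\<^bsub>K\<^esub>"
  shows "pres_eq {..<n - 1} braid_relations w []"
  using assms
proof (induction n arbitrary: w)
  case 0
  then show ?case by (cases w) (auto intro: pres_eq.refl)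
next
  case (Suc n)
  show ?case
  proof (cases n)
    case 0
    then show ?thesis using Suc.prems by (cases w) (auto intro: pres_eq.refl)
  next
    case n: (Suc N)
    interpret artin_step M n N by unfold_locales (use Suc.prems n in auto)
    have X: "{..<Suc n - 1} = {..N}" using n by (auto simp: lessThan_Suc_atMost)
    define y where "y = pres_rel {..N} braid_relations `` {w}"
    have w: "w \<in> words {..N}" using Suc.prems X by simp
    then have y: "y \<in> carrier G" by (auto simp: y_def in_carrier_presented_group)
    moreover have "\<rho> y = \<one>\<^bsub>K\<^esub>" using \<rho>_word[OF w] Suc.prems by (simp add: y_def)
    ultimately have "y \<in> B.B" by (rule kernel_subset_B)
    then obtain v where v: "v \<in> words {..<N}" "y = pres_rel {..N} braid_relations `` {v}"
      using generate_as_word[of "{..<N}" "{..N}" y braid_relations] lessThan_subset_iff[of N "Suc N"]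
      by (auto simp: lessThan_Suc_atMost)
    have vN: "v \<in> words {..N}" by (rule words_mono[OF _ v(1)]) auto
    have "word_val K \<sigma> v = \<one>\<^bsub>K\<^esub>" using \<rho>_word[OF vN] v \<open>\<rho> y = \<one>\<^bsub>K\<^esub>\<close> by simp
    then have "pres_eq {..<n - 1} braid_relations v []"
      using Suc.IH[of v] Suc.prems v n by simp
    then have "pres_eq {..N} braid_relations v []" by (rule pres_eq_mono) (use n in auto)
    moreover have "pres_eq {..N} braid_relations w v"
      using v w vN by (simp add: y_def pres_class_eq_iff)
    ultimately show ?thesis using X pres_eq.trans by metis
  qed
qed

theorem artin_representation_faithful:
  "pres_lift K \<sigma> \<in> mon (braid_group M) (AutoGroup F)"
  unfolding mon_def
proof (intro CollectI conjI)
  have rel: "word_val K \<sigma> u = word_val K \<sigma> v"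
    if "(u, v) \<in> braid_relations" "u \<in> words {..<M - 1}" "v \<in> words {..<M - 1}" for u v
    using that by (rule \<sigma>_relations[OF order.refl])
  show hom: "pres_lift K \<sigma> \<in> hom (braid_group M) K"
    unfolding braid_group_def by (rule K.pres_lift_hom[OF _ rel]) auto
  interpret h: group_hom "braid_group M" K "pres_lift K \<sigma>"
    using hom by (simp add: group_hom_def group_hom_axioms_def braid_group_def group_presented_group K.is_group)
  show "inj_on (pres_lift K \<sigma>) (carrier (braid_group M))"
  proof (subst h.inj_on_one_iff, intro allI impI)
    fix y assume "y \<in> carrier (braid_group M)" and 1: "pres_lift K \<sigma> y = \<one>\<^bsub>K\<^esub>"
    then obtain w where w: "w \<in> words {..<M - 1}" "y = pres_rel {..<M - 1} braid_relations `` {w}"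
      by (auto simp: braid_group_def in_carrier_presented_group)
    have "pres_lift K \<sigma> y = word_val K \<sigma> w"
      unfolding w(2) by (rule K.pres_lift_class[OF _ rel w(1)]) auto
    then have "pres_eq {..<M - 1} braid_relations w []"
      using 1 w by (intro artin_word_faithful) auto
    then show "y = \<one>\<^bsub>braid_group M\<^esub>"
      using w by (simp add: braid_group_def one_presented_group pres_class_eq_iff)
  qed
qed

end

section \<open>Polynomial functions\<close>

definition const_mpol :: "'k::comm_semiring_1 \<Rightarrow> 'k mpol" where
  "const_mpol c = Poly_Mapping.single 0 c"

definition var_mpol :: "nat \<Rightarrow> 'k::comm_semiring_1 mpol" where
  "var_mpol i = Poly_Mapping.single (Poly_Mapping.single i 1) 1"

lemma mpeval_const [simp]: "mpeval (const_mpol c) x = c"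
  by (simp add: const_mpol_def mpeval_single mono_eval_def)

lemma mpeval_var [simp]: "mpeval (var_mpol i) x = x ! i"
  by (simp add: var_mpol_def mpeval_single mono_eval_def)

lemma const_mpol_polys [simp]: "const_mpol c \<in> polys n"
  by (simp add: const_mpol_def polys_def)

lemma var_mpol_polys [simp]: "i < n \<Longrightarrow> var_mpol i \<in> polys n"
  by (simp add: var_mpol_def polys_def)

lemma polys_add: "f \<in> polys n \<Longrightarrow> g \<in> polys n \<Longrightarrow> f + g \<in> polys n"
  unfolding polys_def using Poly_Mapping.keys_add[of f g] by blast

text \<open>An induction principle: a property of functions that holds for constants and coordinates, and is
  preserved by sums and products, holds for all polynomial expressions in the coordinates.\<close>

lemma mpeval_closed:
  assumes const: "\<And>c. S (\<lambda>_. c)"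
    and add: "\<And>f g. S f \<Longrightarrow> S g \<Longrightarrow> S (\<lambda>x. f x + g x)"
    and mult: "\<And>f g. S f \<Longrightarrow> S g \<Longrightarrow> S (\<lambda>x. f x * g x)"
    and coord: "\<And>i. i < n \<Longrightarrow> S (\<lambda>x. \<psi> x ! i)"
    and p: "p \<in> polys n"
  shows "S (\<lambda>x. mpeval p (\<psi> x))"
proof -
  have sum: "S (\<lambda>x. \<Sum>i\<in>I. f i x)" if "finite I" "\<And>i. i \<in> I \<Longrightarrow> S (f i)" for I :: "(nat \<Rightarrow>\<^sub>0 nat) set" and f
    using that by (induction I rule: finite_induct) (auto intro: const add)
  have prod: "S (\<lambda>x. \<Prod>i\<in>I. f i x)" if "finite I" "\<And>i. i \<in> I \<Longrightarrow> S (f i)" for I :: "nat set" and f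
    using that by (induction I rule: finite_induct) (auto intro: const mult)
  have pow: "S (\<lambda>x. f x ^ e)" if "S f" for f and e :: nat
    by (induction e) (auto intro: const mult that)
  have "S (\<lambda>x. Poly_Mapping.lookup p m * mono_eval m (\<psi> x))" if "m \<in> Poly_Mapping.keys p" for m
  proof (rule mult[OF const])
    have "Poly_Mapping.keys m \<subseteq> {..<n}" using p that by (auto simp: polys_def)
    then have "\<And>i. i \<in> Poly_Mapping.keys m \<Longrightarrow> S (\<lambda>x. (\<psi> x ! i) ^ Poly_Mapping.lookup m i)"
      by (intro pow coord) auto
    then show "S (\<lambda>x. mono_eval m (\<psi> x))"
      unfolding mono_eval_def by (rule prod[OF finite_keys])
  qed
  then show ?thesis unfolding mpeval_def by (rule sum[OF finite_keys])
qed

section \<open>Spaces with functions in which nonvanishing functions are invertible\<close>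

text \<open>The second assumption distinguishes spaces of algebraic geometry among all spaces with functions: it
  says that the stalks are local rings. It makes loci of agreement closed and quotients regular.\<close>

locale function_space =
  fixes X :: "('p, 'k::field) fspace"
  assumes space_with_functions: "space_with_functions X"
    and nonvanishing: "openin (Top X) U \<Longrightarrow> regular X U f \<Longrightarrow>
      openin (Top X) {x \<in> U. f x \<noteq> 0} \<and> regular X {x \<in> U. f x \<noteq> 0} (\<lambda>x. inverse (f x))"
begin

lemmas function_axioms = space_with_functions[unfolded space_with_functions_def]

lemma regular_cong:
  assumes "openin (Top X) U" "\<And>x. x \<in> U \<Longrightarrow> f x = g x" "regular X U f"
  shows "regular X U g"
  by (rule function_axioms[THEN conjunct1, rule_format, OF assms(1) _ assms(3)]) (rule assms(2))

lemma regular_const: "openin (Top X) U \<Longrightarrow> regular X U (\<lambda>_. c)"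
  by (rule function_axioms[THEN conjunct2, THEN conjunct1, rule_format])

lemma regular_add:
  "openin (Top X) U \<Longrightarrow> regular X U f \<Longrightarrow> regular X U g \<Longrightarrow> regular X U (\<lambda>x. f x + g x)"
  by (rule function_axioms[THEN conjunct2, THEN conjunct2, THEN conjunct1, rule_format, THEN conjunct1])

lemma regular_mult:
  "openin (Top X) U \<Longrightarrow> regular X U f \<Longrightarrow> regular X U g \<Longrightarrow> regular X U (\<lambda>x. f x * g x)"
  by (rule function_axioms[THEN conjunct2, THEN conjunct2, THEN conjunct1, rule_format, THEN conjunct2])

lemma regular_restrict:
  assumes "regular X U f" "openin (Top X) U" "openin (Top X) V" "V \<subseteq> U"
  shows "regular X V f"
  by (rule function_axioms[THEN conjunct2, THEN conjunct2, THEN conjunct2, THEN conjunct1,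
    rule_format, OF assms(2,3,4,1)])

lemma regular_glue:
  "(\<And>U. U \<in> \<U> \<Longrightarrow> openin (Top X) U \<and> regular X U f) \<Longrightarrow> regular X (\<Union>\<U>) f"
  by (rule function_axioms[THEN conjunct2, THEN conjunct2, THEN conjunct2, THEN conjunct2, rule_format])

lemma regular_local:
  assumes "\<And>x. x \<in> U \<Longrightarrow> \<exists>W. openin (Top X) W \<and> x \<in> W \<and> W \<subseteq> U \<and> regular X W f"
  shows "regular X U f"
proof -
  have "U = \<Union>{W. openin (Top X) W \<and> W \<subseteq> U \<and> regular X W f}" using assms by blast
  then show ?thesis using regular_glue[of "{W. openin (Top X) W \<and> W \<subseteq> U \<and> regular X W f}" f] by auto
qed

lemma regular_diff:
  assumes "openin (Top X) U" "regular X U f" "regular X U g"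
  shows "regular X U (\<lambda>x. f x - g x)"
  using regular_add[OF assms(1,2) regular_mult[OF assms(1) regular_const[OF assms(1), of "- 1"] assms(3)]]
  by simp

lemma regular_divide:
  assumes "openin (Top X) U" "regular X U f" "regular X U g" "\<And>x. x \<in> U \<Longrightarrow> g x \<noteq> 0"
  shows "regular X U (\<lambda>x. f x / g x)"
proof -
  have "{x \<in> U. g x \<noteq> 0} = U" using assms(4) by auto
  then have "regular X U (\<lambda>x. inverse (g x))" using nonvanishing[OF assms(1,3)] by simp
  from regular_mult[OF assms(1,2) this] show ?thesis by (simp add: field_simps)
qed

lemma regular_mpeval:
  assumes "openin (Top X) U" "p \<in> polys n" "\<And>i. i < n \<Longrightarrow> regular X U (\<lambda>x. \<psi> x ! i)"
  shows "regular X U (\<lambda>x. mpeval p (\<psi> x))"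
  by (rule mpeval_closed[where S = "regular X U", OF _ _ _ assms(3,2)])
    (auto intro: assms(1) regular_const regular_add regular_mult)

lemma openin_nonzero: "openin (Top X) U \<Longrightarrow> regular X U f \<Longrightarrow> openin (Top X) {x \<in> U. f x \<noteq> 0}"
  using nonvanishing by blast

end

lemma open_subspace_simps [simp]:
  "Top (open_subspace X U) = subtopology (Top X) U" "regular (open_subspace X U) = regular X"
  by (simp_all add: open_subspace_def)

lemma function_space_open_subspace:
  assumes "function_space X" "openin (Top X) U"
  shows "function_space (open_subspace X U)"
proof -
  interpret function_space X by fact
  show ?thesis
  proof
    show "space_with_functions (open_subspace X U)"
      unfolding space_with_functions_def open_subspace_simps openin_open_subtopology[OF assms(2)]
    proof (intro conjI allI impI, goal_cases)
      case (1 V f g)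
      then show ?case by (intro regular_cong[of V f g]) auto
    next
      case (2 V c)
      then show ?case by (intro regular_const) auto
    next
      case (3 V f g)
      then show ?case by (intro regular_add) auto
    next
      case (4 V f g)
      then show ?case by (intro regular_mult) auto
    next
      case (5 V W f)
      then show ?case by (intro regular_restrict[of V f W]) auto
    next
      case (6 \<V> f)
      then show ?case by (intro regular_glue) auto
    qed
    show "openin (Top (open_subspace X U)) {x \<in> V. f x \<noteq> 0} \<and>
        regular (open_subspace X U) {x \<in> V. f x \<noteq> 0} (\<lambda>x. inverse (f x))"
      if "openin (Top (open_subspace X U)) V" "regular (open_subspace X U) V f" for V f
      using that nonvanishing[of V f] by (auto simp: openin_open_subtopology[OF assms(2)])
  qed
qed

section \<open>Morphisms\<close>

lemma morphism_cong:
  assumes "function_space X" "morphism X Y \<phi>" "\<And>x. x \<in> topspace (Top X) \<Longrightarrow> \<phi> x = \<psi> x"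
  shows "morphism X Y \<psi>"
proof -
  interpret function_space X by fact
  have cont: "continuous_map (Top X) (Top Y) \<psi>"
    using assms(2,3) continuous_map_eq unfolding morphism_def by blast
  have "regular X {x \<in> topspace (Top X). \<psi> x \<in> V} (g \<circ> \<psi>)"
    if V: "openin (Top Y) V" "regular Y V g" for V g
  proof -
    have eq: "{x \<in> topspace (Top X). \<psi> x \<in> V} = {x \<in> topspace (Top X). \<phi> x \<in> V}"
      using assms(3) by auto
    have "regular X {x \<in> topspace (Top X). \<phi> x \<in> V} (g \<circ> \<phi>)"
      using assms(2) V unfolding morphism_def by blast
    then have "regular X {x \<in> topspace (Top X). \<phi> x \<in> V} (g \<circ> \<psi>)"
      using regular_cong[OF openin_continuous_map_preimage[OF cont V(1)], of "g \<circ> \<phi>" "g \<circ> \<psi>"] assms(3)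
      by (simp add: eq)
    then show ?thesis by (simp add: eq)
  qed
  then show ?thesis using cont by (simp add: morphism_def)
qed

lemma morphism_compose:
  assumes "morphism X Y \<phi>" "morphism Y Z \<psi>"
  shows "morphism X Z (\<psi> \<circ> \<phi>)"
  unfolding morphism_def
proof (intro conjI allI impI)
  have cont: "continuous_map (Top X) (Top Y) \<phi>" "continuous_map (Top Y) (Top Z) \<psi>"
    using assms by (auto simp: morphism_def)
  then show "continuous_map (Top X) (Top Z) (\<psi> \<circ> \<phi>)" by (rule continuous_map_compose)
  fix V g assume V: "openin (Top Z) V" "regular Z V g"
  let ?W = "{y \<in> topspace (Top Y). \<psi> y \<in> V}"
  have "openin (Top Y) ?W" "regular Y ?W (g \<circ> \<psi>)"
    using V assms(2) openin_continuous_map_preimage[OF cont(2)] by (auto simp: morphism_def)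
  then have "regular X {x \<in> topspace (Top X). \<phi> x \<in> ?W} ((g \<circ> \<psi>) \<circ> \<phi>)"
    using assms(1) unfolding morphism_def by blast
  moreover have "{x \<in> topspace (Top X). \<phi> x \<in> ?W} = {x \<in> topspace (Top X). (\<psi> \<circ> \<phi>) x \<in> V}"
    using continuous_map_image_subset_topspace[OF cont(1)] by auto
  ultimately show "regular X {x \<in> topspace (Top X). (\<psi> \<circ> \<phi>) x \<in> V} (g \<circ> (\<psi> \<circ> \<phi>))"
    by (simp add: comp_assoc)
qed

lemma morphism_id: "morphism X X id"
proof -
  have "{x \<in> topspace (Top X). id x \<in> V} = V" if "openin (Top X) V" for V
    using openin_subset[OF that] by auto
  then show ?thesis by (simp add: morphism_def)
qed

lemma morphism_restrict_domain:
  assumes "function_space X" "morphism X Y \<phi>" "openin (Top X) U"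
  shows "morphism (open_subspace X U) Y \<phi>"
proof -
  interpret function_space X by fact
  have cont: "continuous_map (Top X) (Top Y) \<phi>" using assms(2) by (simp add: morphism_def)
  have "regular X {x \<in> topspace (Top X) \<inter> U. \<phi> x \<in> V} (g \<circ> \<phi>)"
    if V: "openin (Top Y) V" "regular Y V g" for V g
  proof (rule regular_restrict)
    show "regular X {x \<in> topspace (Top X). \<phi> x \<in> V} (g \<circ> \<phi>)"
      using assms(2) V by (auto simp: morphism_def)
    show o: "openin (Top X) {x \<in> topspace (Top X). \<phi> x \<in> V}"
      by (rule openin_continuous_map_preimage[OF cont V(1)])
    have "{x \<in> topspace (Top X) \<inter> U. \<phi> x \<in> V} = {x \<in> topspace (Top X). \<phi> x \<in> V} \<inter> U" by auto
    then show "openin (Top X) {x \<in> topspace (Top X) \<inter> U. \<phi> x \<in> V}" using o assms(3) by auto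
  qed auto
  then show ?thesis
    using continuous_map_from_subtopology[OF cont] by (simp add: morphism_def)
qed

lemma morphism_restrict_codomain:
  assumes "morphism X Y \<phi>" "openin (Top Y) V" "\<And>x. x \<in> topspace (Top X) \<Longrightarrow> \<phi> x \<in> V"
  shows "morphism X (open_subspace Y V) \<phi>"
  using assms by (auto simp: morphism_def continuous_map_in_subtopology openin_open_subtopology)

lemma morphism_maps_to:
  "morphism X Y \<phi> \<Longrightarrow> x \<in> topspace (Top X) \<Longrightarrow> \<phi> x \<in> topspace (Top Y)"
  using continuous_map_image_subset_topspace unfolding morphism_def by blast

lemma openin_morphism_preimage:
  "morphism X Y \<phi> \<Longrightarrow> openin (Top Y) V \<Longrightarrow> openin (Top X) {x \<in> topspace (Top X). \<phi> x \<in> V}"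
  unfolding morphism_def by (auto intro: openin_continuous_map_preimage)

lemma morphism_pullback:
  "morphism X Y \<phi> \<Longrightarrow> openin (Top Y) V \<Longrightarrow> regular Y V g \<Longrightarrow>
    regular X {x \<in> topspace (Top X). \<phi> x \<in> V} (g \<circ> \<phi>)"
  by (simp add: morphism_def)

text \<open>Affine and projective regular functions are both defined as functions that are locally quotients, and
  only the closure properties of quotients on a fixed set differ. Here \<open>Q W f\<close> stands for \<open>f\<close> being such a
  quotient on \<open>W\<close>.\<close>

lemma function_space_of_local_property:
  fixes X :: "('p, 'k::field) fspace"
  assumes regular: "\<And>U f. regular X U f \<longleftrightarrow>
      (\<forall>p\<in>U. \<exists>W. openin (Top X) W \<and> p \<in> W \<and> W \<subseteq> U \<and> Q W f)"
    and cong: "\<And>W f g. Q W f \<Longrightarrow> (\<And>x. x \<in> W \<Longrightarrow> f x = g x) \<Longrightarrow> Q W g"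
    and restrict: "\<And>V W f. Q W f \<Longrightarrow> V \<subseteq> W \<Longrightarrow> Q V f"
    and const: "\<And>W c. openin (Top X) W \<Longrightarrow> Q W (\<lambda>_. c)"
    and add: "\<And>W f g. Q W f \<Longrightarrow> Q W g \<Longrightarrow> Q W (\<lambda>x. f x + g x)"
    and mult: "\<And>W f g. Q W f \<Longrightarrow> Q W g \<Longrightarrow> Q W (\<lambda>x. f x * g x)"
    and inverse: "\<And>W f. openin (Top X) W \<Longrightarrow> Q W f \<Longrightarrow>
      openin (Top X) {x \<in> W. f x \<noteq> 0} \<and> Q {x \<in> W. f x \<noteq> 0} (\<lambda>x. inverse (f x))"
  shows "function_space X"
proof
  have regularI: "regular X U f"
    if "\<And>p. p \<in> U \<Longrightarrow> \<exists>W. openin (Top X) W \<and> p \<in> W \<and> W \<subseteq> U \<and> Q W f" for U f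
    unfolding regular using that by blast
  have two: "\<exists>W. openin (Top X) W \<and> p \<in> W \<and> W \<subseteq> U \<and> Q W f \<and> Q W g"
    if fg: "regular X U f" "regular X U g" and p: "p \<in> U" for U f g p
  proof -
    obtain V where V: "openin (Top X) V" "p \<in> V" "V \<subseteq> U" "Q V f" using fg(1) p unfolding regular by blast
    obtain W where W: "openin (Top X) W" "p \<in> W" "W \<subseteq> U" "Q W g" using fg(2) p unfolding regular by blast
    show ?thesis
      using V W restrict[OF V(4), of "V \<inter> W"] restrict[OF W(4), of "V \<inter> W"]
      by (intro exI[of _ "V \<inter> W"]) (simp add: openin_Int le_infI1)
  qed
  show "space_with_functions X"
    unfolding space_with_functions_def
  proof (intro conjI allI impI, goal_cases)
    case (1 U f g)
    show ?case
    proof (rule regularI)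
      fix p assume "p \<in> U"
      then obtain W where W: "openin (Top X) W" "p \<in> W" "W \<subseteq> U" "Q W f" using 1(3) unfolding regular by blast
      have "Q W g" by (rule cong[OF W(4)]) (use 1(2) W(3) in blast)
      with W show "\<exists>W. openin (Top X) W \<and> p \<in> W \<and> W \<subseteq> U \<and> Q W g" by blast
    qed
  next
    case (2 U c)
    then show ?case by (intro regularI exI[of _ U]) (simp add: const)
  next
    case (3 U f g)
    show ?case
    proof (rule regularI)
      fix p assume "p \<in> U"
      from two[OF 3(2,3) this] obtain W where "openin (Top X) W" "p \<in> W" "W \<subseteq> U" "Q W f" "Q W g" by blast
      with add show "\<exists>W. openin (Top X) W \<and> p \<in> W \<and> W \<subseteq> U \<and> Q W (\<lambda>x. f x + g x)" by auto
    qed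
  next
    case (4 U f g)
    show ?case
    proof (rule regularI)
      fix p assume "p \<in> U"
      from two[OF 4(2,3) this] obtain W where "openin (Top X) W" "p \<in> W" "W \<subseteq> U" "Q W f" "Q W g" by blast
      with mult show "\<exists>W. openin (Top X) W \<and> p \<in> W \<and> W \<subseteq> U \<and> Q W (\<lambda>x. f x * g x)" by auto
    qed
  next
    case (5 U V f)
    show ?case
    proof (rule regularI)
      fix p assume p: "p \<in> V"
      then obtain W where W: "openin (Top X) W" "p \<in> W" "Q W f" using 5(3,4) unfolding regular by blast
      then show "\<exists>W. openin (Top X) W \<and> p \<in> W \<and> W \<subseteq> V \<and> Q W f"
        using 5(2) p restrict[OF W(3), of "W \<inter> V"] by (intro exI[of _ "W \<inter> V"]) (simp add: openin_Int)
    qed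
  next
    case (6 \<U> f)
    show ?case
    proof (rule regularI)
      fix p assume "p \<in> \<Union>\<U>"
      then obtain U where U: "U \<in> \<U>" "p \<in> U" by blast
      then obtain W where "openin (Top X) W" "p \<in> W" "W \<subseteq> U" "Q W f" using 6 unfolding regular by blast
      then show "\<exists>W. openin (Top X) W \<and> p \<in> W \<and> W \<subseteq> \<Union>\<U> \<and> Q W f" using U(1) by blast
    qed
  qed
  show "openin (Top X) {x \<in> U. f x \<noteq> 0} \<and> regular X {x \<in> U. f x \<noteq> 0} (\<lambda>x. inverse (f x))"
    if U: "regular X U f" for U f
  proof -
    have local: "\<exists>W. openin (Top X) W \<and> p \<in> W \<and> W \<subseteq> {x \<in> U. f x \<noteq> 0} \<and> Q W (\<lambda>x. inverse (f x))"
      if p: "p \<in> {x \<in> U. f x \<noteq> 0}" for p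
    proof -
      obtain W where W: "openin (Top X) W" "p \<in> W" "W \<subseteq> U" "Q W f" using U p unfolding regular by blast
      then show ?thesis using p inverse[OF W(1,4)] by (intro exI[of _ "{x \<in> W. f x \<noteq> 0}"]) blast
    qed
    then have "regular X {x \<in> U. f x \<noteq> 0} (\<lambda>x. inverse (f x))" by (rule regularI)
    moreover have "openin (Top X) {x \<in> U. f x \<noteq> 0}"
      by (subst openin_subopen) (use local in blast)
    ultimately show ?thesis by blast
  qed
qed

section \<open>Algebraic sets\<close>

lemma openin_algebraic_set:
  "openin (Top (algebraic_set n Z)) U \<longleftrightarrow>
    (\<exists>F\<subseteq>polys n. U = {x \<in> affine_points n \<inter> Z. \<exists>f\<in>F. mpeval f x \<noteq> 0})"
proof -
  have "(affine_points n - affine_zeros n F) \<inter> Z = {x \<in> affine_points n \<inter> Z. \<exists>f\<in>F. mpeval f x \<noteq> 0}"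
    for F :: "'a mpol set"
    by (auto simp: affine_zeros_def)
  then show ?thesis
    unfolding algebraic_set_def fspace.simps openin_subtopology openin_affine_zariski by metis
qed

lemma topspace_algebraic_set [simp]: "topspace (Top (algebraic_set n Z)) = affine_points n \<inter> Z"
  by (simp add: algebraic_set_def)

lemma openin_algebraic_set_nonzero:
  "f \<in> polys n \<Longrightarrow> openin (Top (algebraic_set n Z)) {x \<in> affine_points n \<inter> Z. mpeval f x \<noteq> 0}"
  unfolding openin_algebraic_set by (intro exI[of _ "{f}"]) auto

definition fraction_on :: "nat \<Rightarrow> 'k::field list set \<Rightarrow> ('k list \<Rightarrow> 'k) \<Rightarrow> bool" where
  "fraction_on n W f \<longleftrightarrow> (\<exists>g\<in>polys n. \<exists>h\<in>polys n. \<forall>x\<in>W. mpeval h x \<noteq> 0 \<and> f x = mpeval g x / mpeval h x)"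

lemma fraction_onI:
  assumes "g \<in> polys n" "h \<in> polys n" "\<And>x. x \<in> W \<Longrightarrow> mpeval h x \<noteq> 0 \<and> f x = mpeval g x / mpeval h x"
  shows "fraction_on n W f"
  unfolding fraction_on_def using assms by blast

lemma fraction_onE:
  assumes "fraction_on n W f"
  obtains g h where "g \<in> polys n" "h \<in> polys n"
    "\<forall>x\<in>W. mpeval h x \<noteq> 0 \<and> f x = mpeval g x / mpeval h x"
  using assms unfolding fraction_on_def by (elim bexE)

lemma regular_algebraic_set:
  "regular (algebraic_set n Z) U f \<longleftrightarrow> (\<forall>p\<in>U. \<exists>W.
     openin (Top (algebraic_set n Z)) W \<and> p \<in> W \<and> W \<subseteq> U \<and> fraction_on n W f)"
proof -
  have "(\<exists>g\<in>A. \<exists>h\<in>A. \<exists>W. P W \<and> p \<in> W \<and> W \<subseteq> U \<and> R g h W) \<longleftrightarrow>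
      (\<exists>W. P W \<and> p \<in> W \<and> W \<subseteq> U \<and> (\<exists>g\<in>A. \<exists>h\<in>A. R g h W))"
    for A :: "'a mpol set" and P p R
    by (rule iffI; elim bexE exE conjE; intro exI conjI bexI; assumption)
  then show ?thesis unfolding algebraic_set_def fspace.simps fraction_on_def by simp
qed

lemma function_space_algebraic_set: "function_space (algebraic_set n Z :: ('k::field list, 'k) fspace)"
proof (rule function_space_of_local_property[OF regular_algebraic_set])
  fix V W :: "'k list set" and f g :: "'k list \<Rightarrow> 'k" and c
  show "fraction_on n W g" if "fraction_on n W f" "\<And>x. x \<in> W \<Longrightarrow> f x = g x"
    using that unfolding fraction_on_def by simp
  show "fraction_on n V f" if "fraction_on n W f" "V \<subseteq> W"
    using that unfolding fraction_on_def by blast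
  show "fraction_on n W (\<lambda>_. c)"
    by (rule fraction_onI[of "const_mpol c" _ "const_mpol 1"]) auto
  assume f: "fraction_on n W f"
  obtain a b where ab: "a \<in> polys n" "b \<in> polys n"
    "\<forall>x\<in>W. mpeval b x \<noteq> 0 \<and> f x = mpeval a x / mpeval b x" using fraction_onE[OF f] .
  show "openin (Top (algebraic_set n Z)) {x \<in> W. f x \<noteq> 0} \<and>
      fraction_on n {x \<in> W. f x \<noteq> 0} (\<lambda>x. inverse (f x))"
    if W: "openin (Top (algebraic_set n Z)) W"
  proof
    have "{x \<in> W. f x \<noteq> 0} = W \<inter> {x \<in> affine_points n \<inter> Z. mpeval a x \<noteq> 0}"
      using ab openin_subset[OF W] by auto
    then show "openin (Top (algebraic_set n Z)) {x \<in> W. f x \<noteq> 0}"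
      using openin_Int[OF W openin_algebraic_set_nonzero[OF ab(1)]] by simp
    show "fraction_on n {x \<in> W. f x \<noteq> 0} (\<lambda>x. inverse (f x))"
      by (rule fraction_onI[OF ab(2,1)]) (use ab in auto)
  qed
  assume g: "fraction_on n W g"
  obtain a' b' where ab': "a' \<in> polys n" "b' \<in> polys n"
    "\<forall>x\<in>W. mpeval b' x \<noteq> 0 \<and> g x = mpeval a' x / mpeval b' x" using fraction_onE[OF g] .
  show "fraction_on n W (\<lambda>x. f x + g x)"
    by (rule fraction_onI[of "a * b' + a' * b" _ "b * b'"])
      (use ab ab' in \<open>simp_all add: polys_mult polys_add mpeval_mult mpeval_add add_frac_eq\<close>)
  show "fraction_on n W (\<lambda>x. f x * g x)"
    by (rule fraction_onI[of "a * a'" _ "b * b'"])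
      (use ab ab' in \<open>simp_all add: polys_mult mpeval_mult\<close>)
qed

lemma regular_coordinate:
  assumes "i < n" "openin (Top (algebraic_set n Z)) U"
  shows "regular (algebraic_set n Z) U (\<lambda>x. x ! i)"
  unfolding regular_algebraic_set
  using assms fraction_onI[of "var_mpol i" n "const_mpol 1" U "\<lambda>x. x ! i"] by auto

text \<open>Polynomials in the coordinates pull back to polynomials in regular functions, so their nonvanishing
  loci pull back to open sets and their quotients to regular functions.\<close>

lemma (in function_space) morphism_to_algebraic_set:
  assumes \<psi>: "\<And>x. x \<in> topspace (Top X) \<Longrightarrow> \<psi> x \<in> affine_points n \<inter> Z"
    and coord: "\<And>i. i < n \<Longrightarrow> regular X (topspace (Top X)) (\<lambda>x. \<psi> x ! i)"
  shows "morphism X (algebraic_set n Z) \<psi>"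
proof -
  have reg: "regular X (topspace (Top X)) (\<lambda>x. mpeval p (\<psi> x))" if "p \<in> polys n" for p
    by (rule regular_mpeval[OF openin_topspace that coord])
  have preim: "openin (Top X) {x \<in> topspace (Top X). \<psi> x \<in> U}"
    if U: "openin (Top (algebraic_set n Z)) U" for U
  proof -
    obtain F where F: "F \<subseteq> polys n" "U = {x \<in> affine_points n \<inter> Z. \<exists>f\<in>F. mpeval f x \<noteq> 0}"
      using U unfolding openin_algebraic_set by blast
    have "{x \<in> topspace (Top X). \<psi> x \<in> U} = (\<Union>f\<in>F. {x \<in> topspace (Top X). mpeval f (\<psi> x) \<noteq> 0})"
      unfolding F(2) using \<psi> by auto
    moreover have "openin (Top X) (\<Union>f\<in>F. {x \<in> topspace (Top X). mpeval f (\<psi> x) \<noteq> 0})"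
      using F(1) openin_nonzero[OF openin_topspace reg] by (intro openin_Union) auto
    ultimately show ?thesis by simp
  qed
  have "regular X {x \<in> topspace (Top X). \<psi> x \<in> V} (g \<circ> \<psi>)"
    if V: "openin (Top (algebraic_set n Z)) V" "regular (algebraic_set n Z) V g" for V g
  proof (rule regular_local)
    fix x assume x: "x \<in> {x \<in> topspace (Top X). \<psi> x \<in> V}"
    then have "\<psi> x \<in> V" by simp
    then obtain W where W: "openin (Top (algebraic_set n Z)) W" "\<psi> x \<in> W" "W \<subseteq> V" "fraction_on n W g"
      using V(2) unfolding regular_algebraic_set by blast
    obtain a b where ab: "a \<in> polys n" "b \<in> polys n"
      "\<forall>y\<in>W. mpeval b y \<noteq> 0 \<and> g y = mpeval a y / mpeval b y" using fraction_onE[OF W(4)] .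
    let ?N = "{x \<in> topspace (Top X). \<psi> x \<in> W}"
    have N: "openin (Top X) ?N" by (rule preim[OF W(1)])
    have "regular X ?N (\<lambda>x. mpeval a (\<psi> x) / mpeval b (\<psi> x))"
      by (rule regular_divide[OF N])
        (use ab N in \<open>auto intro: regular_restrict[OF reg openin_topspace]\<close>)
    then have "regular X ?N (g \<circ> \<psi>)"
      by (rule regular_cong[OF N, rotated]) (use ab in auto)
    then show "\<exists>N. openin (Top X) N \<and> x \<in> N \<and> N \<subseteq> {x \<in> topspace (Top X). \<psi> x \<in> V} \<and> regular X N (g \<circ> \<psi>)"
      using N W x by (intro exI[of _ ?N]) auto
  qed
  then show ?thesis
    unfolding morphism_def continuous_map_def using preim \<psi> by auto
qed

text \<open>Two morphisms differ where one of the differences of their coordinates does not vanish, which is an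
  open condition.\<close>

lemma variety_algebraic_set:
  assumes "closedin (affine_zariski n) Z"
  shows "variety (algebraic_set n Z :: ('k::field list, 'k) fspace)"
proof -
  let ?X = "algebraic_set n Z :: ('k list, 'k) fspace"
  interpret X: function_space ?X by (rule function_space_algebraic_set)
  have "open_subspace ?X (topspace (Top ?X)) = ?X"
    by (rule fspace.equality) (simp_all add: open_subspace_def[of _ "topspace (Top ?X)"] subtopology_topspace del: topspace_algebraic_set)
  moreover have "affine_variety ?X"
    unfolding affine_variety_def isomorphic_def
    using X.space_with_functions assms morphism_id by fastforce
  ultimately have "prevariety ?X"
    unfolding prevariety_def using X.space_with_functions openin_topspace[of "Top ?X"]
    by (intro conjI exI[of _ "{topspace (Top ?X)}"]) simp_all
  moreover have "separated ?X"
    unfolding separated_def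
  proof (intro allI impI)
    fix m :: nat and Y :: "'k list set" and \<phi> \<psi>
    assume Y: "closedin (affine_zariski m) Y"
      and \<phi>: "morphism (algebraic_set m Y) ?X \<phi>" and \<psi>: "morphism (algebraic_set m Y) ?X \<psi>"
    let ?Y = "algebraic_set m Y"
    interpret Y: function_space ?Y by (rule function_space_algebraic_set)
    have YY: "topspace (Top ?Y) = Y" using closedin_subset[OF Y] by auto
    have pull: "regular ?Y Y (\<lambda>y. \<chi> y ! i)" if "morphism ?Y ?X \<chi>" "i < n" for \<chi> i
    proof -
      have "{y \<in> Y. \<chi> y \<in> topspace (Top ?X)} = Y"
        using morphism_maps_to[OF that(1)] unfolding YY by auto
      moreover have "regular ?X (topspace (Top ?X)) (\<lambda>x. x ! i)"
        using that(2) openin_topspace[of "Top ?X"] by (intro regular_coordinate) simp_all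
      from morphism_pullback[OF that(1) openin_topspace this]
      have "regular ?Y {y \<in> Y. \<chi> y \<in> topspace (Top ?X)} ((\<lambda>x. x ! i) \<circ> \<chi>)" unfolding YY .
      ultimately show ?thesis by (simp add: comp_def)
    qed
    have o: "openin (Top ?Y) {y \<in> Y. \<phi> y ! i - \<psi> y ! i \<noteq> 0}" if "i < n" for i
      using Y.openin_nonzero[OF _ Y.regular_diff[OF _ pull[OF \<phi> that] pull[OF \<psi> that]]] openin_topspace[of "Top ?Y"]
      unfolding YY by blast
    have "{z \<in> Y. \<phi> z \<noteq> \<psi> z} = (\<Union>i<n. {y \<in> Y. \<phi> y ! i - \<psi> y ! i \<noteq> 0})"
    proof -
      have "\<phi> z \<noteq> \<psi> z \<longleftrightarrow> (\<exists>i<n. \<phi> z ! i - \<psi> z ! i \<noteq> 0)" if "z \<in> Y" for z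
      proof -
        have "length (\<phi> z) = n" "length (\<psi> z) = n"
          using morphism_maps_to[OF \<phi>, of z] morphism_maps_to[OF \<psi>, of z] that
          unfolding YY by (auto simp: affine_points_def)
        then show ?thesis by (auto simp: list_eq_iff_nth_eq)
      qed
      then show ?thesis by auto
    qed
    then have "openin (Top ?Y) {z \<in> Y. \<phi> z \<noteq> \<psi> z}" using o by auto
    then have "closedin (Top ?Y) (Y - {z \<in> Y. \<phi> z \<noteq> \<psi> z})"
      using closedin_diff[OF closedin_topspace, of "Top ?Y"] unfolding YY by blast
    moreover have "Y - {z \<in> Y. \<phi> z \<noteq> \<psi> z} = {z \<in> Y. \<phi> z = \<psi> z}" by auto
    ultimately have "closedin (subtopology (affine_zariski m) Y) {z \<in> Y. \<phi> z = \<psi> z}"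
      by (simp add: algebraic_set_def)
    then show "closedin (affine_zariski m) {z \<in> Y. \<phi> z = \<psi> z}"
      using closedin_trans_full[OF _ Y] by blast
  qed
  ultimately show ?thesis by (simp add: variety_def)
qed

section \<open>Polynomial curves\<close>

text \<open>Otherwise the polynomial \<open>1 + \<Prod>(X - a)\<close>, with \<open>a\<close> ranging over the field, would have no root.\<close>

lemma infinite_alg_closed_field: "infinite (UNIV :: 'k::alg_closed_field set)"
proof
  assume fin: "finite (UNIV :: 'k set)"
  define p where "p = (\<Prod>a\<in>UNIV. [:- a, 1:]) + (1 :: 'k poly)"
  have "degree (\<Prod>a\<in>(UNIV :: 'k set). [:- a, 1:]) = (\<Sum>a\<in>(UNIV :: 'k set). degree [:- a, 1:])"
    by (rule degree_prod_eq_sum_degree) auto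
  also have "\<dots> = card (UNIV :: 'k set)" by simp
  finally have deg: "degree (\<Prod>a\<in>(UNIV :: 'k set). [:- a, 1:]) = card (UNIV :: 'k set)" .
  have "card (UNIV :: 'k set) > 0" using fin by (simp add: card_gt_0_iff)
  then have "degree p > 0" unfolding p_def using deg
    by (subst degree_add_eq_left) auto
  then obtain z where "poly p z = 0" using alg_closed_imp_poly_has_root by blast
  moreover have "(\<Prod>a\<in>UNIV. z - a) = 0" using fin by (intro prod_zero) auto
  then have "poly p z = 1" by (simp add: p_def poly_prod)
  ultimately show False by simp
qed

lemma mpeval_on_curve:
  fixes p :: "'k::comm_ring_1 mpol"
  assumes "p \<in> polys n" "\<And>i. i < n \<Longrightarrow> \<exists>q. \<forall>t. c t ! i = poly q t"
  shows "\<exists>q. \<forall>t. mpeval p (c t) = poly q t"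
proof (rule mpeval_closed[where S = "\<lambda>f. \<exists>q. \<forall>t. f t = poly q t", OF _ _ _ assms(2,1)])
  show "\<exists>q. \<forall>t. a = poly q t" for a :: 'k
    by (rule exI[of _ "[:a:]"]) simp
  show "\<exists>q. \<forall>t. f t + g t = poly q t"
    if "\<exists>q. \<forall>t. f t = poly q t" "\<exists>q. \<forall>t. g t = poly q t" for f g :: "'k \<Rightarrow> 'k"
    using that by (metis poly_add)
  show "\<exists>q. \<forall>t. f t * g t = poly q t"
    if "\<exists>q. \<forall>t. f t = poly q t" "\<exists>q. \<forall>t. g t = poly q t" for f g :: "'k \<Rightarrow> 'k"
    using that by (metis poly_mult)
qed

text \<open>This is the test for irreducibility used below: if any two points lie on a polynomial curve, then any
  two nonempty open sets meet, since the two polynomials that do not vanish at the ends of the curve have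
  finitely many zeros on it.\<close>

lemma common_nonzero_on_curve:
  fixes p q :: "'k::alg_closed_field mpol"
  assumes "p \<in> polys n" "q \<in> polys n" "\<And>i. i < n \<Longrightarrow> \<exists>q. \<forall>t. c t ! i = poly q t"
    and "mpeval p (c a) \<noteq> 0" "mpeval q (c b) \<noteq> 0"
  obtains t where "mpeval p (c t) \<noteq> 0" "mpeval q (c t) \<noteq> 0"
proof -
  obtain P where P: "\<And>t. mpeval p (c t) = poly P t" using mpeval_on_curve[OF assms(1,3)] by blast
  obtain Q where Q: "\<And>t. mpeval q (c t) = poly Q t" using mpeval_on_curve[OF assms(2,3)] by blast
  have "P \<noteq> 0" "Q \<noteq> 0" using assms(4,5) P Q by auto
  then have "finite {t. poly (P * Q) t = 0}" by (intro poly_roots_finite) simp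
  then obtain t where "poly (P * Q) t \<noteq> 0"
    using infinite_alg_closed_field[where 'k = 'k] by (metis (mono_tags, lifting) UNIV_eq_I mem_Collect_eq)
  then show ?thesis using that[of t] P Q by simp
qed

section \<open>Projective space\<close>

lemma homogeneous_add: "homogeneous d f \<Longrightarrow> homogeneous d g \<Longrightarrow> homogeneous d (f + g)"
  unfolding homogeneous_def using Poly_Mapping.keys_add[of f g] by blast

lemma homogeneous_const [simp]: "homogeneous 0 (const_mpol c)"
  by (simp add: homogeneous_def const_mpol_def)

lemma homogeneous_var [simp]: "homogeneous (Suc 0) (var_mpol i)"
  by (simp add: homogeneous_def var_mpol_def)

lemma proj_pointsE:
  assumes "P \<in> proj_points m"
  obtains w where "length w = Suc m" "\<exists>a\<in>set w. a \<noteq> 0" "P = proj_point w"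
  using assms by (auto simp: proj_points_def)

lemma proj_point_in [intro]: "x \<in> proj_point x"
  unfolding proj_point_def by (rule CollectI, rule exI[of _ 1]) (simp add: map_idI)

lemma in_proj_pointE:
  assumes "y \<in> proj_point x"
  obtains c where "c \<noteq> 0" "y = map ((*) c) x"
  using assms by (auto simp: proj_point_def)

lemma proj_point_in_proj_points:
  "length x = Suc m \<Longrightarrow> \<exists>a\<in>set x. a \<noteq> 0 \<Longrightarrow> proj_point x \<in> proj_points m"
  by (auto simp: proj_points_def)

lemma proj_point_scale:
  "c \<noteq> 0 \<Longrightarrow> proj_point (map ((*) c) (x :: 'k::field list)) = proj_point x"
  unfolding proj_point_def
proof (intro equalityI subsetI; elim CollectE exE conjE)
  fix y a assume c: "c \<noteq> 0" and y: "y = map ((*) a) (map ((*) c) x)" "a \<noteq> 0"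
  then show "y \<in> {map ((*) c) x |c. c \<noteq> 0}"
    by (intro CollectI exI[of _ "a * c"]) (simp add: comp_def mult.assoc)
next
  fix y a assume c: "c \<noteq> 0" and y: "y = map ((*) a) x" "a \<noteq> 0"
  then show "y \<in> {map ((*) b) (map ((*) c) x) |b. b \<noteq> 0}"
    by (intro CollectI exI[of _ "a / c"]) (simp add: comp_def)
qed

lemma proj_point_eq:
  assumes "P \<in> proj_points m" "x \<in> P"
  shows "P = proj_point x" "length x = Suc m" "\<exists>a\<in>set x. a \<noteq> 0"
proof -
  obtain w where w: "length w = Suc m" "\<exists>a\<in>set w. a \<noteq> 0" "P = proj_point w"
    using assms(1) by (rule proj_pointsE)
  then obtain c where "x = map ((*) c) w" "c \<noteq> 0" using assms(2) by (auto simp: proj_point_def)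
  then show "P = proj_point x" "length x = Suc m" "\<exists>a\<in>set x. a \<noteq> 0" using w by (auto simp: proj_point_scale)
qed

lemma openin_proj:
  "openin (proj_zariski m) U \<longleftrightarrow> (\<exists>F. (\<forall>f\<in>F. f \<in> polys (Suc m) \<and> (\<exists>d. homogeneous d f)) \<and>
     U = {P \<in> proj_points m. \<exists>f\<in>F. \<exists>x\<in>P. mpeval f x \<noteq> 0})"
proof -
  have "proj_points m - proj_zeros m F = {P \<in> proj_points m. \<exists>f\<in>F. \<exists>x\<in>P. mpeval f x \<noteq> 0}"
    for F :: "'a mpol set"
    by (auto simp: proj_zeros_def)
  moreover have "(F \<subseteq> {f \<in> polys (Suc m). \<exists>d. homogeneous d f}) \<longleftrightarrow>
      (\<forall>f\<in>F. f \<in> polys (Suc m) \<and> (\<exists>d. homogeneous d f))" for F :: "'a mpol set"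
    by blast
  ultimately show ?thesis unfolding openin_proj_zariski by simp
qed

lemma openin_proj_nonzero:
  assumes "f \<in> polys (Suc m)" "homogeneous d f"
  shows "openin (proj_zariski m) {P \<in> proj_points m. \<forall>x\<in>P. mpeval f x \<noteq> 0}"
  unfolding openin_proj
proof (intro exI[of _ "{f}"] conjI)
  show "{P \<in> proj_points m. \<forall>x\<in>P. mpeval f x \<noteq> 0} =
      {P \<in> proj_points m. \<exists>f\<in>{f}. \<exists>x\<in>P. mpeval f x \<noteq> 0}"
    using proj_nonzero_iff[OF _ assms] proj_points_nonempty by blast
qed (use assms in auto)

lemma proj_space_simps [simp]: "Top (proj_space m) = proj_zariski m"
  by (simp add: proj_space_def)

definition proj_fraction_on :: "nat \<Rightarrow> 'k::field list set set \<Rightarrow> ('k list set \<Rightarrow> 'k) \<Rightarrow> bool" where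
  "proj_fraction_on m W f \<longleftrightarrow> (\<exists>d. \<exists>g\<in>polys (Suc m). \<exists>h\<in>polys (Suc m). homogeneous d g \<and> homogeneous d h \<and>
     (\<forall>Q\<in>W. \<forall>x\<in>Q. mpeval h x \<noteq> 0 \<and> f Q = mpeval g x / mpeval h x))"

lemma proj_fraction_onI:
  assumes "g \<in> polys (Suc m)" "h \<in> polys (Suc m)" "homogeneous d g" "homogeneous d h"
    "\<And>Q x. Q \<in> W \<Longrightarrow> x \<in> Q \<Longrightarrow> mpeval h x \<noteq> 0 \<and> f Q = mpeval g x / mpeval h x"
  shows "proj_fraction_on m W f"
  unfolding proj_fraction_on_def using assms by blast

lemma proj_fraction_onE:
  assumes "proj_fraction_on m W f"
  obtains d g h where "g \<in> polys (Suc m)" "h \<in> polys (Suc m)" "homogeneous d g" "homogeneous d h"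
    "\<forall>Q\<in>W. \<forall>x\<in>Q. mpeval h x \<noteq> 0 \<and> f Q = mpeval g x / mpeval h x"
  using assms unfolding proj_fraction_on_def by (elim exE bexE conjE)

lemma regular_proj_space:
  "regular (proj_space m) U f \<longleftrightarrow> (\<forall>P\<in>U. \<exists>W.
     openin (Top (proj_space m)) W \<and> P \<in> W \<and> W \<subseteq> U \<and> proj_fraction_on m W f)"
proof -
  have "(\<exists>d. \<exists>g\<in>A. \<exists>h\<in>A. \<exists>W. H d g \<and> H d h \<and> O' W \<and> p \<in> W \<and> W \<subseteq> U \<and> R g h W) \<longleftrightarrow>
      (\<exists>W. O' W \<and> p \<in> W \<and> W \<subseteq> U \<and> (\<exists>d. \<exists>g\<in>A. \<exists>h\<in>A. H d g \<and> H d h \<and> R g h W))"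
    for A :: "'a mpol set" and O' p R and H :: "nat \<Rightarrow> _"
  proof (rule iffI; elim bexE exE conjE)
    fix d g h W assume "g \<in> A" "h \<in> A" "H d g" "H d h" "O' W" "p \<in> W" "W \<subseteq> U" "R g h W"
    then show "\<exists>W. O' W \<and> p \<in> W \<and> W \<subseteq> U \<and> (\<exists>d. \<exists>g\<in>A. \<exists>h\<in>A. H d g \<and> H d h \<and> R g h W)"
      by (intro exI[of _ W] conjI exI[of _ d] bexI[of _ g] bexI[of _ h])
  next
    fix d g h W assume "g \<in> A" "h \<in> A" "H d g" "H d h" "O' W" "p \<in> W" "W \<subseteq> U" "R g h W"
    then show "\<exists>d. \<exists>g\<in>A. \<exists>h\<in>A. \<exists>W. H d g \<and> H d h \<and> O' W \<and> p \<in> W \<and> W \<subseteq> U \<and> R g h W"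
      by (intro exI[of _ W] conjI exI[of _ d] bexI[of _ g] bexI[of _ h])
  qed
  then show ?thesis unfolding proj_space_def fspace.simps proj_fraction_on_def by simp
qed

lemma function_space_proj_space: "function_space (proj_space m :: ('k::field list set, 'k) fspace)"
proof (rule function_space_of_local_property[OF regular_proj_space])
  fix V W :: "'k list set set" and f g :: "'k list set \<Rightarrow> 'k" and c
  show "proj_fraction_on m W g" if f: "proj_fraction_on m W f" and eq: "\<And>x. x \<in> W \<Longrightarrow> f x = g x"
  proof -
    obtain d a b where ab: "a \<in> polys (Suc m)" "b \<in> polys (Suc m)" "homogeneous d a" "homogeneous d b"
      "\<forall>Q\<in>W. \<forall>x\<in>Q. mpeval b x \<noteq> 0 \<and> f Q = mpeval a x / mpeval b x" using proj_fraction_onE[OF f] .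
    show ?thesis
      by (rule proj_fraction_onI[OF ab(1-4)]) (use ab(5) in \<open>simp add: eq[symmetric]\<close>)
  qed
  show "proj_fraction_on m V f" if "proj_fraction_on m W f" "V \<subseteq> W"
    using that unfolding proj_fraction_on_def by blast
  show "proj_fraction_on m W (\<lambda>_. c)"
    by (rule proj_fraction_onI[of "const_mpol c" _ "const_mpol 1" 0]) auto
  assume f: "proj_fraction_on m W f"
  obtain d a b where ab: "a \<in> polys (Suc m)" "b \<in> polys (Suc m)" "homogeneous d a" "homogeneous d b"
    "\<forall>Q\<in>W. \<forall>x\<in>Q. mpeval b x \<noteq> 0 \<and> f Q = mpeval a x / mpeval b x" using proj_fraction_onE[OF f] .
  show "openin (Top (proj_space m)) {x \<in> W. f x \<noteq> 0} \<and>
      proj_fraction_on m {x \<in> W. f x \<noteq> 0} (\<lambda>x. inverse (f x))"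
    if W: "openin (Top (proj_space m)) W"
  proof
    have *: "mpeval a x \<noteq> 0 \<longleftrightarrow> f Q \<noteq> 0" if "Q \<in> W" "x \<in> Q" for Q x using ab(5) that by simp
    have "{x \<in> W. f x \<noteq> 0} = W \<inter> {P \<in> proj_points m. \<forall>x\<in>P. mpeval a x \<noteq> 0}"
      using * openin_subset[OF W] proj_points_nonempty[of _ m] by fastforce
    then show "openin (Top (proj_space m)) {x \<in> W. f x \<noteq> 0}"
      using openin_Int[OF _ openin_proj_nonzero[OF ab(1,3)]] W by simp
    show "proj_fraction_on m {x \<in> W. f x \<noteq> 0} (\<lambda>x. inverse (f x))"
      by (rule proj_fraction_onI[OF ab(2,1,4,3)]) (use ab(5) in auto)
  qed
  assume g: "proj_fraction_on m W g"
  obtain d' a' b' where ab': "a' \<in> polys (Suc m)" "b' \<in> polys (Suc m)" "homogeneous d' a'" "homogeneous d' b'"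
    "\<forall>Q\<in>W. \<forall>x\<in>Q. mpeval b' x \<noteq> 0 \<and> g Q = mpeval a' x / mpeval b' x" using proj_fraction_onE[OF g] .
  show "proj_fraction_on m W (\<lambda>x. f x + g x)"
  proof (rule proj_fraction_onI[of "a * b' + a' * b" _ "b * b'" "d + d'"])
    show "homogeneous (d + d') (a * b' + a' * b)"
      using homogeneous_mult[OF ab(3) ab'(4)] homogeneous_mult[OF ab'(3) ab(4)]
      by (simp add: homogeneous_add add.commute)
    show "mpeval (b * b') x \<noteq> 0 \<and> f Q + g Q = mpeval (a * b' + a' * b) x / mpeval (b * b') x"
      if "Q \<in> W" "x \<in> Q" for Q x
    proof -
      have "mpeval b x \<noteq> 0" "mpeval b' x \<noteq> 0" "f Q = mpeval a x / mpeval b x" "g Q = mpeval a' x / mpeval b' x"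
        using ab(5) ab'(5) that by auto
      then show ?thesis by (simp add: mpeval_mult mpeval_add add_frac_eq)
    qed
  qed (use ab ab' in \<open>simp_all add: polys_mult polys_add homogeneous_mult\<close>)
  show "proj_fraction_on m W (\<lambda>x. f x * g x)"
  proof (rule proj_fraction_onI[of "a * a'" _ "b * b'" "d + d'"])
    show "mpeval (b * b') x \<noteq> 0 \<and> f Q * g Q = mpeval (a * a') x / mpeval (b * b') x"
      if "Q \<in> W" "x \<in> Q" for Q x
    proof -
      have "mpeval b x \<noteq> 0" "mpeval b' x \<noteq> 0" "f Q = mpeval a x / mpeval b x" "g Q = mpeval a' x / mpeval b' x"
        using ab(5) ab'(5) that by auto
      then show ?thesis by (simp add: mpeval_mult)
    qed
  qed (use ab ab' in \<open>simp_all add: polys_mult homogeneous_mult\<close>)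
qed

lemma proj_opens_meet:
  fixes U V :: "'k::alg_closed_field list set set"
  assumes "openin (proj_zariski m) U" "openin (proj_zariski m) V" "U \<noteq> {}" "V \<noteq> {}"
  shows "U \<inter> V \<noteq> {}"
proof -
  obtain F P f x where F: "\<forall>f\<in>F. f \<in> polys (Suc m) \<and> (\<exists>d. homogeneous d f)"
      "U = {P \<in> proj_points m. \<exists>f\<in>F. \<exists>x\<in>P. mpeval f x \<noteq> 0}"
    and f: "P \<in> proj_points m" "f \<in> F" "x \<in> P" "mpeval f x \<noteq> 0"
    using assms(1,3) unfolding openin_proj by blast
  obtain G Q g y where G: "\<forall>f\<in>G. f \<in> polys (Suc m) \<and> (\<exists>d. homogeneous d f)"
      "V = {P \<in> proj_points m. \<exists>f\<in>G. \<exists>x\<in>P. mpeval f x \<noteq> 0}"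
    and g: "Q \<in> proj_points m" "g \<in> G" "y \<in> Q" "mpeval g y \<noteq> 0"
    using assms(2,4) unfolding openin_proj by blast
  have len: "length x = Suc m" "length y = Suc m" using f g by (auto dest: proj_point_eq)
  obtain i where i: "i < Suc m" "x ! i \<noteq> 0"
    using proj_point_eq(3)[OF f(1,3)] len by (auto simp: in_set_conv_nth)
  define c where "c t = map (\<lambda>i. x ! i + t * (y ! i - x ! i)) [0..<Suc m]" for t
  have c: "c 0 = x" "c 1 = y" using len by (auto simp: c_def intro!: nth_equalityI simp del: upt_Suc)
  \<comment> \<open>the factor \<open>x\<^sub>i\<close> ensures that the point found on the line is not the origin\<close>
  obtain t where t: "mpeval (f * var_mpol i) (c t) \<noteq> 0" "mpeval g (c t) \<noteq> 0"
  proof (rule common_nonzero_on_curve)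
    show "f * var_mpol i \<in> polys (Suc m)" "g \<in> polys (Suc m)" using F f G g i by (auto intro: polys_mult)
    show "mpeval (f * var_mpol i) (c 0) \<noteq> 0" "mpeval g (c 1) \<noteq> 0"
      using f g i by (auto simp: c mpeval_mult)
    show "\<exists>q. \<forall>t. c t ! j = poly q t" if "j < Suc m" for j
      using that by (intro exI[of _ "[:x ! j, y ! j - x ! j:]"]) (simp add: c_def del: upt_Suc)
  qed
  have "c t ! i \<noteq> 0" "mpeval f (c t) \<noteq> 0" using t by (auto simp: mpeval_mult)
  moreover have "c t ! i \<in> set (c t)" using i by (intro nth_mem) (simp add: c_def)
  ultimately have "proj_point (c t) \<in> proj_points m"
    by (intro proj_point_in_proj_points) (auto simp: c_def)
  then have "proj_point (c t) \<in> U \<inter> V"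
    using F G f g t \<open>mpeval f (c t) \<noteq> 0\<close> by blast
  then show ?thesis by blast
qed

text \<open>The function \<open>g/h\<close> on projective space. It does not depend on the representative chosen if \<open>g\<close> and \<open>h\<close> are
  homogeneous of the same degree.\<close>

definition proj_ratio :: "'k::field mpol \<Rightarrow> 'k mpol \<Rightarrow> 'k list set \<Rightarrow> 'k" where
  "proj_ratio g h P = mpeval g (SOME x. x \<in> P) / mpeval h (SOME x. x \<in> P)"

lemma proj_ratio_eq:
  assumes "P \<in> proj_points m" "x \<in> P" "g \<in> polys (Suc m)" "h \<in> polys (Suc m)"
    and "homogeneous d g" "homogeneous d h"
  shows "proj_ratio g h P = mpeval g x / mpeval h x"
proof -
  define y where "y = (SOME x. x \<in> P)"
  have "y \<in> P" unfolding y_def using assms(2) by (rule someI)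
  then obtain c where c: "c \<noteq> 0" "y = map ((*) c) x"
    using proj_point_eq(1)[OF assms(1,2)] by (auto simp: proj_point_def)
  have "length x = Suc m" using proj_point_eq(2)[OF assms(1,2)] .
  then have "mpeval g y = c ^ d * mpeval g x" "mpeval h y = c ^ d * mpeval h x"
    using c assms by (auto simp: mpeval_scale)
  then show ?thesis using c by (simp add: proj_ratio_def y_def[symmetric])
qed

lemma regular_proj_ratio:
  assumes "g \<in> polys (Suc m)" "h \<in> polys (Suc m)" "homogeneous d g" "homogeneous d h"
    and "openin (proj_zariski m) U" "\<And>P x. P \<in> U \<Longrightarrow> x \<in> P \<Longrightarrow> mpeval h x \<noteq> 0"
  shows "regular (proj_space m) U (proj_ratio g h)"
proof -
  have "U \<subseteq> proj_points m" using openin_subset[OF assms(5)] by simp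
  then have "proj_fraction_on m U (proj_ratio g h)"
    using proj_ratio_eq[OF _ _ assms(1-4)] assms(6)
    by (intro proj_fraction_onI[OF assms(1-4)]) (auto simp: subset_iff)
  then show ?thesis unfolding regular_proj_space using assms(5) by auto
qed

text \<open>As for algebraic sets. The only new point is that vanishing of a homogeneous polynomial at
  \<open>proj_point (\<psi> x)\<close> can be tested at the representative \<open>\<psi> x\<close>.\<close>

lemma (in function_space) morphism_to_proj_space:
  assumes \<psi>: "\<And>x. x \<in> topspace (Top X) \<Longrightarrow> length (\<psi> x) = Suc m \<and> (\<exists>a\<in>set (\<psi> x). a \<noteq> 0)"
    and coord: "\<And>i. i < Suc m \<Longrightarrow> regular X (topspace (Top X)) (\<lambda>x. \<psi> x ! i)"
  shows "morphism X (proj_space m) (\<lambda>x. proj_point (\<psi> x))"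
proof -
  have reg: "regular X (topspace (Top X)) (\<lambda>x. mpeval p (\<psi> x))" if "p \<in> polys (Suc m)" for p
    by (rule regular_mpeval[OF openin_topspace that coord])
  have pt: "proj_point (\<psi> x) \<in> proj_points m" if "x \<in> topspace (Top X)" for x
    using \<psi>[OF that] by (intro proj_point_in_proj_points) auto
  have preim: "openin (Top X) {x \<in> topspace (Top X). proj_point (\<psi> x) \<in> U}"
    if U: "openin (proj_zariski m) U" for U
  proof -
    obtain F where F: "\<forall>f\<in>F. f \<in> polys (Suc m) \<and> (\<exists>d. homogeneous d f)"
      "U = {P \<in> proj_points m. \<exists>f\<in>F. \<exists>x\<in>P. mpeval f x \<noteq> 0}"
      using U unfolding openin_proj by blast
    have "proj_point (\<psi> x) \<in> U \<longleftrightarrow> (\<exists>f\<in>F. mpeval f (\<psi> x) \<noteq> 0)" if "x \<in> topspace (Top X)" for x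
    proof -
      have "(\<exists>y\<in>proj_point (\<psi> x). mpeval f y \<noteq> 0) \<longleftrightarrow> mpeval f (\<psi> x) \<noteq> 0" if "f \<in> F" for f
        using F(1) that proj_nonzero_iff[OF pt[OF \<open>x \<in> topspace (Top X)\<close>], of f] proj_point_in by metis
      then show ?thesis unfolding F(2) using pt[OF that] by auto
    qed
    then have "{x \<in> topspace (Top X). proj_point (\<psi> x) \<in> U}
        = (\<Union>f\<in>F. {x \<in> topspace (Top X). mpeval f (\<psi> x) \<noteq> 0})" by auto
    moreover have "openin (Top X) (\<Union>f\<in>F. {x \<in> topspace (Top X). mpeval f (\<psi> x) \<noteq> 0})"
      using F(1) openin_nonzero[OF openin_topspace reg] by (intro openin_Union) auto
    ultimately show ?thesis by simp
  qed
  have "regular X {x \<in> topspace (Top X). proj_point (\<psi> x) \<in> V} (g \<circ> (\<lambda>x. proj_point (\<psi> x)))"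
    if V: "openin (proj_zariski m) V" "regular (proj_space m) V g" for V g
  proof (rule regular_local)
    fix x assume x: "x \<in> {x \<in> topspace (Top X). proj_point (\<psi> x) \<in> V}"
    then have "proj_point (\<psi> x) \<in> V" by simp
    then obtain W where W: "openin (proj_zariski m) W" "proj_point (\<psi> x) \<in> W" "W \<subseteq> V" "proj_fraction_on m W g"
      using V(2) unfolding regular_proj_space by auto
    obtain d a b where ab: "a \<in> polys (Suc m)" "b \<in> polys (Suc m)" "homogeneous d a" "homogeneous d b"
        "\<forall>Q\<in>W. \<forall>x\<in>Q. mpeval b x \<noteq> 0 \<and> g Q = mpeval a x / mpeval b x"
      using proj_fraction_onE[OF W(4)] .
    let ?N = "{x \<in> topspace (Top X). proj_point (\<psi> x) \<in> W}"
    have N: "openin (Top X) ?N" by (rule preim[OF W(1)])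
    have val: "mpeval b (\<psi> x) \<noteq> 0" "g (proj_point (\<psi> x)) = mpeval a (\<psi> x) / mpeval b (\<psi> x)" if "x \<in> ?N" for x
      using ab(5) that proj_point_in by blast+
    have "regular X ?N (\<lambda>x. mpeval a (\<psi> x) / mpeval b (\<psi> x))"
      by (rule regular_divide[OF N])
        (use ab N val in \<open>auto intro: regular_restrict[OF reg openin_topspace]\<close>)
    then have "regular X ?N (g \<circ> (\<lambda>x. proj_point (\<psi> x)))"
      by (rule regular_cong[OF N, rotated]) (use val in auto)
    then show "\<exists>N. openin (Top X) N \<and> x \<in> N \<and> N \<subseteq> {x \<in> topspace (Top X). proj_point (\<psi> x) \<in> V} \<and>
        regular X N (g \<circ> (\<lambda>x. proj_point (\<psi> x)))"
      using N W x by (intro exI[of _ ?N]) auto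
  qed
  then show ?thesis
    unfolding morphism_def continuous_map_def using preim pt by (auto simp: proj_space_def)
qed

section \<open>Rational self-maps of projective space\<close>

lemma open_subspace_open_subspace:
  "U \<subseteq> W \<Longrightarrow> open_subspace (open_subspace X W) U = open_subspace X U"
  by (simp add: open_subspace_def subtopology_subtopology Int_absorb1)

lemma topspace_open_subspace:
  "openin (Top X) U \<Longrightarrow> topspace (Top (open_subspace X U)) = U"
  using openin_subset[of "Top X" U] by auto

lemma linear_form_nonzero_at_two_points:
  fixes p q :: "'k::field list"
  assumes "length p = n" "length q = n" "\<exists>a\<in>set p. a \<noteq> 0" "\<exists>a\<in>set q. a \<noteq> 0"
  shows "\<exists>l\<in>polys n. homogeneous 1 l \<and> mpeval l p \<noteq> 0 \<and> mpeval l q \<noteq> 0"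
proof -
  obtain i where i: "i < n" "p ! i \<noteq> 0" using assms by (auto simp: in_set_conv_nth)
  obtain j where j: "j < n" "q ! j \<noteq> 0" using assms by (auto simp: in_set_conv_nth)
  consider "q ! i \<noteq> 0" | "p ! j \<noteq> 0" | "q ! i = 0" "p ! j = 0" by blast
  then show ?thesis
  proof cases
    case 1
    then show ?thesis using i by (intro bexI[of _ "var_mpol i"]) auto
  next
    case 2
    then show ?thesis using j by (intro bexI[of _ "var_mpol j"]) auto
  next
    case 3
    then show ?thesis using i j
      by (intro bexI[of _ "var_mpol i + var_mpol j"]) (auto simp: mpeval_add homogeneous_add polys_add)
  qed
qed

lemma in_rational_repsD:
  assumes "(U, \<phi>) \<in> rational_reps X Y"
  shows "openin (Top X) U" "U \<noteq> {}" "morphism (open_subspace X U) Y \<phi>"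
  using assms by (auto simp: rational_reps_def)

lemma openin_rational_rep_preimage:
  assumes "(U, \<phi>) \<in> rational_reps X Y" "openin (Top Y) V"
  shows "openin (Top X) {x \<in> U. \<phi> x \<in> V}"
proof -
  note U = in_rational_repsD[OF assms(1)]
  show ?thesis
    using openin_morphism_preimage[OF U(3) assms(2)] openin_subset[OF U(1)]
    by (auto simp: topspace_open_subspace[OF U(1), simplified] openin_open_subtopology[OF U(1)])
qed

lemma pull_back_rational_rep:
  assumes "(U, \<phi>) \<in> rational_reps X Y" "openin (Top Y) V" "regular Y V g"
  shows "regular X {x \<in> U. \<phi> x \<in> V} (g \<circ> \<phi>)"
proof -
  note U = in_rational_repsD[OF assms(1)]
  show ?thesis
    using morphism_pullback[OF U(3) assms(2,3)] by (simp add: topspace_open_subspace[OF U(1), simplified])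
qed

text \<open>Projective space is separated. If the two values at \<open>x\<close> differ, a linear form \<open>l\<close> vanishes at neither of them,
  and some function \<open>x\<^sub>s/l\<close>, which is regular near both, separates them. The pullbacks of this function then differ on a
  nonempty open set, which meets \<open>N\<close> by irreducibility.\<close>

lemma rational_reps_agree:
  fixes m :: nat
  defines "P \<equiv> proj_space m :: ('k::alg_closed_field list set, 'k) fspace"
  assumes \<phi>: "(U, \<phi>) \<in> rational_reps P P" and \<psi>: "(V, \<psi>) \<in> rational_reps P P"
    and N: "openin (Top P) N" "N \<noteq> {}" "N \<subseteq> U \<inter> V" "\<And>x. x \<in> N \<Longrightarrow> \<phi> x = \<psi> x"
    and x: "x \<in> U \<inter> V"
  shows "\<phi> x = \<psi> x"
proof (rule ccontr)
  assume ne: "\<phi> x \<noteq> \<psi> x"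
  interpret P: function_space P unfolding P_def by (rule function_space_proj_space)
  note U = in_rational_repsD[OF \<phi>] and V = in_rational_repsD[OF \<psi>]
  have TP: "Top P = proj_zariski m" by (simp add: P_def)
  have "\<phi> x \<in> proj_points m" "\<psi> x \<in> proj_points m"
    using x morphism_maps_to[OF U(3), of x] morphism_maps_to[OF V(3), of x]
      topspace_open_subspace[OF U(1)] topspace_open_subspace[OF V(1)] by (auto simp: TP)
  then obtain y z where y: "y \<in> \<phi> x" and z: "z \<in> \<psi> x" using proj_points_nonempty by blast
  note y' = proj_point_eq[OF \<open>\<phi> x \<in> proj_points m\<close> y] and z' = proj_point_eq[OF \<open>\<psi> x \<in> proj_points m\<close> z]
  obtain l where l: "l \<in> polys (Suc m)" "homogeneous 1 l" "mpeval l y \<noteq> 0" "mpeval l z \<noteq> 0"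
    using linear_form_nonzero_at_two_points[OF y'(2) z'(2) y'(3) z'(3)] by blast
  define D where "D = {Q \<in> proj_points m. \<forall>y\<in>Q. mpeval l y \<noteq> 0}"
  have D: "openin (Top P) D" unfolding D_def TP by (rule openin_proj_nonzero[OF l(1,2)])
  have xD: "\<phi> x \<in> D" "\<psi> x \<in> D"
    unfolding D_def using proj_nonzero_iff[OF _ l(1,2)] l(3,4) y z
      \<open>\<phi> x \<in> proj_points m\<close> \<open>\<psi> x \<in> proj_points m\<close> by blast+
  obtain s where s: "s < Suc m" "y ! s / mpeval l y \<noteq> z ! s / mpeval l z"
  proof (rule ccontr)
    assume "\<not> thesis"
    with that have eq: "y ! s / mpeval l y = z ! s / mpeval l z" if "s < Suc m" for s using that by blast
    have "y = map ((*) (mpeval l y / mpeval l z)) z"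
    proof (rule nth_equalityI)
      fix i assume "i < length y"
      then show "y ! i = map ((*) (mpeval l y / mpeval l z)) z ! i"
        using eq[of i] l y' z' by (simp add: field_simps)
    qed (use y' z' in simp)
    then have "proj_point y = proj_point z"
      using proj_point_scale[of "mpeval l y / mpeval l z" z] l by simp
    then show False using ne y'(1) z'(1) by simp
  qed
  define r where "r = proj_ratio (var_mpol s) l"
  have r: "regular P D r"
    unfolding P_def r_def using l s D
    by (intro regular_proj_ratio[of _ _ _ 1]) (auto simp: D_def P_def)
  define N' where "N' = {x \<in> U. \<phi> x \<in> D} \<inter> {x \<in> V. \<psi> x \<in> D}"
  note pb = openin_rational_rep_preimage[OF \<phi> D] pull_back_rational_rep[OF \<phi> D r]
    openin_rational_rep_preimage[OF \<psi> D] pull_back_rational_rep[OF \<psi> D r]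
  have N': "openin (Top P) N'" unfolding N'_def using pb by (intro openin_Int)
  have "regular P N' (r \<circ> \<phi>)" "regular P N' (r \<circ> \<psi>)"
    using P.regular_restrict[OF pb(2,1) N'] P.regular_restrict[OF pb(4,3) N'] by (auto simp: N'_def)
  then have "regular P N' (\<lambda>x. (r \<circ> \<phi>) x - (r \<circ> \<psi>) x)" by (rule P.regular_diff[OF N'])
  from P.openin_nonzero[OF N' this]
  have o: "openin (Top P) {x \<in> N'. r (\<phi> x) \<noteq> r (\<psi> x)}" by simp
  have "r (\<phi> x) = y ! s / mpeval l y" "r (\<psi> x) = z ! s / mpeval l z"
    unfolding r_def using proj_ratio_eq[of _ m _ "var_mpol s" l 1] l s y z
      \<open>\<phi> x \<in> proj_points m\<close> \<open>\<psi> x \<in> proj_points m\<close> by auto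
  then have "x \<in> {x \<in> N'. r (\<phi> x) \<noteq> r (\<psi> x)}" using s x xD by (auto simp: N'_def)
  then obtain u where "u \<in> N" "r (\<phi> u) \<noteq> r (\<psi> u)"
    using proj_opens_meet[OF o[unfolded TP] N(1)[unfolded TP] _ N(2)] by blast
  then show False using N(4) by auto
qed

text \<open>For transitivity, the outer two morphisms agree on the intersection of all three domains, which is
  nonempty, and therefore on the intersection of their own domains.\<close>

lemma equiv_rational_rel:
  fixes m :: nat
  defines "P \<equiv> proj_space m :: ('k::alg_closed_field list set, 'k) fspace"
  shows "equiv (rational_reps P P) (rational_rel P P)"
proof (rule equivI)
  show "rational_rel P P \<subseteq> rational_reps P P \<times> rational_reps P P"
    by (auto simp: rational_rel_def)
  show "refl_on (rational_reps P P) (rational_rel P P)"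
    by (auto simp: refl_on_def rational_rel_def)
  show "sym (rational_rel P P)"
    by (auto simp: sym_def rational_rel_def)
  show "trans (rational_rel P P)"
  proof (rule transI)
    fix a b c assume "(a, b) \<in> rational_rel P P" "(b, c) \<in> rational_rel P P"
    moreover obtain U1 f1 U2 f2 U3 f3 where "a = (U1, f1)" "b = (U2, f2)" "c = (U3, f3)"
      by (metis surj_pair)
    ultimately have *: "a = (U1, f1)" "c = (U3, f3)" "(U1, f1) \<in> rational_reps P P" "(U2, f2) \<in> rational_reps P P"
      "(U3, f3) \<in> rational_reps P P" "\<forall>x\<in>U1 \<inter> U2. f1 x = f2 x" "\<forall>x\<in>U2 \<inter> U3. f2 x = f3 x"
      by (auto simp: rational_rel_def)
    have o: "openin (proj_zariski m) U1" "openin (proj_zariski m) U2" "openin (proj_zariski m) U3"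
      "U1 \<noteq> {}" "U2 \<noteq> {}" "U3 \<noteq> {}"
      using in_rational_repsD[OF *(3)] in_rational_repsD[OF *(4)] in_rational_repsD[OF *(5)]
      by (auto simp: P_def)
    have "U1 \<inter> U2 \<noteq> {}" using proj_opens_meet[OF o(1,2,4,5)] .
    then have "U1 \<inter> U2 \<inter> U3 \<noteq> {}" using proj_opens_meet[OF openin_Int[OF o(1,2)] o(3)] o(6) by blast
    moreover have "openin (Top P) (U1 \<inter> U2 \<inter> U3)" using o by (auto simp: P_def)
    ultimately have "f1 x = f3 x" if "x \<in> U1 \<inter> U3" for x
      using rational_reps_agree[of U1 f1 m U3 f3 "U1 \<inter> U2 \<inter> U3" x] * that unfolding P_def by auto
    then show "(a, c) \<in> rational_rel P P" using * by (auto simp: rational_rel_def)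
  qed
qed

section \<open>Automorphisms as birational maps\<close>

text \<open>An irreducible separated space \<open>Z\<close> with an isomorphism between its open subset \<open>V\<close> and an open subset \<open>W\<close>
  of projective space. Irreducibility appears as \<open>opens_meet\<close>, and separatedness as \<open>openin_differ\<close>.\<close>

locale rational_chart =
  fixes Z :: "('p, 'k::alg_closed_field) fspace" and m :: nat
    and V :: "'p set" and W :: "'k list set set" and \<iota> :: "'p \<Rightarrow> 'k list set" and j :: "'k list set \<Rightarrow> 'p"
  assumes function_space_Z: "function_space Z"
    and opens_meet: "\<And>A B. openin (Top Z) A \<Longrightarrow> openin (Top Z) B \<Longrightarrow> A \<noteq> {} \<Longrightarrow> B \<noteq> {} \<Longrightarrow> A \<inter> B \<noteq> {}"
    and openin_differ: "\<And>f g. morphism Z Z f \<Longrightarrow> morphism Z Z g \<Longrightarrow> openin (Top Z) {z \<in> topspace (Top Z). f z \<noteq> g z}"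
    and V: "openin (Top Z) V" "V \<noteq> {}"
    and W: "openin (proj_zariski m) W"
    and \<iota>: "morphism (open_subspace Z V) (proj_space m) \<iota>" "\<And>z. z \<in> V \<Longrightarrow> \<iota> z \<in> W"
    and j: "morphism (open_subspace (proj_space m) W) Z j" "\<And>x. x \<in> W \<Longrightarrow> j x \<in> V"
    and inverse: "\<And>z. z \<in> V \<Longrightarrow> j (\<iota> z) = z" "\<And>x. x \<in> W \<Longrightarrow> \<iota> (j x) = x"
begin

abbreviation P where "P \<equiv> proj_space m :: ('k list set, 'k) fspace"
abbreviation Aut where "Aut \<equiv> Aut_variety Z"

sublocale P: function_space P by (rule function_space_proj_space)
sublocale Z: function_space Z by (rule function_space_Z)

lemma Aut_iff: "\<alpha> \<in> carrier Aut \<longleftrightarrow> \<alpha> \<in> Bij (topspace (Top Z)) \<and> morphism Z Z \<alpha> \<and>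
    morphism Z Z (inv_into (topspace (Top Z)) \<alpha>)"
  by (simp add: Aut_variety_def)

lemma AutD:
  assumes "\<alpha> \<in> carrier Aut"
  shows "morphism Z Z \<alpha>" "bij_betw \<alpha> (topspace (Top Z)) (topspace (Top Z))"
    "\<alpha> \<in> extensional (topspace (Top Z))"
  using assms by (auto simp: Aut_iff Bij_def)

lemma mult_apply:
  "\<alpha> \<in> carrier Aut \<Longrightarrow> \<beta> \<in> carrier Aut \<Longrightarrow> z \<in> topspace (Top Z) \<Longrightarrow> (\<beta> \<otimes>\<^bsub>Aut\<^esub> \<alpha>) z = \<beta> (\<alpha> z)"
  by (simp add: Aut_iff) (simp add: Aut_variety_def BijGroup_def compose_def)

lemma one_apply: "z \<in> topspace (Top Z) \<Longrightarrow> \<one>\<^bsub>Aut\<^esub> z = z"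
  by (simp add: Aut_variety_def BijGroup_def)

lemma openin_preimage:
  "\<alpha> \<in> carrier Aut \<Longrightarrow> openin (Top Z) A \<Longrightarrow> openin (Top Z) {z \<in> topspace (Top Z). \<alpha> z \<in> A}"
  using openin_morphism_preimage AutD(1) by blast

lemma preimage_nonempty:
  assumes "\<alpha> \<in> carrier Aut" "openin (Top Z) A" "A \<noteq> {}"
  shows "{z \<in> topspace (Top Z). \<alpha> z \<in> A} \<noteq> {}"
proof -
  obtain a where a: "a \<in> A" "a \<in> topspace (Top Z)" using assms(3) openin_subset[OF assms(2)] by blast
  then have "a \<in> \<alpha> ` topspace (Top Z)" using bij_betw_imp_surj_on[OF AutD(2)[OF assms(1)]] by simp
  then show ?thesis using a(1) by auto
qed

lemma V_subset: "V \<subseteq> topspace (Top Z)"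
  using openin_subset[OF V(1)] .

text \<open>In the chart, \<open>\<alpha>\<close> is defined where it does not leave \<open>V\<close>.\<close>

definition bir_dom :: "('p \<Rightarrow> 'p) \<Rightarrow> 'k list set set" where
  "bir_dom \<alpha> = {x \<in> W. \<alpha> (j x) \<in> V}"

definition bir_rep :: "('p \<Rightarrow> 'p) \<Rightarrow> 'k list set set \<times> ('k list set \<Rightarrow> 'k list set)" where
  "bir_rep \<alpha> = (bir_dom \<alpha>, \<iota> \<circ> (\<alpha> \<circ> j))"

lemma meets_bir_dom:
  assumes \<alpha>: "\<alpha> \<in> carrier Aut" and A: "openin (Top P) A" "A \<noteq> {}"
  shows "{x \<in> bir_dom \<alpha>. \<iota> (\<alpha> (j x)) \<in> A} \<noteq> {}"
proof -
  have "W \<noteq> {}" using V(2) \<iota>(2) by blast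
  then have "A \<inter> W \<noteq> {}" using proj_opens_meet[OF _ W] A by auto
  then obtain y where y: "y \<in> A" "y \<in> W" by blast
  let ?B = "{z \<in> V. \<iota> z \<in> A}"
  have "openin (Top (open_subspace Z V)) {z \<in> topspace (Top (open_subspace Z V)). \<iota> z \<in> A}"
    by (rule openin_morphism_preimage[OF \<iota>(1) A(1)])
  then have B: "openin (Top Z) ?B"
    unfolding topspace_open_subspace[OF V(1)] by (simp add: openin_open_subtopology[OF V(1)])
  have "j y \<in> ?B" using y j(2) inverse(2) by simp
  then have "{z \<in> topspace (Top Z). \<alpha> z \<in> ?B} \<noteq> {}" using preimage_nonempty[OF \<alpha> B] by blast
  then obtain z where z: "z \<in> V" "\<alpha> z \<in> ?B"
    using opens_meet[OF openin_preimage[OF \<alpha> B] V(1) _ V(2)] by blast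
  then have "\<iota> z \<in> {x \<in> bir_dom \<alpha>. \<iota> (\<alpha> (j x)) \<in> A}" using \<iota>(2) inverse(1) by (simp add: bir_dom_def)
  then show ?thesis by blast
qed

lemma bir_rep_in_reps:
  assumes \<alpha>: "\<alpha> \<in> carrier Aut"
  shows "bir_rep \<alpha> \<in> rational_reps P P"
proof -
  have W': "openin (Top P) W" using W by simp
  have \<alpha>j: "morphism (open_subspace P W) Z (\<alpha> \<circ> j)"
    by (rule morphism_compose[OF j(1) AutD(1)[OF \<alpha>]])
  have "openin (Top (open_subspace P W)) {x \<in> topspace (Top (open_subspace P W)). (\<alpha> \<circ> j) x \<in> V}"
    by (rule openin_morphism_preimage[OF \<alpha>j V(1)])
  then have bir_dom: "openin (Top P) (bir_dom \<alpha>)"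
    unfolding topspace_open_subspace[OF W'] bir_dom_def using W by (simp add: openin_open_subtopology)
  have "openin (Top (open_subspace P W)) (bir_dom \<alpha>)"
    using bir_dom W by (auto simp: openin_open_subtopology bir_dom_def)
  from morphism_restrict_domain[OF function_space_open_subspace[OF P.function_space_axioms W'] \<alpha>j this]
  have "morphism (open_subspace P (bir_dom \<alpha>)) Z (\<alpha> \<circ> j)"
    by (subst (asm) open_subspace_open_subspace) (auto simp: bir_dom_def)
  then have "morphism (open_subspace P (bir_dom \<alpha>)) (open_subspace Z V) (\<alpha> \<circ> j)"
    by (rule morphism_restrict_codomain[OF _ V(1)])
      (use topspace_open_subspace[OF bir_dom] in \<open>auto simp: bir_dom_def\<close>)
  then have "morphism (open_subspace P (bir_dom \<alpha>)) P (\<iota> \<circ> (\<alpha> \<circ> j))"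
    by (rule morphism_compose[OF _ \<iota>(1)])
  moreover have "bir_dom \<alpha> \<noteq> {}"
    using meets_bir_dom[OF \<alpha> W'] V(2) \<iota>(2) by blast
  ultimately show ?thesis using bir_dom by (simp add: rational_reps_def bir_rep_def)
qed

definition bir_class :: "('p \<Rightarrow> 'p) \<Rightarrow> ('k list set set \<times> ('k list set \<Rightarrow> 'k list set)) set" where
  "bir_class \<alpha> = rational_rel P P `` {bir_rep \<alpha>}"

lemma in_bir_class_iff:
  "\<alpha> \<in> carrier Aut \<Longrightarrow> (U, \<phi>) \<in> bir_class \<alpha> \<longleftrightarrow>
    (U, \<phi>) \<in> rational_reps P P \<and> (\<forall>x\<in>bir_dom \<alpha> \<inter> U. \<iota> (\<alpha> (j x)) = \<phi> x)"
  using bir_rep_in_reps[of \<alpha>] by (auto simp: bir_class_def rational_rel_def bir_rep_def)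

lemma bir_rep_in_bir_class: "\<alpha> \<in> carrier Aut \<Longrightarrow> bir_rep \<alpha> \<in> bir_class \<alpha>"
  using bir_rep_in_reps[of \<alpha>] by (auto simp: bir_class_def rational_rel_def bir_rep_def)

lemma openin_bir_dom: "\<alpha> \<in> carrier Aut \<Longrightarrow> openin (Top P) (bir_dom \<alpha>)"
  using bir_rep_in_reps[of \<alpha>] by (auto simp: rational_reps_def bir_rep_def)

lemma bir_dom_nonempty: "\<alpha> \<in> carrier Aut \<Longrightarrow> bir_dom \<alpha> \<noteq> {}"
  using bir_rep_in_reps[of \<alpha>] by (auto simp: rational_reps_def bir_rep_def)

text \<open>This contains dominance: every nonempty open set \<open>A\<close> is met by the image, even by that of any nonempty
  open subset \<open>B\<close> of the domain. The point can be taken where the representative agrees with the standard one.\<close>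

lemma bir_class_meets:
  assumes \<alpha>: "\<alpha> \<in> carrier Aut" and \<phi>: "(U, \<phi>) \<in> bir_class \<alpha>"
    and A: "openin (Top P) A" "A \<noteq> {}" and B: "openin (Top P) B" "B \<noteq> {}"
  obtains x where "x \<in> B" "x \<in> U" "x \<in> bir_dom \<alpha>" "\<phi> x = \<iota> (\<alpha> (j x))" "\<phi> x \<in> A"
proof -
  have U: "openin (Top P) U" "U \<noteq> {}" using \<phi> in_rational_repsD(1,2)[of U \<phi> P P] unfolding in_bir_class_iff[OF \<alpha>] by blast+
  have "openin (Top P) {x \<in> bir_dom \<alpha>. (\<iota> \<circ> (\<alpha> \<circ> j)) x \<in> A}"
    using openin_rational_rep_preimage[OF bir_rep_in_reps[OF \<alpha>, unfolded bir_rep_def] A(1)] .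
  moreover have "{x \<in> bir_dom \<alpha>. (\<iota> \<circ> (\<alpha> \<circ> j)) x \<in> A} \<noteq> {}" using meets_bir_dom[OF \<alpha> A] by simp
  moreover have "openin (Top P) (U \<inter> B)" "U \<inter> B \<noteq> {}" using U B proj_opens_meet by auto
  ultimately obtain x where "x \<in> {x \<in> bir_dom \<alpha>. (\<iota> \<circ> (\<alpha> \<circ> j)) x \<in> A} \<inter> (U \<inter> B)"
    using proj_opens_meet[of m "{x \<in> bir_dom \<alpha>. (\<iota> \<circ> (\<alpha> \<circ> j)) x \<in> A}" "U \<inter> B"] by auto
  then show ?thesis using that[of x] \<phi> by (auto simp: in_bir_class_iff[OF \<alpha>])
qed

lemma bir_class_dominant:
  assumes "\<alpha> \<in> carrier Aut"
  shows "bir_class \<alpha> \<in> dominant_maps P P"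
proof -
  have "bir_class \<alpha> \<in> rational_maps P P"
    unfolding rational_maps_def bir_class_def by (rule quotientI[OF bir_rep_in_reps[OF assms]])
  moreover have "Top P closure_of (\<phi> ` U) = topspace (Top P)" if \<phi>: "(U, \<phi>) \<in> bir_class \<alpha>" for U \<phi>
    unfolding dense_intersects_open
  proof (intro allI impI)
    fix A assume A: "openin (Top P) A \<and> A \<noteq> {}"
    then obtain x where "x \<in> U" "\<phi> x \<in> A" using bir_class_meets[OF assms \<phi>, of A A] by blast
    then show "\<phi> ` U \<inter> A \<noteq> {}" by blast
  qed
  ultimately show ?thesis by (auto simp: dominant_maps_def)
qed

lemma mult_closed:
  assumes "\<alpha> \<in> carrier Aut" "\<beta> \<in> carrier Aut"
  shows "\<beta> \<otimes>\<^bsub>Aut\<^esub> \<alpha> \<in> carrier Aut"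
proof -
  let ?T = "topspace (Top Z)"
  have B: "\<alpha> \<in> Bij ?T" "\<beta> \<in> Bij ?T" using assms by (auto simp: Aut_iff)
  have eq: "\<beta> \<otimes>\<^bsub>Aut\<^esub> \<alpha> = compose ?T \<beta> \<alpha>" using B by (simp add: Aut_variety_def BijGroup_def)
  have "compose ?T \<beta> \<alpha> \<in> Bij ?T" using B by (rule compose_Bij[rotated])
  moreover have "morphism Z Z (compose ?T \<beta> \<alpha>)"
    by (rule morphism_cong[OF function_space_Z morphism_compose[OF AutD(1)[OF assms(1)] AutD(1)[OF assms(2)]]])
      (simp add: compose_def)
  moreover have "morphism Z Z (inv_into ?T (compose ?T \<beta> \<alpha>))"
  proof (rule morphism_cong[OF function_space_Z])
    show "morphism Z Z (inv_into ?T \<alpha> \<circ> inv_into ?T \<beta>)"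
      using assms by (intro morphism_compose[of Z Z]) (auto simp: Aut_iff)
    fix z assume z: "z \<in> ?T"
    let ?y = "inv_into ?T \<alpha> (inv_into ?T \<beta> z)"
    have y: "?y \<in> ?T" "compose ?T \<beta> \<alpha> ?y = z"
      using z B by (simp_all add: Bij_inv_into_mem compose_def)
        (simp add: Bij_def bij_betw_def f_inv_into_f Bij_inv_into_mem[OF B(2)])
    have "inj_on (compose ?T \<beta> \<alpha>) ?T"
      using \<open>compose ?T \<beta> \<alpha> \<in> Bij ?T\<close> by (simp add: Bij_def bij_betw_def)
    then show "(inv_into ?T \<alpha> \<circ> inv_into ?T \<beta>) z = inv_into ?T (compose ?T \<beta> \<alpha>) z"
      using y inv_into_f_f by (metis comp_apply)
  qed
  ultimately show ?thesis unfolding eq Aut_iff by blast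
qed

lemma ex_inverse:
  assumes "\<alpha> \<in> carrier Aut"
  shows "\<exists>\<beta>\<in>carrier Aut. \<beta> \<otimes>\<^bsub>Aut\<^esub> \<alpha> = \<one>\<^bsub>Aut\<^esub> \<and> \<alpha> \<otimes>\<^bsub>Aut\<^esub> \<beta> = \<one>\<^bsub>Aut\<^esub>"
proof -
  let ?T = "topspace (Top Z)"
  have \<alpha>: "\<alpha> \<in> Bij ?T" "morphism Z Z \<alpha>" "morphism Z Z (inv_into ?T \<alpha>)" using assms by (auto simp: Aut_iff)
  then have bij: "bij_betw \<alpha> ?T ?T" by (simp add: Bij_def)
  define \<beta> where "\<beta> = restrict (inv_into ?T \<alpha>) ?T"
  have "\<beta> \<in> Bij ?T" unfolding \<beta>_def using \<alpha>(1) by (rule restrict_inv_into_Bij)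
  moreover have "morphism Z Z \<beta>"
    by (rule morphism_cong[OF function_space_Z \<alpha>(3)]) (simp add: \<beta>_def)
  moreover have "morphism Z Z (inv_into ?T \<beta>)"
  proof (rule morphism_cong[OF function_space_Z \<alpha>(2)])
    fix z assume z: "z \<in> ?T"
    then have "\<alpha> z \<in> ?T" "\<beta> (\<alpha> z) = z" using bij by (auto simp: \<beta>_def bij_betw_def)
    moreover have "inj_on \<beta> ?T" using \<open>\<beta> \<in> Bij ?T\<close> by (simp add: Bij_def bij_betw_def)
    ultimately show "\<alpha> z = inv_into ?T \<beta> z" by (metis inv_into_f_f)
  qed
  ultimately have \<beta>: "\<beta> \<in> carrier Aut" by (simp add: Aut_iff)
  have "compose ?T \<beta> \<alpha> = (\<lambda>z\<in>?T. z)" "compose ?T \<alpha> \<beta> = (\<lambda>z\<in>?T. z)"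
    using bij unfolding \<beta>_def
    by (auto simp: compose_def fun_eq_iff restrict_def bij_betw_def f_inv_into_f inv_into_into)
  then show ?thesis
    using \<beta> \<open>\<beta> \<in> Bij ?T\<close> \<alpha>(1) by (intro bexI[of _ \<beta>]) (auto simp: Aut_variety_def BijGroup_def)
qed

lemma one_closed: "\<one>\<^bsub>Aut\<^esub> \<in> carrier Aut"
proof -
  let ?T = "topspace (Top Z)"
  have one: "\<one>\<^bsub>Aut\<^esub> = (\<lambda>z\<in>?T. z)" by (simp add: Aut_variety_def BijGroup_def)
  have "morphism Z Z (\<lambda>z\<in>?T. z)"
    by (rule morphism_cong[OF function_space_Z morphism_id]) simp
  moreover have "morphism Z Z (inv_into ?T (\<lambda>z\<in>?T. z))"
  proof (rule morphism_cong[OF function_space_Z morphism_id])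
    show "id z = inv_into ?T (\<lambda>z\<in>?T. z) z" if "z \<in> ?T" for z
      using that inv_into_f_f[of "\<lambda>z\<in>?T. z" ?T z] by (simp add: inj_on_def)
  qed
  ultimately show ?thesis by (simp add: Aut_iff one id_Bij)
qed

text \<open>The composite of representatives need not be defined on the whole domain of the standard representative
  of the product, nor conversely. They agree where both steps are given by the standard representatives, and this is a
  nonempty open set.\<close>

lemma bir_class_comp:
  assumes \<alpha>: "\<alpha> \<in> carrier Aut" and \<beta>: "\<beta> \<in> carrier Aut"
  shows "rational_comp P (bir_class \<beta>) (bir_class \<alpha>) = bir_class (\<beta> \<otimes>\<^bsub>Aut\<^esub> \<alpha>)"
proof -
  let ?\<gamma> = "\<beta> \<otimes>\<^bsub>Aut\<^esub> \<alpha>"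
  have \<gamma>: "?\<gamma> \<in> carrier Aut" by (rule mult_closed[OF \<alpha> \<beta>])
  have eq: "rational_rel P P `` {({x \<in> U. \<phi> x \<in> Y}, \<psi> \<circ> \<phi>)} = bir_class ?\<gamma>"
    if \<psi>: "(Y, \<psi>) \<in> bir_class \<beta>" and \<phi>: "(U, \<phi>) \<in> bir_class \<alpha>" for Y \<psi> U \<phi>
  proof -
    have reps: "(Y, \<psi>) \<in> rational_reps P P" "(U, \<phi>) \<in> rational_reps P P"
      using \<psi> \<phi> by (auto simp: in_bir_class_iff \<alpha> \<beta>)
    note Y = in_rational_repsD[OF reps(1)] and U = in_rational_repsD[OF reps(2)]
    let ?U = "{x \<in> U. \<phi> x \<in> Y}"
    have oU: "openin (Top P) ?U" by (rule openin_rational_rep_preimage[OF reps(2) Y(1)])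
    have "morphism (open_subspace P ?U) P \<phi>"
    proof -
      have "openin (Top (open_subspace P U)) ?U" using oU U(1) by (auto simp: openin_open_subtopology)
      from morphism_restrict_domain[OF function_space_open_subspace[OF P.function_space_axioms U(1)] U(3) this]
      show ?thesis by (subst (asm) open_subspace_open_subspace) auto
    qed
    then have "morphism (open_subspace P ?U) (open_subspace P Y) \<phi>"
      by (rule morphism_restrict_codomain[OF _ Y(1)]) (use topspace_open_subspace[OF oU] in auto)
    then have mor: "morphism (open_subspace P ?U) P (\<psi> \<circ> \<phi>)" by (rule morphism_compose[OF _ Y(3)])
    have oY: "openin (Top P) (Y \<inter> bir_dom \<beta>)" using Y(1) openin_bir_dom[OF \<beta>] by (rule openin_Int)
    have "Y \<inter> bir_dom \<beta> \<noteq> {}"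
      using proj_opens_meet[of m Y "bir_dom \<beta>"] Y(1,2) openin_bir_dom[OF \<beta>] bir_dom_nonempty[OF \<beta>] by simp
    note YB = oY this
    have odom: "openin (Top P) (bir_dom ?\<gamma>)" "bir_dom ?\<gamma> \<noteq> {}"
      using openin_bir_dom[OF \<gamma>] bir_dom_nonempty[OF \<gamma>] .
    obtain x0 where x0: "x0 \<in> bir_dom ?\<gamma>" "x0 \<in> U" "x0 \<in> bir_dom \<alpha>" "\<phi> x0 \<in> Y \<inter> bir_dom \<beta>"
      using bir_class_meets[OF \<alpha> \<phi> YB odom] by metis
    then have r: "(?U, \<psi> \<circ> \<phi>) \<in> rational_reps P P"
      using mor oU by (auto simp: rational_reps_def)
    let ?N = "{x \<in> U. \<phi> x \<in> Y \<inter> bir_dom \<beta>} \<inter> (bir_dom \<alpha> \<inter> bir_dom ?\<gamma>)"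
    have N: "openin (Top P) ?N"
      using openin_rational_rep_preimage[OF reps(2) oY] openin_bir_dom[OF \<alpha>] odom(1) by (intro openin_Int)
    have agree: "(\<psi> \<circ> \<phi>) x = (\<iota> \<circ> (?\<gamma> \<circ> j)) x" if "x \<in> ?N" for x
    proof -
      have \<phi>x: "\<phi> x = \<iota> (\<alpha> (j x))" using \<phi> that by (auto simp: in_bir_class_iff[OF \<alpha>])
      have "\<alpha> (j x) \<in> V" "j x \<in> V" using that j(2) by (auto simp: bir_dom_def)
      then have "j (\<phi> x) = \<alpha> (j x)" using \<phi>x inverse(1) by simp
      moreover have "\<psi> (\<phi> x) = \<iota> (\<beta> (j (\<phi> x)))" using \<psi> that by (auto simp: in_bir_class_iff[OF \<beta>])
      ultimately show ?thesis using \<open>j x \<in> V\<close> V_subset mult_apply[OF \<alpha> \<beta>] by auto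
    qed
    have "(\<psi> \<circ> \<phi>) x = (\<iota> \<circ> (?\<gamma> \<circ> j)) x" if "x \<in> ?U \<inter> bir_dom ?\<gamma>" for x
      by (rule rational_reps_agree[OF r bir_rep_in_reps[OF \<gamma>, unfolded bir_rep_def] N _ _ agree that])
        (use x0 in auto)
    then have "(bir_rep ?\<gamma>, (?U, \<psi> \<circ> \<phi>)) \<in> rational_rel P P"
      using r bir_rep_in_reps[OF \<gamma>] by (auto simp: rational_rel_def bir_rep_def)
    from equiv_class_eq[OF equiv_rational_rel this] show ?thesis by (simp add: bir_class_def)
  qed
  have "rational_comp P (bir_class \<beta>) (bir_class \<alpha>) = (\<Union>b\<in>bir_class \<beta>. \<Union>a\<in>bir_class \<alpha>. bir_class ?\<gamma>)"
    unfolding rational_comp_def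
  proof (intro SUP_cong HOL.refl)
    fix b assume b: "b \<in> bir_class \<beta>"
    obtain Y \<psi> where Y: "b = (Y, \<psi>)" by (cases b)
    have "(case a of (U, \<phi>) \<Rightarrow> rational_rel P P `` {({x \<in> U. \<phi> x \<in> Y}, \<psi> \<circ> \<phi>)}) = bir_class ?\<gamma>"
      if "a \<in> bir_class \<alpha>" for a
      using eq[of Y \<psi> "fst a" "snd a"] b Y that by (simp add: case_prod_beta)
    then show "(case b of (Y, \<psi>) \<Rightarrow> \<Union>(U, \<phi>)\<in>bir_class \<alpha>. rational_rel P P `` {({x \<in> U. \<phi> x \<in> Y}, \<psi> \<circ> \<phi>)})
        = (\<Union>a\<in>bir_class \<alpha>. bir_class ?\<gamma>)"
      unfolding Y prod.case by (rule SUP_cong[OF HOL.refl])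
  qed
  also have "\<dots> = bir_class ?\<gamma>" using bir_rep_in_bir_class[OF \<alpha>] bir_rep_in_bir_class[OF \<beta>] by auto
  finally show ?thesis .
qed

lemma bir_class_one: "bir_class \<one>\<^bsub>Aut\<^esub> = rational_id P"
proof -
  have "(topspace (Top P), id) \<in> rational_reps P P"
  proof -
    have "openin (Top P) (topspace (Top P))" by (rule openin_topspace)
    moreover have "topspace (Top P) \<noteq> {}" using V(2) \<iota>(2) openin_subset[OF W] by auto
    moreover have "morphism (open_subspace P (topspace (Top P))) P id"
      by (rule morphism_restrict_domain[OF P.function_space_axioms morphism_id openin_topspace])
    ultimately show ?thesis unfolding rational_reps_def by blast
  qed
  moreover have "(\<iota> \<circ> (\<one>\<^bsub>Aut\<^esub> \<circ> j)) x = id x" if "x \<in> bir_dom \<one>\<^bsub>Aut\<^esub>" for x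
  proof -
    have "x \<in> W" using that by (simp add: bir_dom_def)
    then have "j x \<in> topspace (Top Z)" using j(2) V_subset by auto
    then show ?thesis using \<open>x \<in> W\<close> inverse(2) by (simp add: one_apply)
  qed
  ultimately have "(bir_rep \<one>\<^bsub>Aut\<^esub>, (topspace (Top P), id)) \<in> rational_rel P P"
    using bir_rep_in_reps[OF one_closed] by (auto simp: rational_rel_def bir_rep_def)
  from equiv_class_eq[OF equiv_rational_rel this] show ?thesis by (simp add: bir_class_def rational_id_def)
qed

theorem bir_class_mon: "bir_class \<in> mon Aut (Cremona m)"
  unfolding mon_def
proof (intro CollectI conjI)
  show "bir_class \<in> hom Aut (Cremona m)"
  proof (rule homI)
    fix \<alpha> assume \<alpha>: "\<alpha> \<in> carrier Aut"
    obtain \<beta> where \<beta>: "\<beta> \<in> carrier Aut" "\<beta> \<otimes>\<^bsub>Aut\<^esub> \<alpha> = \<one>\<^bsub>Aut\<^esub>" "\<alpha> \<otimes>\<^bsub>Aut\<^esub> \<beta> = \<one>\<^bsub>Aut\<^esub>"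
      using ex_inverse[OF \<alpha>] by blast
    then show "bir_class \<alpha> \<in> carrier (Cremona m)"
      unfolding Cremona_def Bir_def partial_object.simps
      using bir_class_dominant[OF \<alpha>] bir_class_dominant[OF \<beta>(1)] bir_class_comp[OF \<alpha> \<beta>(1)] bir_class_comp[OF \<beta>(1) \<alpha>] bir_class_one by auto
    fix \<beta> assume "\<beta> \<in> carrier Aut"
    then show "bir_class (\<alpha> \<otimes>\<^bsub>Aut\<^esub> \<beta>) = bir_class \<alpha> \<otimes>\<^bsub>Cremona m\<^esub> bir_class \<beta>"
      using bir_class_comp[OF _ \<alpha>] by (simp add: Cremona_def Bir_def)
  qed
  show "inj_on bir_class (carrier Aut)"
  proof (rule inj_onI, rule ccontr)
    fix \<alpha> \<beta> assume \<alpha>: "\<alpha> \<in> carrier Aut" and \<beta>: "\<beta> \<in> carrier Aut" and eq: "bir_class \<alpha> = bir_class \<beta>" and ne: "\<alpha> \<noteq> \<beta>"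
    have agree: "\<iota> (\<alpha> (j x)) = \<iota> (\<beta> (j x))" if "x \<in> bir_dom \<alpha> \<inter> bir_dom \<beta>" for x
      using bir_rep_in_bir_class[OF \<beta>] that unfolding eq[symmetric] bir_rep_def in_bir_class_iff[OF \<alpha>] by auto
    let ?D = "{z \<in> topspace (Top Z). \<alpha> z \<noteq> \<beta> z}"
    have "?D \<noteq> {}" using ne extensionalityI[OF AutD(3)[OF \<alpha>] AutD(3)[OF \<beta>]] by blast
    moreover have "openin (Top Z) ?D" by (rule openin_differ[OF AutD(1)[OF \<alpha>] AutD(1)[OF \<beta>]])
    moreover have A: "openin (Top Z) {z \<in> topspace (Top Z). \<alpha> z \<in> V}" "{z \<in> topspace (Top Z). \<alpha> z \<in> V} \<noteq> {}"
      using openin_preimage[OF \<alpha> V(1)] preimage_nonempty[OF \<alpha> V] by auto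
    moreover have B: "openin (Top Z) {z \<in> topspace (Top Z). \<beta> z \<in> V}" "{z \<in> topspace (Top Z). \<beta> z \<in> V} \<noteq> {}"
      using openin_preimage[OF \<beta> V(1)] preimage_nonempty[OF \<beta> V] by auto
    ultimately have "?D \<inter> {z \<in> topspace (Top Z). \<alpha> z \<in> V} \<inter> ({z \<in> topspace (Top Z). \<beta> z \<in> V} \<inter> V) \<noteq> {}"
      using V by (intro opens_meet openin_Int) auto
    then obtain z where z: "z \<in> V" "\<alpha> z \<noteq> \<beta> z" "\<alpha> z \<in> V" "\<beta> z \<in> V" by blast
    then have "\<iota> z \<in> bir_dom \<alpha> \<inter> bir_dom \<beta>" using \<iota>(2) inverse(1) by (auto simp: bir_dom_def)
    from agree[OF this] have "\<iota> (\<alpha> z) = \<iota> (\<beta> z)" using z inverse(1) by simp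
    then have "j (\<iota> (\<alpha> z)) = j (\<iota> (\<beta> z))" by simp
    then show False using z inverse(1) by simp
  qed
qed

end

section \<open>The group of unimodular two by two matrices\<close>

type_synonym 'k mat2 = "'k \<times> 'k \<times> 'k \<times> 'k"

definition SL2 :: "'k::field mat2 monoid" where
  "SL2 = \<lparr>carrier = {(a, b, c, d). a * d - b * c = 1},
    mult = (\<lambda>(a, b, c, d) (a', b', c', d').
      (a * a' + b * c', a * b' + b * d', c * a' + d * c', c * b' + d * d')),
    one = (1, 0, 0, 1)\<rparr>"

lemma SL2_carrier [simp]: "(a, b, c, d) \<in> carrier SL2 \<longleftrightarrow> a * d - b * c = 1"
  by (simp add: SL2_def)

lemma SL2_mult [simp]: "(a, b, c, d) \<otimes>\<^bsub>SL2\<^esub> (a', b', c', d') =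
    (a * a' + b * c', a * b' + b * d', c * a' + d * c', c * b' + d * d')"
  by (simp add: SL2_def)

lemma SL2_one: "\<one>\<^bsub>SL2\<^esub> = (1, 0, 0, 1)"
  by (simp add: SL2_def)

lemma group_SL2: "group (SL2 :: 'k::field mat2 monoid)"
proof (rule groupI)
  fix x y z :: "'k mat2"
  obtain a b c d a' b' c' d' a'' b'' c'' d'' where
    xyz: "x = (a, b, c, d)" "y = (a', b', c', d')" "z = (a'', b'', c'', d'')"
    by (metis prod_cases4)
  assume x: "x \<in> carrier SL2"
  show "\<exists>y\<in>carrier SL2. y \<otimes>\<^bsub>SL2\<^esub> x = \<one>\<^bsub>SL2\<^esub>"
    using x by (intro bexI[of _ "(d, - b, - c, a)"]) (auto simp: xyz SL2_one algebra_simps)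
  show "\<one>\<^bsub>SL2\<^esub> \<otimes>\<^bsub>SL2\<^esub> x = x" by (simp add: xyz SL2_one)
  assume y: "y \<in> carrier SL2"
  have "(a * a' + b * c') * (c * b' + d * d') - (a * b' + b * d') * (c * a' + d * c')
      = (a * d - b * c) * (a' * d' - b' * c')" by (simp add: algebra_simps)
  then show "x \<otimes>\<^bsub>SL2\<^esub> y \<in> carrier SL2" using x y by (simp add: xyz)
  assume "z \<in> carrier SL2"
  show "x \<otimes>\<^bsub>SL2\<^esub> y \<otimes>\<^bsub>SL2\<^esub> z = x \<otimes>\<^bsub>SL2\<^esub> (y \<otimes>\<^bsub>SL2\<^esub> z)" by (simp add: xyz algebra_simps)
qed (simp add: SL2_one)

lemma SL2_inv: "(a, b, c, d) \<in> carrier SL2 \<Longrightarrow> inv\<^bsub>SL2\<^esub> (a, b, c, d) = (d, - b, - c, a)"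
  by (rule group.inv_equality[OF group_SL2]) (auto simp: SL2_one algebra_simps)

section \<open>Free groups are separated by homomorphisms to unimodular matrices\<close>

text \<open>The matrix with eigenvectors \<open>(1, p)\<close> and \<open>(1, q)\<close> for the eigenvalues \<open>t\<close> and \<open>1/t\<close>.\<close>

definition eigen_mat :: "'k::field \<Rightarrow> 'k \<Rightarrow> 'k \<Rightarrow> 'k mat2" where
  "eigen_mat p q t = ((p / t - q * t) / (p - q), (t - 1 / t) / (p - q),
     p * q * (1 / t - t) / (p - q), (p * t - q / t) / (p - q))"

lemma eigen_mat_in_SL2:
  assumes "p \<noteq> q" "t \<noteq> 0"
  shows "eigen_mat p q t \<in> carrier SL2"
proof -
  have "(p / t - q * t) * (p * t - q / t) - (t - 1 / t) * (p * q * (1 / t - t)) = (p - q) * (p - q)"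
    using assms(2) by (simp add: field_simps) 
  then have "((p / t - q * t) * (p * t - q / t) - (t - 1 / t) * (p * q * (1 / t - t))) / ((p - q) * (p - q)) = 1"
    using assms(1) by simp
  moreover have "A / D * (B / D) - C / D * (E / D) = (A * B - C * E) / (D * D)" for A B C D E :: 'a
    by (simp add: diff_divide_distrib)
  ultimately show ?thesis unfolding eigen_mat_def SL2_carrier by metis
qed

lemma inv_eigen_mat:
  assumes "p \<noteq> q" "t \<noteq> 0"
  shows "inv\<^bsub>SL2\<^esub> (eigen_mat p q t) = eigen_mat q p t"
proof -
  have "(p * t - q / t) / (p - q) = (q / t - p * t) / (q - p)"
    "- ((t - 1 / t) / (p - q)) = (t - 1 / t) / (q - p)"
    "- (p * q * (1 / t - t) / (p - q)) = q * p * (1 / t - t) / (q - p)"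
    "(p / t - q * t) / (p - q) = (q * t - p / t) / (q - p)"
    by (metis minus_diff_eq minus_divide_divide minus_divide_right mult.commute)+
  then show ?thesis using SL2_inv[OF eigen_mat_in_SL2[OF assms, unfolded eigen_mat_def]] by (simp add: eigen_mat_def)
qed

fun mat_vec :: "'k::field mat2 \<Rightarrow> 'k \<times> 'k \<Rightarrow> 'k \<times> 'k" where
  "mat_vec (a, b, c, d) (u, v) = (a * u + b * v, c * u + d * v)"

lemma mat_vec_mult: "mat_vec (A \<otimes>\<^bsub>SL2\<^esub> B) x = mat_vec A (mat_vec B x)"
  by (cases A; cases B; cases x) (simp add: algebra_simps)

text \<open>The vector \<open>S \<cdot> (1, p)\<close> with \<open>S = (v - q u) / (p - q)\<close> is the component of \<open>(u, v)\<close> along \<open>(1, p)\<close>; it is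
  multiplied by \<open>t\<close>, and the rest by \<open>1/t\<close>.\<close>

lemma mat_vec_eigen_mat:
  assumes "p \<noteq> q" "t \<noteq> 0"
  shows "mat_vec (eigen_mat p q t) (u, v) =
    ((t * t * ((v - q * u) / (p - q)) + (u - (v - q * u) / (p - q))) / t,
     (t * t * (p * ((v - q * u) / (p - q))) + (v - p * ((v - q * u) / (p - q)))) / t)"
proof -
  define S where "S = (v - q * u) / (p - q)"
  have v: "v = S * (p - q) + q * u" using assms(1) by (simp add: S_def)
  have "(p / t - q * t) * u + (t - 1 / t) * v = (p - q) * ((t * t * S + (u - S)) / t)"
    using assms(2) unfolding v by (simp add: field_simps)
  then have 1: "(p / t - q * t) / (p - q) * u + (t - 1 / t) / (p - q) * v = (t * t * S + (u - S)) / t"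
    using assms(1) by (simp add: add_divide_distrib[symmetric])
  have "p * q * (1 / t - t) * u + (p * t - q / t) * v = (p - q) * ((t * t * (p * S) + (v - p * S)) / t)"
    using assms(2) unfolding v by (simp add: field_simps)
  then have 2: "p * q * (1 / t - t) / (p - q) * u + (p * t - q / t) / (p - q) * v
      = (t * t * (p * S) + (v - p * S)) / t"
    using assms(1) by (simp add: add_divide_distrib[symmetric])
  show ?thesis unfolding eigen_mat_def mat_vec.simps 1 2 S_def[symmetric] ..
qed

text \<open>The generator \<open>i\<close> is represented by the matrix with the eigenlines \<open>c (2 i + 1)\<close> and \<open>c (2 i + 2)\<close>; its inverse
  exchanges the two eigenvalues. The line \<open>c 0\<close> is left over for the initial vector.\<close>

definition attractor :: "(nat \<Rightarrow> 'k) \<Rightarrow> bool \<times> nat \<Rightarrow> 'k" where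
  "attractor c l = c (if fst l then 2 * snd l + 1 else 2 * snd l + 2)"

definition repeller :: "(nat \<Rightarrow> 'k) \<Rightarrow> bool \<times> nat \<Rightarrow> 'k" where
  "repeller c l = attractor c (\<not> fst l, snd l)"

text \<open>The leading coefficient is a multiple of the attracting vector of the first letter, or of the
  initial vector if the word is empty. A further
  letter \<open>l\<close> projects it along the repelling line of \<open>l\<close>, which differs from the line of that vector
  unless \<open>l\<close> cancels against the first letter.\<close>

lemma word_val_eigen_mat_leading_term:
  fixes c :: "nat \<Rightarrow> 'k::field"
  assumes c: "inj c" and w: "reduced w" "w \<in> words X"
  shows "\<exists>U V \<kappa>. \<kappa> \<noteq> 0 \<and> degree U \<le> 2 * length w \<and> degree V \<le> 2 * length w \<and>
    coeff U (2 * length w) = \<kappa> \<and>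
    coeff V (2 * length w) = \<kappa> * (case w of [] \<Rightarrow> c 0 | l # _ \<Rightarrow> attractor c l) \<and>
    (\<forall>t. t \<noteq> 0 \<longrightarrow> mat_vec (word_val SL2 (\<lambda>i. eigen_mat (c (2 * i + 1)) (c (2 * i + 2)) t) w) (1, c 0)
       = (poly U t / t ^ length w, poly V t / t ^ length w))"
  using w
proof (induction w)
  case Nil
  show ?case
    by (intro exI[of _ "[:1:]"] exI[of _ "[:c 0:]"] exI[of _ 1]) (simp add: SL2_one)
next
  case (Cons l w)
  let ?g = "\<lambda>t i. eigen_mat (c (2 * i + 1)) (c (2 * i + 2)) t"
  define e where "e = (case w of [] \<Rightarrow> c 0 | l # _ \<Rightarrow> attractor c l)"
  obtain U V \<kappa> where IH: "\<kappa> \<noteq> 0" "degree U \<le> 2 * length w" "degree V \<le> 2 * length w"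
      "coeff U (2 * length w) = \<kappa>" "coeff V (2 * length w) = \<kappa> * e"
      "\<And>t. t \<noteq> 0 \<Longrightarrow> mat_vec (word_val SL2 (?g t) w) (1, c 0) = (poly U t / t ^ length w, poly V t / t ^ length w)"
    using Cons.IH reduced_ConsD[OF Cons.prems(1)] Cons.prems(2) by (auto simp: e_def)
  define p q where "p = attractor c l" and "q = repeller c l"
  have pq: "p \<noteq> q" by (simp add: p_def q_def attractor_def repeller_def inj_eq[OF c])
  have "e \<noteq> q"
  proof (cases w)
    case Nil
    then show ?thesis by (simp add: e_def q_def repeller_def attractor_def inj_eq[OF c])
  next
    case (Cons m w')
    then have "\<not> (snd l = snd m \<and> fst l \<noteq> fst m)" using \<open>reduced (l # w)\<close> by simp
    moreover have "2 * a \<noteq> Suc (2 * b)" "Suc (2 * a) \<noteq> 2 * b" for a b :: nat by presburger+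
    ultimately show ?thesis using Cons
      by (auto simp: e_def q_def repeller_def attractor_def inj_eq[OF c])
  qed
  have letter: "(if fst l then ?g t (snd l) else inv\<^bsub>SL2\<^esub> ?g t (snd l)) = eigen_mat p q t" if "t \<noteq> 0" for t
  proof -
    have "c (2 * i + 1) \<noteq> c (2 * i + 2)" for i by (simp add: inj_eq[OF c])
    then show ?thesis using inv_eigen_mat[OF _ that] by (auto simp: p_def q_def attractor_def repeller_def)
  qed
\<comment> \<open>the component of the vector along the attracting line of \<open>l\<close>\<close>
  define S where "S = smult (1 / (p - q)) (V - smult q U)"
  define U' where "U' = monom 1 2 * S + (U - S)"
  define V' where "V' = monom 1 2 * smult p S + (V - smult p S)"
  have dS: "degree S \<le> 2 * length w"
    unfolding S_def using IH(2,3) by (auto intro!: degree_diff_le order.trans[OF degree_smult_le])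
  have cS: "coeff S (2 * length w) = \<kappa> * (e - q) / (p - q)"
    unfolding S_def using IH(4,5) by (simp add: algebra_simps diff_divide_distrib)
  have "degree (monom 1 2 * S) \<le> 2 * length (l # w)" "degree (monom 1 2 * smult p S) \<le> 2 * length (l # w)"
    using dS degree_mult_le[of "monom 1 2" S] degree_mult_le[of "monom 1 2" "smult p S"]
      degree_monom_le[of "1::'k" 2] degree_smult_le[of p S] by simp_all
  then have deg: "degree U' \<le> 2 * length (l # w)" "degree V' \<le> 2 * length (l # w)"
    unfolding U'_def V'_def using IH(2,3) dS
    by (auto intro!: degree_add_le degree_diff_le order.trans[OF degree_smult_le])
  have high: "coeff f (Suc (Suc (2 * length w))) = 0" if "degree f \<le> 2 * length w" for f :: "'k poly"
    using that by (intro coeff_eq_0) simp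
  have "coeff U' (2 * length (l # w)) = \<kappa> * (e - q) / (p - q)"
    "coeff V' (2 * length (l # w)) = \<kappa> * (e - q) / (p - q) * p"
    unfolding U'_def V'_def using cS high IH(2,3) dS
    by (simp_all add: coeff_monom_mult numeral_2_eq_2)
  moreover have "\<kappa> * (e - q) / (p - q) \<noteq> 0" using IH(1) pq \<open>e \<noteq> q\<close> by simp
  moreover have "mat_vec (word_val SL2 (?g t) (l # w)) (1, c 0)
      = (poly U' t / t ^ length (l # w), poly V' t / t ^ length (l # w))" if t: "t \<noteq> 0" for t
  proof -
    have "mat_vec (word_val SL2 (?g t) (l # w)) (1, c 0)
        = mat_vec (eigen_mat p q t) (poly U t / t ^ length w, poly V t / t ^ length w)"
      by (simp only: word_val.simps letter[OF t] mat_vec_mult IH(6)[OF t])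
    also have "\<dots> = (poly U' t / t ^ length (l # w), poly V' t / t ^ length (l # w))"
    proof -
      have S: "(poly V t / t ^ length w - q * (poly U t / t ^ length w)) / (p - q) = poly S t / t ^ length w"
        using t pq by (simp add: S_def field_simps)
      show ?thesis unfolding mat_vec_eigen_mat[OF pq t] S using t
        by (simp add: U'_def V'_def poly_monom power2_eq_square field_simps)
    qed
    finally show ?thesis .
  qed
  ultimately show ?case using deg
    by (intro exI[of _ U'] exI[of _ V'] exI[of _ "\<kappa> * (e - q) / (p - q)"]) (simp add: p_def)
qed

text \<open>If a reduced word of length \<open>l \<ge> 1\<close> had the value 1 for all \<open>t \<noteq> 0\<close>, the polynomial \<open>U\<close> of degree \<open>2 l\<close>
  would coincide with \<open>t\<^sup>l\<close>, since the field is infinite.\<close>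

theorem free_group_separated_by_SL2:
  assumes y: "y \<in> carrier (free_group n)" "y \<noteq> \<one>\<^bsub>free_group n\<^esub>"
  shows "\<exists>g :: nat \<Rightarrow> 'k::alg_closed_field mat2. (\<forall>i. g i \<in> carrier SL2) \<and> pres_lift SL2 g y \<noteq> \<one>\<^bsub>SL2\<^esub>"
proof (rule ccontr)
  assume neg: "\<nexists>g :: nat \<Rightarrow> 'k mat2. (\<forall>i. g i \<in> carrier SL2) \<and> pres_lift SL2 g y \<noteq> \<one>\<^bsub>SL2\<^esub>"
  obtain v where v: "v \<in> words {..<n}" "y = pres_rel {..<n} {} `` {v}"
    using y(1) by (auto simp: free_group_def in_carrier_presented_group)
  obtain w where w: "w \<in> words {..<n}" "reduced w" "pres_eq {..<n} {} v w"
    using ex_reduced_word[OF v(1)] by blast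
  have yw: "y = pres_rel {..<n} {} `` {w}" using v w by (simp add: pres_class_eq_iff)
  have "w \<noteq> []" using y(2) yw by (auto simp: free_group_def one_presented_group)
  obtain c :: "nat \<Rightarrow> 'k" where c: "inj c"
    using infinite_countable_subset[OF infinite_alg_closed_field[where 'k = 'k]] by blast
  let ?g = "\<lambda>t i. eigen_mat (c (2 * i + 1)) (c (2 * i + 2)) t"
  obtain U V \<kappa> where UV: "\<kappa> \<noteq> 0" "coeff U (2 * length w) = \<kappa>"
    "\<And>t. t \<noteq> 0 \<Longrightarrow> mat_vec (word_val SL2 (?g t) w) (1, c 0) = (poly U t / t ^ length w, poly V t / t ^ length w)"
    using word_val_eigen_mat_leading_term[OF c w(2,1)] by blast
  have "poly U t = t ^ length w" if t: "t \<noteq> 0" for t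
  proof -
    have g: "?g t i \<in> carrier SL2" for i
      using injD[OF c, of "2 * i + 1" "2 * i + 2"] by (intro eigen_mat_in_SL2 t) auto
    have "pres_lift SL2 (?g t) y = \<one>\<^bsub>SL2\<^esub>"
      using neg[unfolded not_ex, THEN spec, of "?g t"] g by blast
    moreover have "pres_lift SL2 (?g t) y = word_val SL2 (?g t) w"
      unfolding yw using g w(1) by (intro group.pres_lift_class[OF group_SL2]) auto
    ultimately have one: "word_val SL2 (?g t) w = (1, 0, 0, 1)" by (simp add: SL2_one)
    have "mat_vec (word_val SL2 (?g t) w) (1, c 0) = (1, c 0)" unfolding one by simp
    then show ?thesis using UV(3)[OF t] t by simp
  qed
  then have "UNIV - {0} \<subseteq> {t. poly (U - monom 1 (length w)) t = 0}" by (auto simp: poly_monom)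
  then have "infinite {t. poly (U - monom 1 (length w)) t = 0}"
    using infinite_alg_closed_field[where 'k = 'k] by (metis finite_Diff2 finite.emptyI finite.insertI finite_subset)
  then have "U - monom 1 (length w) = 0" using poly_roots_finite by blast
  then have "coeff U (2 * length w) = 0" using \<open>w \<noteq> []\<close> by simp
  then show False using UV by simp
qed

section \<open>The variety of n-tuples of unimodular matrices\<close>

definition mat_at :: "'k list \<Rightarrow> nat \<Rightarrow> 'k mat2" where
  "mat_at z i = (z ! (4 * i), z ! (4 * i + 1), z ! (4 * i + 2), z ! (4 * i + 3))"

definition SL2_tuples :: "nat \<Rightarrow> 'k::field list set" where
  "SL2_tuples n = {z \<in> affine_points (4 * n). \<forall>i<n. mat_at z i \<in> carrier SL2}"

fun entry :: "'k mat2 \<Rightarrow> nat \<Rightarrow> 'k" where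
  "entry (a, b, c, d) r = (if r = 0 then a else if r = 1 then b else if r = 2 then c else d)"

definition of_mats :: "nat \<Rightarrow> (nat \<Rightarrow> 'k mat2) \<Rightarrow> 'k list" where
  "of_mats n g = map (\<lambda>k. entry (g (k div 4)) (k mod 4)) [0..<4 * n]"

lemma length_of_mats [simp]: "length (of_mats n g) = 4 * n"
  by (simp add: of_mats_def)

lemma nth_of_mats: "k < 4 * n \<Longrightarrow> of_mats n g ! k = entry (g (k div 4)) (k mod 4)"
  by (simp add: of_mats_def)

lemma entry_div_mod:
  "entry (g ((4 * i) div 4)) ((4 * i) mod 4) = fst (g i)"
  "entry (g ((4 * i + 1) div 4)) ((4 * i + 1) mod 4) = fst (snd (g i))"
  "entry (g ((4 * i + 2) div 4)) ((4 * i + 2) mod 4) = fst (snd (snd (g i)))"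
  "entry (g ((4 * i + 3) div 4)) ((4 * i + 3) mod 4) = snd (snd (snd (g i)))"
proof -
  have "(4 * i + 1) div 4 = i" "(4 * i + 2) div 4 = i" "(4 * i + 3) div 4 = i"
    "(4 * i + 1) mod 4 = 1" "(4 * i + 2) mod 4 = 2" "(4 * i + 3) mod 4 = 3" by presburger+
  then show
    "entry (g ((4 * i) div 4)) ((4 * i) mod 4) = fst (g i)"
    "entry (g ((4 * i + 1) div 4)) ((4 * i + 1) mod 4) = fst (snd (g i))"
    "entry (g ((4 * i + 2) div 4)) ((4 * i + 2) mod 4) = fst (snd (snd (g i)))"
    "entry (g ((4 * i + 3) div 4)) ((4 * i + 3) mod 4) = snd (snd (snd (g i)))"
    by (cases "g i"; simp)+
qed

lemma mat_at_of_mats [simp]: "i < n \<Longrightarrow> mat_at (of_mats n g) i = g i"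
  unfolding mat_at_def
  by (simp only: nth_of_mats entry_div_mod prod.collapse)

lemma of_mats_mat_at: 
  assumes "length z = 4 * n" shows "of_mats n (mat_at z) = z"
proof (rule nth_equalityI)
  fix k assume "k < length (of_mats n (mat_at z))"
  then have k: "k < 4 * n" by simp
  have entry: "entry (mat_at z q) r = z ! (4 * q + r)" if "r \<in> {0, 1, 2, 3}" for q r
    using that by (auto simp: mat_at_def)
  have "k mod 4 = 0 \<or> k mod 4 = 1 \<or> k mod 4 = 2 \<or> k mod 4 = 3" by presburger
  then have "k mod 4 \<in> {0, 1, 2, 3}" unfolding insert_iff by blast
  then have "entry (mat_at z (k div 4)) (k mod 4) = z ! (4 * (k div 4) + k mod 4)" by (rule entry)
  then have "entry (mat_at z (k div 4)) (k mod 4) = z ! k" by simp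
  then show "of_mats n (mat_at z) ! k = z ! k" using k by (simp add: nth_of_mats)
qed (use assms in simp)

lemma of_mats_in_SL2_tuples:
  "(\<And>i. i < n \<Longrightarrow> g i \<in> carrier SL2) \<Longrightarrow> of_mats n g \<in> SL2_tuples n"
  by (simp add: SL2_tuples_def affine_points_def)

lemma SL2_tuplesD:
  assumes "z \<in> SL2_tuples n"
  shows "length z = 4 * n" "i < n \<Longrightarrow> mat_at z i \<in> carrier SL2"
  using assms by (auto simp: SL2_tuples_def affine_points_def)

lemma of_mats_cong: "(\<And>i. i < n \<Longrightarrow> g i = h i) \<Longrightarrow> of_mats n g = of_mats n h"
  by (auto simp: of_mats_def)

lemma closedin_SL2_tuples: "closedin (affine_zariski (4 * n)) (SL2_tuples n :: 'k::field list set)"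
proof -
  define f :: "nat \<Rightarrow> 'k mpol" where "f i = var_mpol (4 * i) * var_mpol (4 * i + 3)
    + (const_mpol (- 1) * (var_mpol (4 * i + 1) * var_mpol (4 * i + 2)) + const_mpol (- 1))" for i
  have "f ` {..<n} \<subseteq> polys (4 * n)"
    by (auto simp: f_def intro!: polys_add polys_mult)
  moreover have "mpeval (f i) z = 0 \<longleftrightarrow> mat_at z i \<in> carrier SL2" for z i
    by (simp add: mat_at_def f_def mpeval_add mpeval_mult) (auto simp: algebra_simps)
  then have "SL2_tuples n = affine_zeros (4 * n) (f ` {..<n})"
    by (auto simp: SL2_tuples_def affine_zeros_def)
  ultimately show ?thesis unfolding closedin_affine_zariski by blast
qed

abbreviation SL2_variety :: "nat \<Rightarrow> ('k::field list, 'k) fspace" where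
  "SL2_variety n \<equiv> algebraic_set (4 * n) (SL2_tuples n)"

lemma topspace_SL2_variety: "topspace (Top (SL2_variety n)) = SL2_tuples n"
  by (auto simp: SL2_tuples_def)

lemma variety_SL2_variety: "variety (SL2_variety n :: ('k::field list, 'k) fspace)"
  by (rule variety_algebraic_set[OF closedin_SL2_tuples])

subsection \<open>Irreducibility\<close>

text \<open>The product of an upper, a lower, an upper and a lower triangular shear. It parametrises \<open>SL\<^sub>2\<close> by an affine space,
  which provides polynomial curves between any two matrices.\<close>

definition four_shears :: "'k::field \<Rightarrow> 'k \<Rightarrow> 'k \<Rightarrow> 'k \<Rightarrow> 'k mat2" where
  "four_shears s1 s2 s3 s4 =
    (1 + s1 * s2 + ((1 + s1 * s2) * s3 + s1) * s4, (1 + s1 * s2) * s3 + s1,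
     s2 + (s2 * s3 + 1) * s4, s2 * s3 + 1)"

lemma four_shears_in_SL2: "four_shears s1 s2 s3 s4 \<in> carrier SL2"
  by (simp add: four_shears_def algebra_simps)

lemma SL2_is_product_of_four_shears:
  assumes "A \<in> carrier SL2"
  obtains s1 s2 s3 s4 where "A = four_shears s1 s2 s3 s4"
proof -
  obtain a b c d where A: "A = (a, b, c, d)" by (metis prod_cases4)
  then have det: "a * d - b * c = 1" using assms by simp
  show ?thesis
  proof (cases "c = 0")
    case False
    have "b * c = a * (d - 1) + (a - 1)" using det by (simp add: algebra_simps)
    then have "b = a * ((d - 1) / c) + (a - 1) / c"
      using False by (simp add: eq_divide_eq add_divide_distrib[symmetric])
    then have "A = four_shears ((a - 1) / c) c ((d - 1) / c) 0"
      using False by (simp add: A four_shears_def)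
    then show ?thesis using that by blast
  next
\<comment> \<open>multiplication by a lower shear from the right makes the lower left entry nonzero\<close>
    case True
    then have "d \<noteq> 0" using det by auto
    moreover from this have "a = 1 / d" using det True by (simp add: eq_divide_eq)
    ultimately have "A = four_shears ((a - b - 1) / (- d)) (- d) ((d - 1) / (- d)) 1"
      using True by (simp add: A four_shears_def field_simps)
    then show ?thesis using that by blast
  qed
qed

lemma SL2_curve:
  assumes "A \<in> carrier SL2" "B \<in> carrier SL2"
  obtains G :: "'k::field \<Rightarrow> 'k mat2" where "G 0 = A" "G 1 = B" "\<And>t. G t \<in> carrier SL2"
    "\<And>r. \<exists>q. \<forall>t. entry (G t) r = poly q t"
proof -
  obtain a1 a2 a3 a4 where A: "A = four_shears a1 a2 a3 a4" using SL2_is_product_of_four_shears[OF assms(1)] .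
  obtain b1 b2 b3 b4 where B: "B = four_shears b1 b2 b3 b4" using SL2_is_product_of_four_shears[OF assms(2)] .
  define q1 q2 q3 q4 where q: "q1 = [:a1, b1 - a1:]" "q2 = [:a2, b2 - a2:]"
    "q3 = [:a3, b3 - a3:]" "q4 = [:a4, b4 - a4:]"
  define G where "G t = four_shears (poly q1 t) (poly q2 t) (poly q3 t) (poly q4 t)" for t
  have "\<exists>q. \<forall>t. entry (G t) r = poly q t" for r
  proof -
    let ?q = "if r = 0 then 1 + q1 * q2 + ((1 + q1 * q2) * q3 + q1) * q4 else if r = 1 then (1 + q1 * q2) * q3 + q1
      else if r = 2 then q2 + (q2 * q3 + 1) * q4 else q2 * q3 + 1"
    show ?thesis by (rule exI[of _ ?q]) (simp add: G_def four_shears_def)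
  qed
  moreover have "G 0 = A" "G 1 = B" by (simp_all add: G_def q A B)
  ultimately show ?thesis using that[of G] by (simp add: G_def four_shears_in_SL2)
qed

lemma SL2_variety_opens_meet:
  fixes U V :: "'k::alg_closed_field list set"
  assumes "openin (Top (SL2_variety n)) U" "openin (Top (SL2_variety n)) V" "U \<noteq> {}" "V \<noteq> {}"
  shows "U \<inter> V \<noteq> {}"
proof -
  obtain F f x where F: "F \<subseteq> polys (4 * n)" "U = {x \<in> affine_points (4 * n) \<inter> SL2_tuples n. \<exists>f\<in>F. mpeval f x \<noteq> 0}"
    and f: "x \<in> SL2_tuples n" "f \<in> F" "mpeval f x \<noteq> 0"
    using assms(1,3) unfolding openin_algebraic_set by blast
  obtain G g y where G: "G \<subseteq> polys (4 * n)" "V = {x \<in> affine_points (4 * n) \<inter> SL2_tuples n. \<exists>f\<in>G. mpeval f x \<noteq> 0}"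
    and g: "y \<in> SL2_tuples n" "g \<in> G" "mpeval g y \<noteq> 0"
    using assms(2,4) unfolding openin_algebraic_set by blast
  have "\<exists>G. G 0 = mat_at x i \<and> G 1 = mat_at y i \<and> (\<forall>t. G t \<in> carrier SL2) \<and>
      (\<forall>r. \<exists>q. \<forall>t. entry (G t) r = poly q t)" if "i < n" for i
    using SL2_curve[OF SL2_tuplesD(2)[OF f(1) that] SL2_tuplesD(2)[OF g(1) that]] by metis
  then obtain H where H: "\<And>i. i < n \<Longrightarrow> H i 0 = mat_at x i \<and> H i 1 = mat_at y i \<and> (\<forall>t. H i t \<in> carrier SL2) \<and>
      (\<forall>r. \<exists>q. \<forall>t. entry (H i t) r = poly q t)" by metis
  define c where "c t = of_mats n (\<lambda>i. H i t)" for t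
  have c: "c 0 = x" "c 1 = y"
    using H of_mats_cong[of n "\<lambda>i. H i 0" "mat_at x"] of_mats_cong[of n "\<lambda>i. H i 1" "mat_at y"]
      of_mats_mat_at[OF SL2_tuplesD(1)[OF f(1)]] of_mats_mat_at[OF SL2_tuplesD(1)[OF g(1)]]
    by (simp_all add: c_def)
  obtain t where t: "mpeval f (c t) \<noteq> 0" "mpeval g (c t) \<noteq> 0"
  proof (rule common_nonzero_on_curve)
    show "f \<in> polys (4 * n)" "g \<in> polys (4 * n)" using F(1) f(2) G(1) g(2) by auto
    show "mpeval f (c 0) \<noteq> 0" "mpeval g (c 1) \<noteq> 0" using f g c by auto
    show "\<exists>q. \<forall>t. c t ! k = poly q t" if "k < 4 * n" for k
      using that H[of "k div 4"] by (simp add: c_def nth_of_mats)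
  qed
  have "c t \<in> SL2_tuples n" unfolding c_def using H by (intro of_mats_in_SL2_tuples) auto
  moreover from this have "c t \<in> affine_points (4 * n)" by (simp add: SL2_tuples_def)
  ultimately have "c t \<in> U \<inter> V" using F(2) G(2) f(2) g(2) t by blast
  then show ?thesis by blast
qed

lemma SL2_variety_irreducible:
  "irreducible_in (Top (SL2_variety n)) (topspace (Top (SL2_variety n :: ('k::alg_closed_field list, 'k) fspace)))"
  unfolding irreducible_in_def
proof (intro conjI allI impI)
  let ?T = "Top (SL2_variety n :: ('k list, 'k) fspace)"
  have "of_mats n (\<lambda>_. \<one>\<^bsub>SL2\<^esub>) \<in> (SL2_tuples n :: 'k list set)"
    by (rule of_mats_in_SL2_tuples) (simp add: SL2_one)
  then show "topspace ?T \<noteq> {}" unfolding topspace_SL2_variety by blast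
  fix F G assume FG: "closedin ?T F" "closedin ?T G" "topspace ?T \<subseteq> F \<union> G"
  then have "openin ?T (topspace ?T - F)" "openin ?T (topspace ?T - G)" by (auto simp: closedin_def)
  from SL2_variety_opens_meet[OF this] FG(3) show "topspace ?T \<subseteq> F \<or> topspace ?T \<subseteq> G" by blast
qed simp

subsection \<open>The action of the automorphisms of the free group\<close>

text \<open>Word maps are polynomial, because the inverse of a unimodular matrix is its adjugate.\<close>

lemma regular_word_val:
  fixes w :: "nat word"
  assumes "w \<in> words {..<n}"
  shows "\<exists>a b c d. (\<forall>f\<in>{a, b, c, d}. regular (SL2_variety n) (SL2_tuples n) f) \<and>
    (\<forall>z\<in>SL2_tuples n. word_val SL2 (mat_at z) w = (a z, b z, c z, d z :: 'k::field))"
proof -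
  let ?X = "SL2_variety n :: ('k list, 'k) fspace" and ?Z = "SL2_tuples n :: 'k list set"
  interpret X: function_space ?X by (rule function_space_algebraic_set)
  have Z: "openin (Top ?X) ?Z" using openin_topspace[of "Top ?X"] unfolding topspace_SL2_variety .
  show ?thesis
    using assms
  proof (induction w)
    case Nil
    show ?case using X.regular_const[OF Z]
      by (intro exI[of _ "\<lambda>_. 1"] exI[of _ "\<lambda>_. 0"] exI[of _ "\<lambda>_. 0"] exI[of _ "\<lambda>_. 1"]) (simp add: SL2_one)
  next
    case (Cons l w)
    then obtain a b c d where IH: "regular ?X ?Z a" "regular ?X ?Z b" "regular ?X ?Z c" "regular ?X ?Z d"
      "\<And>z. z \<in> ?Z \<Longrightarrow> word_val SL2 (mat_at z) w = (a z, b z, c z, d z)" by auto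
    have i: "snd l < n" using Cons.prems by simp
    have co: "regular ?X ?Z (\<lambda>z. z ! k)" if "k < 4 * n" for k
      using that Z by (rule regular_coordinate)
    have "\<exists>p q r s. regular ?X ?Z p \<and> regular ?X ?Z q \<and> regular ?X ?Z r \<and> regular ?X ?Z s \<and>
      (\<forall>z\<in>?Z. (if fst l then mat_at z (snd l) else inv\<^bsub>SL2\<^esub> mat_at z (snd l)) = (p z, q z, r z, s z))"
    proof (cases "fst l")
      case True
      then show ?thesis using i co
        by (intro exI[of _ "\<lambda>z. z ! (4 * snd l)"] exI[of _ "\<lambda>z. z ! (4 * snd l + 1)"]
          exI[of _ "\<lambda>z. z ! (4 * snd l + 2)"] exI[of _ "\<lambda>z. z ! (4 * snd l + 3)"]) (simp add: mat_at_def)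
    next
      case False
      have "regular ?X ?Z (\<lambda>z. - (z ! k))" if "k < 4 * n" for k
        using X.regular_mult[OF Z X.regular_const[OF Z, of "- 1"] co[OF that]] by simp
      moreover have "inv\<^bsub>SL2\<^esub> mat_at z (snd l) = (z ! (4 * snd l + 3), - (z ! (4 * snd l + 1)),
          - (z ! (4 * snd l + 2)), z ! (4 * snd l))" if "z \<in> ?Z" for z
        using SL2_tuplesD(2)[OF that i] unfolding mat_at_def by (rule SL2_inv)
      ultimately show ?thesis using i co False
        by (intro exI[of _ "\<lambda>z. z ! (4 * snd l + 3)"] exI[of _ "\<lambda>z. - (z ! (4 * snd l + 1))"]
          exI[of _ "\<lambda>z. - (z ! (4 * snd l + 2))"] exI[of _ "\<lambda>z. z ! (4 * snd l)"]) simp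
    qed
    then obtain p q r s where l: "regular ?X ?Z p" "regular ?X ?Z q" "regular ?X ?Z r" "regular ?X ?Z s"
      "\<And>z. z \<in> ?Z \<Longrightarrow> (if fst l then mat_at z (snd l) else inv\<^bsub>SL2\<^esub> mat_at z (snd l)) = (p z, q z, r z, s z)"
      by blast
    note comb = X.regular_add[OF Z X.regular_mult[OF Z] X.regular_mult[OF Z]]
    show ?case
    proof (intro exI conjI)
      show "\<forall>f\<in>{\<lambda>z. p z * a z + q z * c z, \<lambda>z. p z * b z + q z * d z,
          \<lambda>z. r z * a z + s z * c z, \<lambda>z. r z * b z + s z * d z}. regular ?X ?Z f"
        using IH(1-4) l(1-4) comb by blast
      show "\<forall>z\<in>?Z. word_val SL2 (mat_at z) (l # w) = (p z * a z + q z * c z, p z * b z + q z * d z,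
          r z * a z + s z * c z, r z * b z + s z * d z)"
      proof
        fix z assume z: "z \<in> ?Z"
        show "word_val SL2 (mat_at z) (l # w) = (p z * a z + q z * c z, p z * b z + q z * d z,
            r z * a z + s z * c z, r z * b z + s z * d z)"
          by (simp only: word_val.simps l(5)[OF z] IH(5)[OF z] SL2_mult)
      qed
    qed
  qed
qed

context free_group_of_rank
begin

text \<open>The homomorphism from the free group to \<open>SL\<^sub>2\<close> that corresponds to a point of the variety of tuples.\<close>

definition specialise :: "'k::field list \<Rightarrow> nat word set \<Rightarrow> 'k mat2" where
  "specialise z = pres_lift SL2 (mat_at z)"

lemma specialise_hom: "z \<in> SL2_tuples M \<Longrightarrow> specialise z \<in> hom F SL2"
  unfolding specialise_def using SL2_tuplesD(2) by (intro free_lift_hom group_SL2)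

lemma specialise_gen: "z \<in> SL2_tuples M \<Longrightarrow> i < M \<Longrightarrow> specialise z (x i) = mat_at z i"
  unfolding specialise_def using SL2_tuplesD(2) by (intro free_lift_gen group_SL2)

lemma specialise_closed: "z \<in> SL2_tuples M \<Longrightarrow> y \<in> carrier F \<Longrightarrow> specialise z y \<in> carrier SL2"
  using hom_in_carrier[OF specialise_hom] .

text \<open>Precomposition of \<open>specialise z\<close> with \<open>\<phi>\<close>. This is an action from the right, which \<open>act_hom\<close> turns
  into a homomorphism by means of the inverse.\<close>

definition act :: "(nat word set \<Rightarrow> nat word set) \<Rightarrow> 'k::field list \<Rightarrow> 'k list" where
  "act \<phi> z = of_mats M (\<lambda>i. specialise z (\<phi> (x i)))"

lemma act_closed: "\<phi> \<in> carrier K \<Longrightarrow> z \<in> SL2_tuples M \<Longrightarrow> act \<phi> z \<in> SL2_tuples M"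
  unfolding act_def by (intro of_mats_in_SL2_tuples specialise_closed) auto

lemma specialise_act:
  assumes "\<phi> \<in> carrier K" "z \<in> SL2_tuples M" "y \<in> carrier F"
  shows "specialise (act \<phi> z) y = specialise z (\<phi> y)"
proof -
  have "specialise (act \<phi> z) y = (specialise z \<circ> \<phi>) y"
  proof (rule hom_free_eqI[OF group_SL2])
    show "specialise (act \<phi> z) \<in> hom F SL2" by (rule specialise_hom[OF act_closed[OF assms(1,2)]])
    show "specialise z \<circ> \<phi> \<in> hom F SL2"
      by (rule Group.hom_compose[OF Aut_hom[OF assms(1)] specialise_hom[OF assms(2)]])
    show "specialise (act \<phi> z) (x i) = (specialise z \<circ> \<phi>) (x i)" if "i < M" for i
      using specialise_gen[OF act_closed[OF assms(1,2)] that] that by (simp add: act_def)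
  qed fact
  then show ?thesis by simp
qed

lemma act_act:
  assumes "\<phi> \<in> carrier K" "\<psi> \<in> carrier K" "z \<in> SL2_tuples M"
  shows "act \<phi> (act \<psi> z) = act (\<psi> \<otimes>\<^bsub>K\<^esub> \<phi>) z"
  unfolding act_def[of \<phi>] act_def[of "\<psi> \<otimes>\<^bsub>K\<^esub> \<phi>"]
  using assms by (intro of_mats_cong) (simp add: specialise_act)

lemma act_one: "z \<in> SL2_tuples M \<Longrightarrow> act \<one>\<^bsub>K\<^esub> z = z"
  unfolding act_def using of_mats_cong[of M "\<lambda>i. specialise z (\<one>\<^bsub>K\<^esub> (x i))" "mat_at z"]
  by (simp add: specialise_gen of_mats_mat_at SL2_tuplesD(1))

lemma morphism_act:
  assumes \<phi>: "\<phi> \<in> carrier K"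
  shows "morphism (SL2_variety M) (SL2_variety M) (act \<phi> :: 'k::field list \<Rightarrow> 'k list)"
proof -
  let ?X = "SL2_variety M :: ('k list, 'k) fspace" and ?Z = "SL2_tuples M :: 'k list set"
  interpret X: function_space ?X by (rule function_space_algebraic_set)
  have Z: "openin (Top ?X) ?Z" using openin_topspace[of "Top ?X"] unfolding topspace_SL2_variety .
  show ?thesis
  proof (rule X.morphism_to_algebraic_set; unfold topspace_SL2_variety)
    show "act \<phi> z \<in> affine_points (4 * M) \<inter> ?Z" if "z \<in> ?Z" for z
      using act_closed[OF \<phi> that] by (auto simp: SL2_tuples_def)
    fix k assume k: "k < 4 * M"
    then have i: "k div 4 < M" by simp
    then have "\<phi> (x (k div 4)) \<in> carrier F" using \<phi> by simp
    then obtain w where w: "w \<in> words {..<M}" "\<phi> (x (k div 4)) = pres_rel {..<M} {} `` {w}"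
      by (auto simp: free_group_def in_carrier_presented_group)
    obtain a b c d :: "'k list \<Rightarrow> 'k" where abcd: "\<forall>f\<in>{a, b, c, d}. regular ?X ?Z f"
      "\<forall>z\<in>?Z. word_val SL2 (mat_at z) w = (a z, b z, c z, d z)"
      using regular_word_val[OF w(1)] by blast
    have act: "act \<phi> z ! k = entry (a z, b z, c z, d z) (k mod 4)" if z: "z \<in> ?Z" for z
    proof -
      have "specialise z (\<phi> (x (k div 4))) = word_val SL2 (mat_at z) w"
        unfolding specialise_def w(2)
        using SL2_tuplesD(2)[OF z] w(1) by (intro group.pres_lift_class[OF group_SL2]) auto
      then show ?thesis using abcd(2) z k by (simp add: act_def nth_of_mats del: entry.simps)
    qed
    have "regular ?X ?Z (\<lambda>z. entry (a z, b z, c z, d z) (k mod 4))"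
      using abcd(1) by (cases "k mod 4 = 0"; cases "k mod 4 = 1"; cases "k mod 4 = 2") simp_all
    then show "regular ?X ?Z (\<lambda>z. act \<phi> z ! k)"
      by (rule X.regular_cong[OF Z, rotated]) (simp only: act)
  qed
qed

definition act_hom :: "(nat word set \<Rightarrow> nat word set) \<Rightarrow> 'k::field list \<Rightarrow> 'k list" where
  "act_hom \<phi> = restrict (act (inv\<^bsub>K\<^esub> \<phi>)) (SL2_tuples M)"

lemma act_inverse:
  assumes "\<phi> \<in> carrier K" "z \<in> SL2_tuples M"
  shows "act \<phi> (act (inv\<^bsub>K\<^esub> \<phi>) z) = z" "act (inv\<^bsub>K\<^esub> \<phi>) (act \<phi> z) = z"
  using assms by (simp_all add: act_act act_one)

text \<open>If two automorphisms act in the same way, every homomorphism to \<open>SL\<^sub>2\<close> takes the same value at the images of a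
  generator under their inverses, so these images coincide.\<close>

theorem act_hom_mon: "act_hom \<in> mon K (Aut_variety (SL2_variety M :: ('k::alg_closed_field list, 'k) fspace))"
  unfolding mon_def
proof (intro CollectI conjI)
  let ?X = "SL2_variety M :: ('k list, 'k) fspace" and ?Z = "SL2_tuples M :: 'k list set"
  have bij: "bij_betw (act_hom \<phi>) ?Z ?Z" if "\<phi> \<in> carrier K" for \<phi>
    by (rule bij_betwI[where g = "act \<phi>"])
      (use that act_closed in \<open>auto simp: act_hom_def act_inverse\<close>)
  have Bij: "act_hom \<phi> \<in> Bij ?Z" if "\<phi> \<in> carrier K" for \<phi>
    using bij[OF that] by (simp add: Bij_def act_hom_def)
  show "act_hom \<in> hom K (Aut_variety ?X)"
  proof (rule homI)
    fix \<phi> assume \<phi>: "\<phi> \<in> carrier K"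
    have "morphism ?X ?X (act_hom \<phi>)"
      by (rule morphism_cong[OF function_space_algebraic_set morphism_act[of "inv\<^bsub>K\<^esub> \<phi>"]])
        (use \<phi> in \<open>simp_all add: topspace_SL2_variety act_hom_def del: topspace_algebraic_set\<close>)
    moreover have "morphism ?X ?X (inv_into ?Z (act_hom \<phi>))"
    proof (rule morphism_cong[OF function_space_algebraic_set morphism_act[OF \<phi>]])
      fix z assume "z \<in> topspace (Top ?X)"
      then have z: "z \<in> ?Z" unfolding topspace_SL2_variety .
      have "act_hom \<phi> (act \<phi> z) = z" "act \<phi> z \<in> ?Z"
        using z \<phi> by (simp_all add: act_hom_def act_inverse act_closed)
      then show "act \<phi> z = inv_into ?Z (act_hom \<phi>) z"
        using inv_into_f_f[OF bij_betw_imp_inj_on[OF bij[OF \<phi>]], of "act \<phi> z"] by simp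
    qed
    ultimately show "act_hom \<phi> \<in> carrier (Aut_variety ?X)"
      using Bij[OF \<phi>] by (simp add: Aut_variety_def topspace_SL2_variety del: topspace_algebraic_set)
    fix \<psi> assume \<psi>: "\<psi> \<in> carrier K"
    have "act_hom (\<phi> \<otimes>\<^bsub>K\<^esub> \<psi>) z = compose ?Z (act_hom \<phi>) (act_hom \<psi>) z" for z
      using \<phi> \<psi> by (simp add: act_hom_def compose_def act_act act_closed K.inv_mult_group)
    then show "act_hom (\<phi> \<otimes>\<^bsub>K\<^esub> \<psi>) = act_hom \<phi> \<otimes>\<^bsub>Aut_variety ?X\<^esub> act_hom \<psi>"
      using Bij[OF \<phi>] Bij[OF \<psi>]
      by (auto simp: Aut_variety_def BijGroup_def topspace_SL2_variety simp del: topspace_algebraic_set)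
  qed
  show "inj_on (act_hom :: _ \<Rightarrow> 'k list \<Rightarrow> 'k list) (carrier K)"
  proof (rule inj_onI)
    fix \<phi> \<psi> assume \<phi>: "\<phi> \<in> carrier K" and \<psi>: "\<psi> \<in> carrier K"
      and eq: "act_hom \<phi> = (act_hom \<psi> :: 'k list \<Rightarrow> 'k list)"
    define \<phi>' \<psi>' where "\<phi>' = inv\<^bsub>K\<^esub> \<phi>" and "\<psi>' = inv\<^bsub>K\<^esub> \<psi>"
    have K: "\<phi>' \<in> carrier K" "\<psi>' \<in> carrier K" using \<phi> \<psi> by (simp_all add: \<phi>'_def \<psi>'_def)
    have "\<phi>' = \<psi>'"
    proof (rule Aut_free_eqI[OF K])
      fix i assume i: "i < M"
      let ?y = "\<phi>' (x i) \<otimes>\<^bsub>F\<^esub> inv\<^bsub>F\<^esub> \<psi>' (x i)"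
      have cl: "\<phi>' (x i) \<in> carrier F" "\<psi>' (x i) \<in> carrier F" using K i by simp_all
      have "?y = \<one>\<^bsub>F\<^esub>"
      proof (rule ccontr)
        assume "?y \<noteq> \<one>\<^bsub>F\<^esub>"
        then obtain g :: "nat \<Rightarrow> 'k mat2" where g: "\<forall>i. g i \<in> carrier SL2" "pres_lift SL2 g ?y \<noteq> \<one>\<^bsub>SL2\<^esub>"
          using free_group_separated_by_SL2[where 'k = 'k, of ?y M] cl by auto
        let ?z = "of_mats M g"
        have z: "?z \<in> SL2_tuples M" using g(1) by (intro of_mats_in_SL2_tuples) auto
        have "act \<phi>' ?z = act \<psi>' ?z"
          using fun_cong[OF eq, of ?z] z by (simp add: act_hom_def \<phi>'_def \<psi>'_def)
        from arg_cong[OF this, of "\<lambda>z. mat_at z i"]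
        have "specialise ?z (\<phi>' (x i)) = specialise ?z (\<psi>' (x i))" using i by (simp add: act_def)
        moreover have "pres_lift SL2 g y = specialise ?z y" if "y \<in> carrier F" for y
          by (rule hom_free_eqI[OF group_SL2 free_lift_hom[OF group_SL2] specialise_hom[OF z] _ that])
            (use g(1) z in \<open>simp_all add: free_lift_gen group_SL2 specialise_gen\<close>)
        moreover interpret s: group_hom F SL2 "specialise ?z"
          by (simp add: group_hom_def group_hom_axioms_def group_F group_SL2 specialise_hom[OF z])
        have "specialise ?z ?y = specialise ?z (\<phi>' (x i)) \<otimes>\<^bsub>SL2\<^esub> inv\<^bsub>SL2\<^esub> specialise ?z (\<psi>' (x i))"
          using cl by simp
        ultimately have "pres_lift SL2 g ?y = \<one>\<^bsub>SL2\<^esub>" using cl s.H.r_inv by simp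
        then show False using g(2) by simp
      qed
      then show "\<phi>' (x i) = \<psi>' (x i)"
        using cl by (metis inv_equality inv_inv inv_closed)
    qed
    then show "\<phi> = \<psi>" using \<phi> \<psi> K.inv_inv unfolding \<phi>'_def \<psi>'_def by metis
  qed
qed

end

section \<open>A bound for the dimension of a rationally parametrised algebraic set\<close>

text \<open>A homogeneous linear system with more unknowns than equations has a nontrivial solution: the
  equation \<open>m\<close> is used to eliminate the unknown \<open>e0\<close>.\<close>

lemma homogeneous_system_solution:
  fixes a :: "'e \<Rightarrow> 'm \<Rightarrow> 'k::field"
  assumes "finite M" "finite E" "card M < card E"
  shows "\<exists>c. (\<exists>e\<in>E. c e \<noteq> 0) \<and> (\<forall>m\<in>M. (\<Sum>e\<in>E. c e * a e m) = 0)"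
  using assms
proof (induction M arbitrary: E a rule: finite_induct)
  case empty
  then have "E \<noteq> {}" by auto
  then show ?case by (intro exI[of _ "\<lambda>_. 1"]) auto
next
  case (insert m M)
  show ?case
  proof (cases "\<forall>e\<in>E. a e m = 0")
    case True
    obtain c where c: "\<exists>e\<in>E. c e \<noteq> 0" "\<forall>m\<in>M. (\<Sum>e\<in>E. c e * a e m) = 0"
      using insert.IH[of E a] insert.prems insert.hyps by auto
    then show ?thesis using True by (intro exI[of _ c]) auto
  next
    case False
    then obtain e0 where e0: "e0 \<in> E" "a e0 m \<noteq> 0" by blast
    define E' where "E' = E - {e0}"
    have E: "E = insert e0 E'" "e0 \<notin> E'" "finite E'" using e0 insert.prems by (auto simp: E'_def)
    have "card M < card E'" using insert E by auto
    from insert.IH[OF E(3) this, of "\<lambda>e m'. a e m' - a e m / a e0 m * a e0 m'"]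
    obtain c where c: "\<exists>e\<in>E'. c e \<noteq> 0"
      "\<forall>m'\<in>M. (\<Sum>e\<in>E'. c e * (a e m' - a e m / a e0 m * a e0 m')) = 0" by blast
    define c' where "c' = c(e0 := - (\<Sum>e\<in>E'. c e * a e m) / a e0 m)"
    have same: "(\<Sum>e\<in>E'. c' e * a e m') = (\<Sum>e\<in>E'. c e * a e m')" for m'
      using E(2) by (intro sum.cong) (auto simp: c'_def)
    have sum: "(\<Sum>e\<in>E. c' e * a e m') = (\<Sum>e\<in>E'. c e * a e m') - (\<Sum>e\<in>E'. c e * a e m) / a e0 m * a e0 m'" for m'
      unfolding E(1) using E(2,3) same by (simp add: c'_def)
    have "(\<Sum>e\<in>E. c' e * a e m') = (\<Sum>e\<in>E'. c e * (a e m' - a e m / a e0 m * a e0 m'))" for m'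
      unfolding sum by (simp add: algebra_simps sum_subtractf sum_distrib_left sum_divide_distrib)
    moreover have "(\<Sum>e\<in>E. c' e * a e m) = 0" unfolding sum using e0 by simp
    moreover have "\<exists>e\<in>E. c' e \<noteq> 0" using c(1) E by (auto simp: c'_def)
    ultimately show ?thesis using c(2) by (intro exI[of _ c']) auto
  qed
qed

definition exponents :: "nat \<Rightarrow> nat \<Rightarrow> nat list set" where
  "exponents l N = {e. set e \<subseteq> {..N} \<and> length e = l}"

lemma finite_exponents [simp]: "finite (exponents l N)"
  unfolding exponents_def by (rule finite_lists_length_eq) simp

lemma card_exponents: "card (exponents l N) = (N + 1) ^ l"
  unfolding exponents_def by (subst card_lists_length_eq) auto

lemma exponents_0: "exponents 0 N = {[]}"
  by (auto simp: exponents_def)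

lemma sum_exponents_Suc:
  fixes h :: "nat list \<Rightarrow> 'a::comm_monoid_add"
  shows "(\<Sum>e\<in>exponents (Suc l) N. h e) = (\<Sum>r\<le>N. \<Sum>e\<in>exponents l N. h (r # e))"
proof -
  have eq: "exponents (Suc l) N = (\<lambda>(r, e). r # e) ` ({..N} \<times> exponents l N)"
  proof (intro equalityI subsetI)
    fix e assume "e \<in> exponents (Suc l) N"
    then show "e \<in> (\<lambda>(r, e). r # e) ` ({..N} \<times> exponents l N)"
      by (cases e) (auto simp: exponents_def)
  qed (auto simp: exponents_def)
  have inj: "inj_on (\<lambda>(r, e). r # e) ({..N} \<times> exponents l N)" by (auto simp: inj_on_def)
  show ?thesis unfolding eq sum.reindex[OF inj] sum.cartesian_product
    by (intro sum.cong) auto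
qed

text \<open>The entry at the head of the list is the exponent of the last polynomial, because the induction along the chain
  splits off its last member.\<close>

primrec power_product :: "(nat \<Rightarrow> 'k::comm_semiring_1 mpol) \<Rightarrow> nat list \<Rightarrow> 'k mpol" where
  "power_product p [] = 1"
| "power_product p (r # e) = p (length e) ^ r * power_product p e"

lemma polys_power: "f \<in> polys n \<Longrightarrow> f ^ e \<in> polys n"
  by (induction e) (auto intro: polys_mult)

lemma mpeval_power: "mpeval (f ^ e) x = mpeval f x ^ e"
  by (induction e) (auto simp: mpeval_mult)

lemma polys_sum: "(\<And>i. i \<in> I \<Longrightarrow> f i \<in> polys n) \<Longrightarrow> (\<Sum>i\<in>I. f i) \<in> polys n"
proof (induction I rule: infinite_finite_induct)
  case (insert i I)
  then show ?case by (simp add: polys_add)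
qed (simp_all add: polys_def)

lemma power_product_polys: "(\<And>i. i < length e \<Longrightarrow> p i \<in> polys n) \<Longrightarrow> power_product p e \<in> polys n"
  by (induction e) (auto intro!: polys_mult polys_power)

text \<open>Algebraic independence along a chain. In a relation on \<open>C (l + 1)\<close>, ordered by powers of \<open>p l\<close>, the constant term is
  a relation on \<open>C l\<close>, where \<open>p l\<close> vanishes, so its coefficients are zero by induction. What remains is divisible by \<open>p l\<close>,
  which can be cancelled on \<open>C (l + 1)\<close>; this lowers the degree in \<open>p l\<close>.\<close>

lemma power_products_independent:
  fixes p :: "nat \<Rightarrow> 'k::field mpol" and C :: "nat \<Rightarrow> 'k list set"
  assumes "C 0 \<noteq> {}"
    and mono: "\<And>i. i < l \<Longrightarrow> C i \<subseteq> C (Suc i)"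
    and p: "\<And>i. i < l \<Longrightarrow> p i \<in> polys n"
    and vanish: "\<And>i x. i < l \<Longrightarrow> x \<in> C i \<Longrightarrow> mpeval (p i) x = 0"
    and cancel: "\<And>i q. i < l \<Longrightarrow> q \<in> polys n \<Longrightarrow> (\<And>x. x \<in> C (Suc i) \<Longrightarrow> mpeval (p i * q) x = 0) \<Longrightarrow>
      (\<And>x. x \<in> C (Suc i) \<Longrightarrow> mpeval q x = 0)"
    and rel: "\<And>x. x \<in> C l \<Longrightarrow> (\<Sum>e\<in>exponents l N. c e * mpeval (power_product p e) x) = 0"
  shows "\<forall>e\<in>exponents l N. c e = 0"
  using mono p vanish cancel rel
proof (induction l arbitrary: c)
  case 0
  then show ?case using assms(1) by (auto simp: exponents_0)
next
  case (Suc l)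
  note mono = Suc.prems(1) and p = Suc.prems(2) and vanish = Suc.prems(3) and cancel = Suc.prems(4)
  have low: "\<forall>e\<in>exponents l N. b e = 0"
    if "\<And>x. x \<in> C l \<Longrightarrow> (\<Sum>e\<in>exponents l N. b e * mpeval (power_product p e) x) = 0" for b
    by (rule Suc.IH[OF _ _ _ _ that]) (use Suc.prems(1-4) less_SucI in blast)+
  have len: "length e = l" if "e \<in> exponents l N" for e using that by (simp add: exponents_def)
  have all: "\<forall>r\<le>s. \<forall>e\<in>exponents l N. d r e = 0"
    if "\<And>x. x \<in> C (Suc l) \<Longrightarrow>
      (\<Sum>r\<le>s. \<Sum>e\<in>exponents l N. d r e * (mpeval (p l) x ^ r * mpeval (power_product p e) x)) = 0" for s d
    using that
  proof (induction s arbitrary: d)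
    case 0
    then have "(\<Sum>e\<in>exponents l N. d 0 e * mpeval (power_product p e) x) = 0" if "x \<in> C l" for x
      using Suc.prems(1)[of l] that by auto
    then show ?case using low by simp
  next
    case (Suc s)
    have d0: "\<forall>e\<in>exponents l N. d 0 e = 0"
    proof (rule low)
      fix x assume x: "x \<in> C l"
      then have "x \<in> C (Suc l)" using mono[of l] by blast
      from Suc.prems[OF this] have "(\<Sum>e\<in>exponents l N. d 0 e * mpeval (power_product p e) x)
          + (\<Sum>r\<le>s. \<Sum>e\<in>exponents l N. d (Suc r) e * (mpeval (p l) x ^ Suc r * mpeval (power_product p e) x)) = 0"
        by (simp only: sum.atMost_Suc_shift power_0 mult_1)
      moreover have "mpeval (p l) x = 0"
        using vanish[of l] x by blast
      ultimately show "(\<Sum>e\<in>exponents l N. d 0 e * mpeval (power_product p e) x) = 0" by simp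
    qed
    define q where "q = (\<Sum>r\<le>s. \<Sum>e\<in>exponents l N. const_mpol (d (Suc r) e) * (p l ^ r * power_product p e))"
    have pp: "p i \<in> polys n" if "i < Suc l" for i using p[OF that] .
    have "q \<in> polys n"
      unfolding q_def using pp len
      by (intro polys_sum polys_mult polys_power power_product_polys const_mpol_polys) auto
    moreover have q: "mpeval q x = (\<Sum>r\<le>s. \<Sum>e\<in>exponents l N.
        d (Suc r) e * (mpeval (p l) x ^ r * mpeval (power_product p e) x))" for x
      by (simp add: q_def mpeval_sum mpeval_mult mpeval_power)
    have "mpeval (p l * q) x = 0" if "x \<in> C (Suc l)" for x
    proof -
      have "(\<Sum>r\<le>Suc s. \<Sum>e\<in>exponents l N. d r e * (mpeval (p l) x ^ r * mpeval (power_product p e) x)) = 0"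
        using Suc.prems that by blast
      then have "(\<Sum>r\<le>s. \<Sum>e\<in>exponents l N. d (Suc r) e * (mpeval (p l) x ^ Suc r * mpeval (power_product p e) x)) = 0"
        using d0 by (simp only: sum.atMost_Suc_shift) simp
      then show ?thesis by (simp add: mpeval_mult q sum_distrib_left mult_ac)
    qed
    ultimately have "mpeval q x = 0" if "x \<in> C (Suc l)" for x
      using cancel[of l q x] that by blast
    then have "\<forall>r\<le>s. \<forall>e\<in>exponents l N. d (Suc r) e = 0"
      using Suc.IH[of "\<lambda>r. d (Suc r)"] unfolding q by blast
    then show ?case using d0 by (metis Suc_le_mono not0_implies_Suc)
  qed
  have "\<forall>r\<le>N. \<forall>e\<in>exponents l N. c (r # e) = 0"
  proof (rule all)
    fix x assume "x \<in> C (Suc l)"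
    from Suc.prems(5)[OF this]
    show "(\<Sum>r\<le>N. \<Sum>e\<in>exponents l N. c (r # e) * (mpeval (p l) x ^ r * mpeval (power_product p e) x)) = 0"
      unfolding sum_exponents_Suc by (simp add: len mpeval_mult mpeval_power cong: sum.cong)
  qed
  then show ?case
    by (auto simp: exponents_def length_Suc_conv)
qed

definition degrees_le :: "nat \<Rightarrow> 'k::comm_semiring_1 mpol \<Rightarrow> bool" where
  "degrees_le D p \<longleftrightarrow> (\<forall>\<mu>\<in>Poly_Mapping.keys p. \<forall>i. Poly_Mapping.lookup \<mu> i \<le> D)"

lemma degrees_le_mono: "degrees_le D p \<Longrightarrow> D \<le> D' \<Longrightarrow> degrees_le D' p"
  unfolding degrees_le_def by (meson order.trans)

lemma degrees_le_mult:
  assumes "degrees_le D p" "degrees_le D' q"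
  shows "degrees_le (D + D') (p * q)"
  unfolding degrees_le_def
proof (intro ballI allI)
  fix \<mu> i assume "\<mu> \<in> Poly_Mapping.keys (p * q)"
  then obtain a b where "\<mu> = a + b" "a \<in> Poly_Mapping.keys p" "b \<in> Poly_Mapping.keys q"
    using Poly_Mapping.keys_mult[of p q] by blast
  then show "Poly_Mapping.lookup \<mu> i \<le> D + D'"
    using assms by (auto simp: degrees_le_def lookup_add intro: add_mono)
qed

lemma degrees_le_one [simp]: "degrees_le 0 1"
  by (simp add: degrees_le_def)

lemma degrees_le_power: "degrees_le D p \<Longrightarrow> degrees_le (e * D) (p ^ e)"
  by (induction e) (auto intro: degrees_le_mult)

lemma degrees_le_power_product:
  "(\<And>i. i < length e \<Longrightarrow> degrees_le D (p i)) \<Longrightarrow> degrees_le (sum_list e * D) (power_product p e)"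
  by (induction e) (auto simp: distrib_right intro!: degrees_le_mult degrees_le_power)

lemma ex_degrees_le: "\<exists>D. degrees_le D p"
proof -
  let ?S = "(\<Union>\<mu>\<in>Poly_Mapping.keys p. Poly_Mapping.lookup \<mu> ` Poly_Mapping.keys \<mu>)"
  have "finite ?S" by simp
  then obtain D where D: "\<And>s. s \<in> ?S \<Longrightarrow> s \<le> D" by (meson finite_nat_set_iff_bounded_le)
  have "degrees_le D p"
    unfolding degrees_le_def
  proof (intro ballI allI)
    fix \<mu> i assume \<mu>: "\<mu> \<in> Poly_Mapping.keys p"
    show "Poly_Mapping.lookup \<mu> i \<le> D"
    proof (cases "i \<in> Poly_Mapping.keys \<mu>")
      case True
      then show ?thesis using \<mu> by (intro D) blast
    qed (simp add: in_keys_iff)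
  qed
  then show ?thesis by blast
qed

definition monomials :: "nat \<Rightarrow> nat \<Rightarrow> (nat \<Rightarrow>\<^sub>0 nat) set" where
  "monomials m D = {\<mu>. Poly_Mapping.keys \<mu> \<subseteq> {..<m} \<and> (\<forall>i. Poly_Mapping.lookup \<mu> i \<le> D)}"

lemma monomials_bound: "finite (monomials m D)" "card (monomials m D) \<le> (D + 1) ^ m"
proof -
  let ?f = "\<lambda>\<mu>. map (Poly_Mapping.lookup \<mu>) [0..<m]"
  have inj: "inj_on ?f (monomials m D)"
  proof (rule inj_onI, rule poly_mapping_eqI)
    fix \<mu> \<nu> i assume \<mu>: "\<mu> \<in> monomials m D" and \<nu>: "\<nu> \<in> monomials m D" and eq: "?f \<mu> = ?f \<nu>"
    show "Poly_Mapping.lookup \<mu> i = Poly_Mapping.lookup \<nu> i"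
    proof (cases "i < m")
      case True
      then show ?thesis using arg_cong[OF eq, of "\<lambda>l. l ! i"] by simp
    next
      case False
      then have "i \<notin> Poly_Mapping.keys \<mu>" "i \<notin> Poly_Mapping.keys \<nu>"
        using \<mu> \<nu> by (auto simp: monomials_def)
      then show ?thesis by (simp add: in_keys_iff)
    qed
  qed
  have sub: "?f ` monomials m D \<subseteq> exponents m D"
    by (auto simp: monomials_def exponents_def)
  then show "finite (monomials m D)" using inj by (meson finite_exponents finite_imageD finite_subset)
  show "card (monomials m D) \<le> (D + 1) ^ m"
    using card_inj_on_le[OF inj sub] by (simp add: card_exponents)
qed

lemma irreducible_zero_product:
  assumes "irreducible_in (Top (algebraic_set n Z)) A" "p \<in> polys n" "q \<in> polys n"
    and "\<And>x. x \<in> A \<Longrightarrow> mpeval (p * q) x = 0"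
  shows "(\<forall>x\<in>A. mpeval p x = 0) \<or> (\<forall>x\<in>A. mpeval q x = 0)"
proof -
  let ?T = "Top (algebraic_set n Z)"
  have A: "A \<subseteq> topspace ?T" using assms(1) by (simp add: irreducible_in_def)
  have cl: "closedin ?T {x \<in> topspace ?T. mpeval f x = 0}" if "f \<in> polys n" for f
  proof -
    have "topspace ?T - {x \<in> topspace ?T. mpeval f x = 0} = {x \<in> affine_points n \<inter> Z. mpeval f x \<noteq> 0}"
      by auto
    then show ?thesis unfolding closedin_def using openin_algebraic_set_nonzero[OF that, of Z] by auto
  qed
  have "A \<subseteq> {x \<in> topspace ?T. mpeval p x = 0} \<union> {x \<in> topspace ?T. mpeval q x = 0}"
    using A assms(4) by (auto simp: mpeval_mult)
  then have "A \<subseteq> {x \<in> topspace ?T. mpeval p x = 0} \<or> A \<subseteq> {x \<in> topspace ?T. mpeval q x = 0}"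
    using assms(1) cl[OF assms(2)] cl[OF assms(3)] unfolding irreducible_in_def by blast
  then show ?thesis by auto
qed

lemma separating_polynomial:
  assumes "closedin (Top (algebraic_set n Z)) A" "A \<subset> B" "B \<subseteq> topspace (Top (algebraic_set n Z))"
  obtains p y where "p \<in> polys n" "\<And>x. x \<in> A \<Longrightarrow> mpeval p x = 0" "y \<in> B" "mpeval p y \<noteq> 0"
proof -
  let ?T = "Top (algebraic_set n Z)"
  obtain y where y: "y \<in> B" "y \<notin> A" using assms(2) by blast
  obtain F where F: "F \<subseteq> polys n" "topspace ?T - A = {x \<in> affine_points n \<inter> Z. \<exists>f\<in>F. mpeval f x \<noteq> 0}"
    using assms(1) unfolding closedin_def openin_algebraic_set by blast
  have "y \<in> topspace ?T - A" using y assms(3) by blast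
  then obtain f where f: "f \<in> F" "mpeval f y \<noteq> 0" unfolding F(2) by blast
  have "mpeval f x = 0" if "x \<in> A" for x
  proof (rule ccontr)
    assume "mpeval f x \<noteq> 0"
    moreover have "x \<in> topspace ?T" using closedin_subset[OF assms(1)] that by blast
    ultimately have "x \<in> topspace ?T - A" unfolding F(2) using f by auto
    then show False using that by blast
  qed
  then show ?thesis using that[of f y] f F(1) y by blast
qed

text \<open>The map \<open>\<psi>\<close> from affine \<open>m\<close>-space has coordinates with denominators that are powers of \<open>d\<close>, and it is dominant.\<close>

theorem top_dim_le_of_rational_parametrisation:
  fixes \<psi> :: "'k::field list \<Rightarrow> 'k list" and d :: "'k mpol"
  assumes d: "d \<in> polys m"
    and rational: "\<And>i. i < n \<Longrightarrow> \<exists>q\<in>polys m. \<exists>E. \<forall>u\<in>affine_points m.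
      mpeval d u \<noteq> 0 \<longrightarrow> mpeval q u = mpeval d u ^ E * (\<psi> u ! i)"
    and dense: "\<And>p. p \<in> polys n \<Longrightarrow> (\<And>u. u \<in> affine_points m \<Longrightarrow> mpeval d u \<noteq> 0 \<Longrightarrow> mpeval p (\<psi> u) = 0) \<Longrightarrow>
      (\<And>z. z \<in> topspace (Top (algebraic_set n Z)) \<Longrightarrow> mpeval p z = 0)"
  shows "top_dim (Top (algebraic_set n Z)) \<le> enat m"
  unfolding top_dim_def
proof (rule Sup_least, clarify)
  let ?T = "Top (algebraic_set n Z)"
  fix l and C :: "nat \<Rightarrow> 'k list set"
  assume C: "\<forall>i\<le>l. closedin ?T (C i) \<and> irreducible_in ?T (C i)" "\<forall>i<l. C i \<subset> C (Suc i)"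
  have sub: "C i \<subseteq> topspace ?T" if "i \<le> l" for i using C(1) that by (simp add: irreducible_in_def)
  have "\<exists>p y. p \<in> polys n \<and> (\<forall>x\<in>C i. mpeval p x = 0) \<and> y \<in> C (Suc i) \<and> mpeval p y \<noteq> 0" if "i < l" for i
    using separating_polynomial[of n Z "C i" "C (Suc i)"] C that sub[of "Suc i"]
    by (metis Suc_leI less_imp_le)
  then obtain p y where p: "\<And>i. i < l \<Longrightarrow> p i \<in> polys n" "\<And>i x. i < l \<Longrightarrow> x \<in> C i \<Longrightarrow> mpeval (p i) x = 0"
    and y: "\<And>i. i < l \<Longrightarrow> y i \<in> C (Suc i)" "\<And>i. i < l \<Longrightarrow> mpeval (p i) (y i) \<noteq> 0" by metis
  define good where "good u \<longleftrightarrow> u \<in> affine_points m \<and> mpeval d u \<noteq> 0" for u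
  define S where "S f \<longleftrightarrow> (\<exists>q\<in>polys m. \<exists>E. \<forall>u. good u \<longrightarrow> mpeval q u = mpeval d u ^ E * f u)" for f
  have S: "S (\<lambda>u. mpeval p (\<psi> u))" if "p \<in> polys n" for p
  proof (rule mpeval_closed[of S, OF _ _ _ _ that])
    show "S (\<lambda>_. c)" for c
      unfolding S_def by (intro bexI[of _ "const_mpol c"] exI[of _ 0]) auto
    show "S (\<lambda>u. \<psi> u ! i)" if "i < n" for i
      unfolding S_def good_def using rational[OF that] by blast
    fix f g assume "S f" "S g"
    then obtain q E q' E' where q: "q \<in> polys m" "q' \<in> polys m"
      "\<And>u. good u \<Longrightarrow> mpeval q u = mpeval d u ^ E * f u"
      "\<And>u. good u \<Longrightarrow> mpeval q' u = mpeval d u ^ E' * g u" unfolding S_def by blast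
    show "S (\<lambda>u. f u + g u)"
      unfolding S_def using q d
      by (intro bexI[of _ "d ^ E' * q + d ^ E * q'"] exI[of _ "E + E'"])
        (auto simp: mpeval_add mpeval_mult mpeval_power power_add algebra_simps
          intro!: polys_add polys_mult polys_power)
    show "S (\<lambda>u. f u * g u)"
      unfolding S_def using q d
      by (intro bexI[of _ "q * q'"] exI[of _ "E + E'"])
        (auto simp: mpeval_mult power_add algebra_simps intro!: polys_mult)
  qed
  have "\<exists>q E. q \<in> polys m \<and> (\<forall>u. good u \<longrightarrow> mpeval q u = mpeval d u ^ E * mpeval (p i) (\<psi> u))" if "i < l" for i
    using S[OF p(1)[OF that]] unfolding S_def by blast
  then obtain q0 E0 where q0: "\<And>i. i < l \<Longrightarrow> q0 i \<in> polys m"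
    "\<And>i u. i < l \<Longrightarrow> good u \<Longrightarrow> mpeval (q0 i) u = mpeval d u ^ E0 i * mpeval (p i) (\<psi> u)" by metis
\<comment> \<open>one exponent that clears the denominators of all the \<open>p i\<close>\<close>
  define E where "E = (\<Sum>i<l. E0 i)"
  have E0: "E0 i \<le> E" if "i < l" for i
    unfolding E_def using that by (intro member_le_sum) auto
  define q where "q i = d ^ (E - E0 i) * q0 i" for i
  have q: "q i \<in> polys m" "good u \<Longrightarrow> mpeval (q i) u = mpeval d u ^ E * mpeval (p i) (\<psi> u)" if "i < l" for i u
    using q0[of i] d that E0[OF that]
    by (auto simp: q_def mpeval_mult mpeval_power power_add[symmetric] mult.assoc[symmetric] intro!: polys_mult polys_power)
  obtain Dd where Dd: "degrees_le Dd d" using ex_degrees_le by blast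
  have "\<forall>i. \<exists>D. degrees_le D (q i)" using ex_degrees_le by blast
  then obtain Dq where Dq: "\<And>i. degrees_le (Dq i) (q i)" by metis
  define D where "D = Dd + (\<Sum>i<l. Dq i)"
  have D: "degrees_le D d" "i < l \<Longrightarrow> degrees_le D (q i)" for i
    using Dd degrees_le_mono[OF Dq[of i], of D] member_le_sum[of i "{..<l}" Dq]
    by (auto simp: D_def intro: degrees_le_mono)
  show "enat l \<le> enat m"
  proof (rule ccontr)
    assume "\<not> enat l \<le> enat m"
    then have lm: "m < l" by simp
\<comment> \<open>\<open>Q e\<close> is the pullback of the monomial with exponents \<open>e\<close>, multiplied by a power of \<open>d\<close> that does not depend on
\<open>e\<close>. It has degrees at most \<open>K N\<close>, and \<open>N\<close> is chosen such that \<open>(K N + 1)\<^sup>m < (N + 1)\<^sup>m\<^sup>+\<^sup>1\<close>.\<close>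
    define K where "K = D * (1 + E) * l"
    define N where "N = (K + 1) ^ m"
    define Q where "Q e = d ^ (E * (l * N - sum_list e)) * power_product q e" for e
    have len: "length e = l" "sum_list e \<le> l * N" if "e \<in> exponents l N" for e
    proof -
      show "length e = l" using that by (simp add: exponents_def)
      have "sum_list f \<le> length f * N" if "set f \<subseteq> {..N}" for f
        using that by (induction f) auto
      from this[of e] have "sum_list e \<le> length e * N" using that by (simp add: exponents_def)
      then show "sum_list e \<le> l * N" using \<open>length e = l\<close> by simp
    qed
    have Q: "mpeval (Q e) u = mpeval d u ^ (E * (l * N)) * mpeval (power_product p e) (\<psi> u)"
      if e: "e \<in> exponents l N" and u: "good u" for e u
    proof -
      have "mpeval (power_product q e) u = mpeval d u ^ (E * sum_list e) * mpeval (power_product p e) (\<psi> u)"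
        if "length e \<le> l" for e
        using that u
        by (induction e) (simp_all add: mpeval_mult mpeval_power q(2) power_mult_distrib power_add
            distrib_left power_mult[symmetric] mult_ac)
      moreover have "E * (l * N - sum_list e) + E * sum_list e = E * (l * N)"
        using len(2)[OF e] by (simp add: distrib_left[symmetric])
      ultimately show ?thesis
        using len(1)[OF e] by (simp add: Q_def mpeval_mult mpeval_power power_add[symmetric] mult.assoc[symmetric])
    qed
    have keys: "Poly_Mapping.keys (Q e) \<subseteq> monomials m (K * N)" if e: "e \<in> exponents l N" for e
    proof -
      have "Q e \<in> polys m"
        unfolding Q_def using d q(1) len(1)[OF e] by (intro polys_mult polys_power power_product_polys) auto
      moreover have "degrees_le (E * (l * N - sum_list e) * D + sum_list e * D) (Q e)"
        unfolding Q_def using D len(1)[OF e]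
        by (intro degrees_le_mult degrees_le_power degrees_le_power_product) auto
      moreover have "E * (l * N - sum_list e) * D + sum_list e * D \<le> E * (l * N) * D + l * N * D"
        using len(2)[OF e] by (intro add_mono mult_right_mono mult_left_mono) auto
      moreover have "E * (l * N) * D + l * N * D = K * N" by (simp add: K_def algebra_simps)
      ultimately have "Q e \<in> polys m" "degrees_le (K * N) (Q e)"
        using degrees_le_mono[of _ "Q e" "K * N"] by simp_all
      then show ?thesis by (auto simp: degrees_le_def polys_def monomials_def)
    qed
    have "card (monomials m (K * N)) \<le> (K * N + 1) ^ m" by (rule monomials_bound)
    also have "\<dots> \<le> ((K + 1) * (N + 1)) ^ m" by (intro power_mono) auto
    also have "\<dots> = N * (N + 1) ^ m" by (simp only: power_mult_distrib N_def)
    also have "\<dots> < (N + 1) ^ Suc m" by simp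
    also have "\<dots> \<le> (N + 1) ^ l" using lm by (intro power_increasing) auto
    also have "\<dots> = card (exponents l N)" by (simp only: card_exponents)
    finally obtain c where c: "\<exists>e\<in>exponents l N. c e \<noteq> 0"
      "\<forall>\<mu>\<in>monomials m (K * N). (\<Sum>e\<in>exponents l N. c e * Poly_Mapping.lookup (Q e) \<mu>) = 0"
      using homogeneous_system_solution[OF monomials_bound(1) finite_exponents,
          of m "K * N" l N "\<lambda>e. Poly_Mapping.lookup (Q e)"] by blast
    define R where "R = (\<Sum>e\<in>exponents l N. const_mpol (c e) * power_product p e)"
    have R: "mpeval R x = (\<Sum>e\<in>exponents l N. c e * mpeval (power_product p e) x)" for x
      by (simp add: R_def mpeval_sum mpeval_mult)
    have "R \<in> polys n"
      unfolding R_def using p(1) len(1) by (intro polys_sum polys_mult power_product_polys) auto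
    moreover have "mpeval R (\<psi> u) = 0" if u: "u \<in> affine_points m" "mpeval d u \<noteq> 0" for u
    proof -
      have "good u" using u by (simp add: good_def)
      have "mpeval d u ^ (E * (l * N)) * mpeval R (\<psi> u) = (\<Sum>e\<in>exponents l N. c e * mpeval (Q e) u)"
        unfolding R sum_distrib_left using Q[OF _ \<open>good u\<close>] by (intro sum.cong) (auto simp: mult_ac)
      also have "\<dots> = (\<Sum>e\<in>exponents l N. \<Sum>\<mu>\<in>monomials m (K * N). c e * Poly_Mapping.lookup (Q e) \<mu> * mono_eval \<mu> u)"
        using mpeval_superset[OF monomials_bound(1) keys]
        by (intro sum.cong) (auto simp: sum_distrib_left mult_ac)
      also have "\<dots> = (\<Sum>\<mu>\<in>monomials m (K * N). (\<Sum>e\<in>exponents l N. c e * Poly_Mapping.lookup (Q e) \<mu>) * mono_eval \<mu> u)"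
        by (subst sum.swap) (simp add: sum_distrib_right)
      also have "\<dots> = 0" using c(2) by simp
      finally show ?thesis using u by simp
    qed
    ultimately have R0: "mpeval R z = 0" if "z \<in> topspace ?T" for z using dense that by blast
    have "\<forall>e\<in>exponents l N. c e = 0"
    proof (rule power_products_independent[of C l p n])
      show "C 0 \<noteq> {}" using C(1) by (simp add: irreducible_in_def)
      show "C i \<subseteq> C (Suc i)" if "i < l" for i using C(2) that by blast
      show "p i \<in> polys n" if "i < l" for i by (rule p(1)[OF that])
      show "mpeval (p i) x = 0" if "i < l" "x \<in> C i" for i x by (rule p(2)[OF that])
      show "mpeval g x = 0" if i: "i < l" and g: "g \<in> polys n" "\<And>x. x \<in> C (Suc i) \<Longrightarrow> mpeval (p i * g) x = 0"
        and x: "x \<in> C (Suc i)" for i g x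
        using irreducible_zero_product[of n Z "C (Suc i)" "p i" g] C(1) i g p(1)[OF i] x y[OF i] by auto
      show "(\<Sum>e\<in>exponents l N. c e * mpeval (power_product p e) x) = 0" if "x \<in> C l" for x
        using R0[of x] sub[of l] that unfolding R by blast
    qed
    then show False using c(1) by blast
  qed
qed

section \<open>Dimension and rationality of the variety of tuples\<close>

text \<open>On the open set \<open>a \<noteq> 0\<close> of \<open>SL\<^sub>2\<close> the entry \<open>d\<close> is \<open>(1 + b c) / a\<close>, so \<open>a\<close>, \<open>b\<close>, \<open>c\<close> are coordinates there. Those
  of the \<open>i\<close>-th matrix have the numbers \<open>3 i\<close>, \<open>3 i + 1\<close> and \<open>3 i + 2\<close>.\<close>

definition chart_point :: "nat \<Rightarrow> (nat \<Rightarrow> 'k::field) \<Rightarrow> 'k list" where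
  "chart_point n u = of_mats n (\<lambda>i. (u (3 * i), u (3 * i + 1), u (3 * i + 2),
     (1 + u (3 * i + 1) * u (3 * i + 2)) / u (3 * i)))"

definition chart_coordinate :: "'k list \<Rightarrow> nat \<Rightarrow> 'k" where
  "chart_coordinate z k = z ! (4 * (k div 3) + k mod 3)"

definition chart_domain :: "nat \<Rightarrow> 'k::field list set" where
  "chart_domain n = {z \<in> SL2_tuples n. \<forall>i<n. z ! (4 * i) \<noteq> 0}"

lemma div_mod_3: 
  "(3 * i + 1) div 3 = i" "(3 * i + 2) div 3 = i" "(3 * i + 1) mod 3 = 1" "(3 * i + 2) mod 3 = (2 :: nat)"
  by presburger+

lemma mat_at_chart_point:
  "i < n \<Longrightarrow> mat_at (chart_point n u) i = (u (3 * i), u (3 * i + 1), u (3 * i + 2),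
     (1 + u (3 * i + 1) * u (3 * i + 2)) / u (3 * i))"
  by (simp add: chart_point_def)

lemma nth_chart_point:
  assumes "i < n"
  shows "chart_point n u ! (4 * i) = u (3 * i)" "chart_point n u ! (4 * i + 1) = u (3 * i + 1)"
    "chart_point n u ! (4 * i + 2) = u (3 * i + 2)"
    "chart_point n u ! (4 * i + 3) = (1 + u (3 * i + 1) * u (3 * i + 2)) / u (3 * i)"
  using mat_at_chart_point[OF assms, of u] unfolding mat_at_def prod.inject by blast+

lemma chart_point_in_domain:
  assumes "\<And>i. i < n \<Longrightarrow> u (3 * i) \<noteq> 0"
  shows "chart_point n u \<in> chart_domain n"
proof -
  have "chart_point n u \<in> SL2_tuples n"
    unfolding chart_point_def using assms by (intro of_mats_in_SL2_tuples) simp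
  then show ?thesis using assms nth_chart_point(1)[of _ n u] by (simp add: chart_domain_def)
qed

lemma chart_point_cong: "(\<And>k. k < 3 * n \<Longrightarrow> u k = v k) \<Longrightarrow> chart_point n u = chart_point n v"
  unfolding chart_point_def by (intro of_mats_cong) simp

lemma chart_point_coordinate:
  assumes "z \<in> chart_domain n"
  shows "chart_point n (chart_coordinate z) = z"
proof -
  have z: "z \<in> SL2_tuples n" "\<And>i. i < n \<Longrightarrow> z ! (4 * i) \<noteq> 0"
    using assms by (auto simp: chart_domain_def)
  have "chart_point n (chart_coordinate z) = of_mats n (mat_at z)"
    unfolding chart_point_def
  proof (rule of_mats_cong)
    fix i assume i: "i < n"
    have c: "chart_coordinate z (3 * i) = z ! (4 * i)" "chart_coordinate z (3 * i + 1) = z ! (4 * i + 1)"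
      "chart_coordinate z (3 * i + 2) = z ! (4 * i + 2)"
      unfolding chart_coordinate_def div_mod_3 by simp_all
    have "z ! (4 * i) * z ! (4 * i + 3) = 1 + z ! (4 * i + 1) * z ! (4 * i + 2)"
      using SL2_tuplesD(2)[OF z(1) i] unfolding mat_at_def SL2_carrier by (simp add: algebra_simps)
    then have "(1 + z ! (4 * i + 1) * z ! (4 * i + 2)) / z ! (4 * i) = z ! (4 * i + 3)"
      using z(2)[OF i] by (simp add: divide_eq_eq mult.commute)
    then show "(chart_coordinate z (3 * i), chart_coordinate z (3 * i + 1), chart_coordinate z (3 * i + 2),
        (1 + chart_coordinate z (3 * i + 1) * chart_coordinate z (3 * i + 2)) / chart_coordinate z (3 * i)) = mat_at z i"
      unfolding c mat_at_def by simp
  qed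
  also have "\<dots> = z" by (rule of_mats_mat_at[OF SL2_tuplesD(1)[OF z(1)]])
  finally show ?thesis .
qed

lemma chart_coordinate_point:
  assumes "k < 3 * n"
  shows "chart_coordinate (chart_point n u) k = u k"
proof -
  have k: "k div 3 < n" "3 * (k div 3) + k mod 3 = k" using assms by auto
  have "k mod 3 = 0 \<or> k mod 3 = 1 \<or> k mod 3 = 2" by presburger
  then show ?thesis
    using nth_chart_point(1-3)[OF k(1), of u] k(2) unfolding chart_coordinate_def by (elim disjE) simp_all
qed

lemma openin_chart_domain: "openin (Top (SL2_variety n)) (chart_domain n :: 'k::field list set)"
proof -
  let ?T = "Top (SL2_variety n :: ('k list, 'k) fspace)"
  have "openin ?T ((\<Inter>i\<in>{..<n}. {z \<in> affine_points (4 * n) \<inter> SL2_tuples n. mpeval (var_mpol (4 * i)) z \<noteq> 0})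
      \<inter> topspace ?T)"
    by (intro openin_INT openin_algebraic_set_nonzero) auto
  moreover have "(\<Inter>i\<in>{..<n}. {z \<in> affine_points (4 * n) \<inter> SL2_tuples n. mpeval (var_mpol (4 * i)) z \<noteq> 0})
      \<inter> topspace ?T = chart_domain n"
    by (auto simp: chart_domain_def SL2_tuples_def)
  ultimately show ?thesis by simp
qed

lemma one_in_chart_domain: "chart_point n (\<lambda>_. 1) \<in> chart_domain n"
  by (rule chart_point_in_domain) simp

text \<open>The chart is a rational parametrisation; the product of all the entries \<open>a\<close> is a common denominator.\<close>

theorem top_dim_SL2_variety:
  "top_dim (Top (SL2_variety n :: ('k::alg_closed_field list, 'k) fspace)) \<le> enat (3 * n)"
proof (rule top_dim_le_of_rational_parametrisation[where \<psi> = "\<lambda>u. chart_point n (\<lambda>k. u ! k)"])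
  let ?d = "\<Prod>i<n. var_mpol (3 * i) :: 'k mpol"
  have prod_polys: "(\<Prod>i\<in>I. var_mpol (3 * i)) \<in> polys (3 * n)" if "I \<subseteq> {..<n}" for I
    using that by (induction I rule: infinite_finite_induct) (auto intro!: polys_mult)
  have prod_eval: "mpeval (\<Prod>i\<in>I. var_mpol (3 * i)) u = (\<Prod>i\<in>I. u ! (3 * i))" for I and u :: "'k list"
    by (induction I rule: infinite_finite_induct) (auto simp: mpeval_mult)
  show "?d \<in> polys (3 * n)" by (rule prod_polys) simp
  show "\<exists>q\<in>polys (3 * n). \<exists>E. \<forall>u\<in>affine_points (3 * n). mpeval ?d u \<noteq> 0 \<longrightarrow>
      mpeval q u = mpeval ?d u ^ E * chart_point n (\<lambda>k. u ! k) ! k" if k: "k < 4 * n" for k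
  proof -
    define i where "i = k div 4"
    have i: "i < n" using k by (simp add: i_def)
    have easy: ?thesis if "j < 3 * n" "\<And>u. chart_point n (\<lambda>k. u ! k) ! k = (u ! j :: 'k)" for j
      using that by (intro bexI[of _ "var_mpol j"] exI[of _ 0] ballI impI) simp_all
    have "k = 4 * i \<or> k = 4 * i + 1 \<or> k = 4 * i + 2 \<or> k = 4 * i + 3" unfolding i_def by presburger
    then show ?thesis
    proof (elim disjE)
      assume "k = 4 * i"
      then show ?thesis using nth_chart_point(1)[OF i] i by (intro easy[of "3 * i"]) simp_all
    next
      assume "k = 4 * i + 1"
      then show ?thesis using nth_chart_point(2)[OF i] i by (intro easy[of "3 * i + 1"]) simp_all
    next
      assume "k = 4 * i + 2"
      then show ?thesis using nth_chart_point(3)[OF i] i by (intro easy[of "3 * i + 2"]) simp_all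
    next
      assume k: "k = 4 * i + 3"
      let ?q = "(1 + var_mpol (3 * i + 1) * var_mpol (3 * i + 2)) * (\<Prod>i\<in>{..<n} - {i}. var_mpol (3 * i)) :: 'k mpol"
      have "?q \<in> polys (3 * n)" using i prod_polys[of "{..<n} - {i}"] by (auto intro!: polys_mult polys_add)
      moreover have "mpeval ?q u = mpeval ?d u ^ 1 * chart_point n (\<lambda>k. u ! k) ! k" if "mpeval ?d u \<noteq> 0" for u
      proof -
        define R where "R = (\<Prod>i\<in>{..<n} - {i}. u ! (3 * i))"
        have d: "mpeval ?d u = u ! (3 * i) * R"
          unfolding prod_eval R_def using i by (simp add: prod.remove)
        then have "u ! (3 * i) \<noteq> 0" using that by auto
        moreover have "mpeval ?q u = (1 + u ! (3 * i + 1) * u ! (3 * i + 2)) * R"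
          by (simp add: mpeval_mult mpeval_add prod_eval R_def)
        ultimately show ?thesis unfolding k nth_chart_point(4)[OF i] d by simp
      qed
      ultimately show ?thesis by blast
    qed
  qed
  fix p z assume p: "p \<in> polys (4 * n)" and z: "z \<in> topspace (Top (SL2_variety n :: ('k list, 'k) fspace))"
    and vanish: "\<And>u. u \<in> affine_points (3 * n) \<Longrightarrow> mpeval ?d u \<noteq> 0 \<Longrightarrow> mpeval p (chart_point n (\<lambda>k. u ! k)) = 0"
  let ?N = "{z \<in> affine_points (4 * n) \<inter> SL2_tuples n. mpeval p z \<noteq> 0}"
  show "mpeval p z = 0"
  proof (rule ccontr)
    assume "mpeval p z \<noteq> 0"
    then have "?N \<noteq> {}" using z by auto
    then obtain y where y: "y \<in> chart_domain n" "mpeval p y \<noteq> 0"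
      using SL2_variety_opens_meet[OF openin_algebraic_set_nonzero[OF p] openin_chart_domain] one_in_chart_domain by blast
    let ?u = "map (chart_coordinate y) [0..<3 * n]"
    have "chart_point n (\<lambda>k. ?u ! k) = chart_point n (chart_coordinate y)"
      by (rule chart_point_cong) simp
    then have "chart_point n (\<lambda>k. ?u ! k) = y" using chart_point_coordinate[OF y(1)] by simp
    moreover have "mpeval ?d ?u \<noteq> 0"
      unfolding prod_eval using y(1) by (auto simp: chart_domain_def chart_coordinate_def)
    ultimately show False using vanish[of ?u] y(2) by (simp add: affine_points_def)
  qed
qed

definition to_proj :: "nat \<Rightarrow> 'k::field list \<Rightarrow> 'k list set" where
  "to_proj n z = proj_point (1 # map (chart_coordinate z) [0..<3 * n])"

text \<open>The homogeneous coordinate 0 is the denominator, so the affine coordinate \<open>k\<close> is the homogeneous coordinate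
  \<open>k + 1\<close> divided by it.\<close>

definition of_proj :: "nat \<Rightarrow> 'k::field list set \<Rightarrow> 'k list" where
  "of_proj n P = chart_point n (\<lambda>k. proj_ratio (var_mpol (Suc k)) (var_mpol 0) P)"

definition proj_chart_domain :: "nat \<Rightarrow> 'k::field list set set" where
  "proj_chart_domain n = {P \<in> proj_points (3 * n). \<forall>y\<in>P. y ! 0 \<noteq> 0 \<and> (\<forall>i<n. y ! Suc (3 * i) \<noteq> 0)}"

lemma openin_proj_chart_domain: "openin (proj_zariski (3 * n)) (proj_chart_domain n :: 'k::field list set set)"
proof -
  let ?T = "proj_zariski (3 * n) :: 'k list set topology"
  have "openin ?T ((\<Inter>k\<in>insert 0 ((\<lambda>i. Suc (3 * i)) ` {..<n}).
      {P \<in> proj_points (3 * n). \<forall>y\<in>P. mpeval (var_mpol k) y \<noteq> 0}) \<inter> topspace ?T)"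
    by (intro openin_INT openin_proj_nonzero[of _ _ 1]) auto
  moreover have "(\<Inter>k\<in>insert 0 ((\<lambda>i. Suc (3 * i)) ` {..<n}).
      {P \<in> proj_points (3 * n). \<forall>y\<in>P. mpeval (var_mpol k) y \<noteq> 0}) \<inter> topspace ?T = proj_chart_domain n"
    by (auto simp: proj_chart_domain_def)
  ultimately show ?thesis by simp
qed

lemma proj_ratio_coordinate:
  assumes "P \<in> proj_points (3 * n)" "y \<in> P" "k < 3 * n"
  shows "proj_ratio (var_mpol (Suc k)) (var_mpol 0) P = y ! Suc k / y ! 0"
  using proj_ratio_eq[OF assms(1,2), of "var_mpol (Suc k)" "var_mpol 0" 1] assms(3) by simp

lemma of_proj_in_domain:
  assumes "P \<in> proj_chart_domain n"
  shows "of_proj n P \<in> chart_domain n"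
  unfolding of_proj_def
proof (rule chart_point_in_domain)
  fix i assume i: "i < n"
  have P: "P \<in> proj_points (3 * n)" using assms by (simp add: proj_chart_domain_def)
  obtain y where y: "y \<in> P" using proj_points_nonempty[OF P] by blast
  then have "y ! 0 \<noteq> 0" "y ! Suc (3 * i) \<noteq> 0" using assms i by (auto simp: proj_chart_domain_def)
  then show "proj_ratio (var_mpol (Suc (3 * i))) (var_mpol 0) P \<noteq> 0"
    using proj_ratio_coordinate[OF P y, of "3 * i"] i by simp
qed

lemma rational_chart_SL2_variety:
  "rational_chart (SL2_variety n :: ('k::alg_closed_field list, 'k) fspace) (3 * n)
     (chart_domain n) (proj_chart_domain n) (to_proj n) (of_proj n)"
proof -
  let ?X = "SL2_variety n :: ('k list, 'k) fspace" and ?P = "proj_space (3 * n) :: ('k list set, 'k) fspace"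
  let ?V = "chart_domain n :: 'k list set" and ?W = "proj_chart_domain n :: 'k list set set"
  have V: "openin (Top ?X) ?V" by (rule openin_chart_domain)
  have W: "openin (Top ?P) ?W" by (simp add: openin_proj_chart_domain)
  have topV: "topspace (Top (open_subspace ?X ?V)) = ?V" by (rule topspace_open_subspace[OF V])
  have topW: "topspace (Top (open_subspace ?P ?W)) = ?W" by (rule topspace_open_subspace[OF W])
  interpret V: function_space "open_subspace ?X ?V"
    by (rule function_space_open_subspace[OF function_space_algebraic_set V])
  interpret W: function_space "open_subspace ?P ?W"
    by (rule function_space_open_subspace[OF function_space_proj_space W])
  have nth: "(1 # map (chart_coordinate z) [0..<3 * n]) ! 0 = 1"
    "k < 3 * n \<Longrightarrow> (1 # map (chart_coordinate z) [0..<3 * n]) ! Suc k = chart_coordinate z k" for z :: "'k list" and k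
    by simp_all
  have proj: "to_proj n z \<in> proj_points (3 * n)" for z :: "'k list"
    unfolding to_proj_def by (rule proj_point_in_proj_points) auto
  show ?thesis
  proof (rule rational_chart.intro)
    show "function_space ?X" by (rule function_space_algebraic_set)
    show "A \<inter> B \<noteq> {}" if "openin (Top ?X) A" "openin (Top ?X) B" "A \<noteq> {}" "B \<noteq> {}" for A B
      using that by (rule SL2_variety_opens_meet)
    show "openin (Top ?X) {z \<in> topspace (Top ?X). f z \<noteq> g z}"
      if "morphism ?X ?X f" "morphism ?X ?X g" for f g
    proof -
      have "closedin (affine_zariski (4 * n)) {z \<in> SL2_tuples n. f z = g z}"
        using variety_SL2_variety[of n, where 'k = 'k] closedin_SL2_tuples that
        unfolding variety_def separated_def by blast
      then have "closedin (Top ?X) {z \<in> SL2_tuples n. f z = g z}"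
        unfolding algebraic_set_def fspace.simps by (rule closedin_subset_topspace) auto
      moreover have "topspace (Top ?X) - {z \<in> SL2_tuples n. f z = g z} = {z \<in> topspace (Top ?X). f z \<noteq> g z}"
        by auto
      ultimately show ?thesis unfolding closedin_def by simp
    qed
    show "openin (Top ?X) ?V" by (rule V)
    show "?V \<noteq> {}" using one_in_chart_domain by blast
    show "openin (proj_zariski (3 * n)) ?W" by (rule openin_proj_chart_domain)
    show "morphism (open_subspace ?X ?V) ?P (to_proj n)"
      unfolding to_proj_def
    proof (rule V.morphism_to_proj_space)
      fix k assume k: "k < Suc (3 * n)"
      have o: "openin (Top (open_subspace ?X ?V)) ?V" using openin_topspace[of "Top (open_subspace ?X ?V)"] unfolding topV .
      show "regular (open_subspace ?X ?V) (topspace (Top (open_subspace ?X ?V)))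
          (\<lambda>z. (1 # map (chart_coordinate z) [0..<3 * n]) ! k)"
      proof (cases k)
        case 0
        then show ?thesis unfolding topV using V.regular_const[OF o, of 1] by simp
      next
        case (Suc j)
        then have j: "j < 3 * n" using k by simp
        then have "j div 3 < n" by (intro less_mult_imp_div_less) simp
        moreover have "j mod 3 < 3" by simp
        ultimately have "4 * (j div 3) + j mod 3 < 4 * n" by linarith
        then have "regular ?X ?V (\<lambda>z. chart_coordinate z j)"
          unfolding chart_coordinate_def by (rule regular_coordinate[OF _ V])
        then show ?thesis unfolding topV Suc nth(2)[OF j] by simp
      qed
    qed auto
    show "to_proj n z \<in> ?W" if z: "z \<in> ?V" for z
    proof -
      have "y ! 0 \<noteq> 0 \<and> (\<forall>i<n. y ! Suc (3 * i) \<noteq> 0)" if yz: "y \<in> to_proj n z" for y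
      proof -
        obtain c where c: "c \<noteq> 0" "y = map ((*) c) (1 # map (chart_coordinate z) [0..<3 * n])"
          using in_proj_pointE[OF yz[unfolded to_proj_def]] .
        have "y ! Suc (3 * i) \<noteq> 0" if i: "i < n" for i
        proof -
          have i3: "3 * i < 3 * n" using i by simp
          have "y ! Suc (3 * i) = c * chart_coordinate z (3 * i)"
            unfolding c(2) using i3 nth(2)[OF i3, of z] by (subst nth_map) simp_all
          moreover have "chart_coordinate z (3 * i) = z ! (4 * i)" by (simp add: chart_coordinate_def)
          ultimately show ?thesis using c(1) z i by (simp add: chart_domain_def)
        qed
        then show ?thesis using c by simp
      qed
      then show ?thesis using proj by (auto simp: proj_chart_domain_def)
    qed
    have reg: "regular (open_subspace ?P ?W) ?W (proj_ratio (var_mpol (Suc k)) (var_mpol 0))" if "k < 3 * n" for k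
      unfolding open_subspace_simps using that openin_proj_chart_domain
      by (intro regular_proj_ratio[of _ _ _ 1]) (auto simp: proj_chart_domain_def)
    have oW: "openin (Top (open_subspace ?P ?W)) ?W" using openin_topspace[of "Top (open_subspace ?P ?W)"] unfolding topW .
    show "morphism (open_subspace ?P ?W) ?X (of_proj n)"
    proof (rule W.morphism_to_algebraic_set; unfold topW)
      show "of_proj n P \<in> affine_points (4 * n) \<inter> SL2_tuples n" if "P \<in> ?W" for P
        using of_proj_in_domain[OF that] by (auto simp: chart_domain_def SL2_tuples_def)
      fix k assume k: "k < 4 * n"
      define i where "i = k div 4"
      have i: "i < n" using k by (simp add: i_def)
      then have r: "regular (open_subspace ?P ?W) ?W (proj_ratio (var_mpol (Suc (3 * i))) (var_mpol 0))"
        "regular (open_subspace ?P ?W) ?W (proj_ratio (var_mpol (Suc (3 * i + 1))) (var_mpol 0))"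
        "regular (open_subspace ?P ?W) ?W (proj_ratio (var_mpol (Suc (3 * i + 2))) (var_mpol 0))"
        using reg[of "3 * i"] reg[of "3 * i + 1"] reg[of "3 * i + 2"] by simp_all
      have ne: "proj_ratio (var_mpol (Suc (3 * i))) (var_mpol 0) P \<noteq> 0" if "P \<in> ?W" for P
      proof -
        have "of_proj n P ! (4 * i) \<noteq> 0" using of_proj_in_domain[OF that] i by (simp add: chart_domain_def)
        then show ?thesis unfolding of_proj_def nth_chart_point(1)[OF i] .
      qed
      have "k = 4 * i \<or> k = 4 * i + 1 \<or> k = 4 * i + 2 \<or> k = 4 * i + 3" unfolding i_def by presburger
      then show "regular (open_subspace ?P ?W) ?W (\<lambda>P. of_proj n P ! k)"
      proof (elim disjE)
        assume k: "k = 4 * i + 3"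
        show ?thesis unfolding of_proj_def k nth_chart_point(4)[OF i]
          by (intro W.regular_divide W.regular_add W.regular_mult W.regular_const oW r ne)
      qed (use r in \<open>simp_all only: of_proj_def nth_chart_point[OF i]\<close>)
    qed
    show "of_proj n P \<in> ?V" if "P \<in> ?W" for P by (rule of_proj_in_domain[OF that])
    show "of_proj n (to_proj n z) = z" if z: "z \<in> ?V" for z
    proof -
      have "of_proj n (to_proj n z) = chart_point n (chart_coordinate z)"
        unfolding of_proj_def
      proof (rule chart_point_cong)
        fix k assume k: "k < 3 * n"
        have "1 # map (chart_coordinate z) [0..<3 * n] \<in> to_proj n z" unfolding to_proj_def by (rule proj_point_in)
        from proj_ratio_coordinate[OF proj this k]
        show "proj_ratio (var_mpol (Suc k)) (var_mpol 0) (to_proj n z) = chart_coordinate z k"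
          unfolding nth(2)[OF k] nth(1) by simp
      qed
      then show ?thesis using chart_point_coordinate[OF z] by simp
    qed
    show "to_proj n (of_proj n P) = P" if P: "P \<in> ?W" for P
    proof -
      have P': "P \<in> proj_points (3 * n)" using P by (simp add: proj_chart_domain_def)
      obtain y where y: "y \<in> P" using proj_points_nonempty[OF P'] by blast
      have y0: "y ! 0 \<noteq> 0" using P y by (auto simp: proj_chart_domain_def)
      note yP = proj_point_eq[OF P' y]
      have "1 # map (chart_coordinate (of_proj n P)) [0..<3 * n] = map ((*) (1 / y ! 0)) y"
      proof (rule nth_equalityI)
        fix k assume k: "k < length (1 # map (chart_coordinate (of_proj n P)) [0..<3 * n])"
        show "(1 # map (chart_coordinate (of_proj n P)) [0..<3 * n]) ! k = map ((*) (1 / y ! 0)) y ! k"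
        proof (cases k)
          case 0
          then show ?thesis using y0 yP(2) by simp
        next
          case (Suc j)
          then have j: "j < 3 * n" using k by simp
          have "chart_coordinate (of_proj n P) j = y ! Suc j / y ! 0"
            unfolding of_proj_def chart_coordinate_point[OF j] by (rule proj_ratio_coordinate[OF P' y j])
          then show ?thesis using yP(2) j by (simp add: Suc)
        qed
      qed (simp add: yP(2))
      then show ?thesis
        unfolding to_proj_def using proj_point_scale[of "1 / y ! 0" y] y0 yP(1) by simp
    qed
  qed
qed

section \<open>The bounds\<close>

lemma embedding_bounds:
  fixes k :: "'k::alg_closed_field itself"
  assumes "mon S (AutoGroup (free_group n)) \<noteq> {}"
  shows "Var k S \<le> enat (3 * n)" "Crem k S \<le> enat (3 * n)"
proof -
  let ?X = "SL2_variety n :: ('k list, 'k) fspace"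
  interpret free_group_of_rank n .
  interpret rational_chart ?X "3 * n" "chart_domain n" "proj_chart_domain n" "to_proj n" "of_proj n"
    by (rule rational_chart_SL2_variety)
  obtain f where "f \<in> mon S (AutoGroup (free_group n))" using assms by blast
  then have f: "act_hom \<circ> f \<in> mon S (Aut_variety ?X)" using act_hom_mon by (rule mon_compose)
  have "irreducible_variety ?X"
    unfolding irreducible_variety_def using variety_SL2_variety SL2_variety_irreducible by blast
  then have "Var k S \<le> top_dim (Top ?X)"
    unfolding Var_def using f by (intro Inf_lower) blast
  also have "\<dots> \<le> enat (3 * n)" by (rule top_dim_SL2_variety)
  finally show "Var k S \<le> enat (3 * n)" .
  have "bir_class \<circ> (act_hom \<circ> f) \<in> mon S (Cremona (3 * n))" using f bir_class_mon by (rule mon_compose)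
  then show "Crem k S \<le> enat (3 * n)"
    unfolding Crem_def by (intro Inf_lower) blast
qed

theorem corollary1p7:
  fixes k :: "'k::alg_closed_field itself" and n :: nat
  shows "(n \<ge> 1 \<longrightarrow> Var k (AutoGroup (free_group n)) \<le> enat (3 * n) \<and>
                     Crem k (AutoGroup (free_group n)) \<le> enat (3 * n)) \<and>
         (n \<ge> 3 \<longrightarrow> Var k (braid_group n) \<le> enat (3 * n) \<and>
                     Crem k (braid_group n) \<le> enat (3 * n))"
proof -
  have "(\<lambda>\<phi>. \<phi>) \<in> mon (AutoGroup (free_group n)) (AutoGroup (free_group n))"
    by (simp add: mon_def hom_def)
  then have aut: "mon (AutoGroup (free_group n)) (AutoGroup (free_group n)) \<noteq> {}" by (metis empty_iff)
  have braid: "mon (braid_group n) (AutoGroup (free_group n)) \<noteq> {}"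
    using free_group_of_rank.artin_representation_faithful[of n] by (metis empty_iff)
  show ?thesis
    using embedding_bounds[OF aut, of k] embedding_bounds[OF braid, of k] by simp
qed

end
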